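(* Let $n\equiv 3 \pmod 4$. (1) If $M^n$ is an oriented flat manifold of dimension $n$ with holonomy group $(\mathbb{Z}_2)^{n-1}$ (a Hantzsche–Wendt manifold), then $\eta(M^n)=0$. (2) If $M^n$ is an oriented flat manifold of dimension $n$ with holonomy group $(\mathbb{Z}_2)^{k}$ for some $1\leq k\leq n-2$, such that, with respect to some basis of the translation lattice of $\pi_1(M^n)$, the image of the holonomy representation $(\mathbb{Z}_2)^k\to GL(n,\mathbb{Z})$ consists of diagonal matrices with entries $\pm1$ on the diagonal, then $\eta(M^n)=0$.
   Context: A flat manifold is a closed Riemannian manifold with zero sectional curvature; it is isometric to $\mathbb{R}^n/\Gamma$ with $\Gamma\subset O(n)\ltimes\mathbb{R}^n$ discrete, torsion-free and cocompact. By Bieberbach's theorem there is an exact sequence $0\to\mathbb{Z}^n\to\Gamma\xrightarrow{p} G\to 0$ with $\mathbb{Z}^n=\Gamma\cap\mathbb{R}^n$ the translation lattice and $G$ finite, the holonomy group. The holonomy representation $\phi:G\to GL(n,\mathbb{Z})$ is $\phi(g)(e_i)=\tilde g e_i\tilde g^{-1}$, where $e_1,\dots,e_n$ is a basis of $\mathbb{Z}^n$ and $p(\tilde g)=g$. The $\eta$ invariant of the signature operator. Let $Y$ be a closed oriented Riemannian manifold of dimension $4m-1$, $\ast$ the Hodge duality operator on $Y$ and $d$ the exterior derivative. Define the first order self-adjoint elliptic operator $B$ on differential forms by $B\phi=(-1)^{m+p+1}(\epsilon\ast d-d\ast)\phi$, where $\epsilon=1$ if $\phi$ is a $2p$-form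 and $\epsilon=-1$ if $\phi$ is a $(2p-1)$-form. $B$ preserves the parity of forms; $B^{ev}$ denotes its restriction to even forms. It has pure point spectrum. The function $\eta(s,Y)=\sum_{\lambda\neq 0}\operatorname{sign}(\lambda)\,\dim(\lambda)\,|\lambda|^{-s}$, where the sum is over nonzero eigenvalues $\lambda$ of $B^{ev}$ with multiplicity $\dim(\lambda)$, converges for $\operatorname{Re}(s)$ large, and has a meromorphic continuation to $\mathbb{C}$ which is finite at $s=0$. Put $\eta(Y)=\eta(0,Y)$. *)

theory Defs
  imports
    "HOL-Complex_Analysis.Complex_Analysis"
    "HOL-Algebra.Product_Groups"
    "HOL-Algebra.Elementary_Groups"
    "HOL-Library.Function_Algebras"
begin

section \<open>Flat manifolds as quotients of Euclidean space\<close>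

text \<open>
  A closed flat manifold is isometric to the quotient of Euclidean space by a discrete,
  torsion-free, cocompact group of rigid motions, which is then its fundamental group; it is
  represented by that group. The pair (A, a) stands for the rigid motion sending x to A x + a.
\<close>

type_synonym 'n rigid_motion = "(real^'n^'n) \<times> (real^'n)"

definition act :: "'n::finite rigid_motion \<Rightarrow> real^'n \<Rightarrow> real^'n" where
  "act g x = fst g *v x + snd g"

definition euclidean_group :: "'n::finite rigid_motion monoid" where
  "euclidean_group =
     \<lparr>carrier = {g. orthogonal_matrix (fst g)},
      monoid.mult = (\<lambda>g h. (fst g ** fst h, fst g *v snd h + snd g)),
      one = (mat 1, 0)\<rparr>"

definition torsion_free :: "'n::finite rigid_motion set \<Rightarrow> bool" where
  "torsion_free \<Gamma> \<longleftrightarrow>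
     (\<forall>g\<in>\<Gamma>. \<forall>k::nat. k > 0 \<and> g [^]\<^bsub>euclidean_group\<^esub> k = \<one>\<^bsub>euclidean_group\<^esub>
        \<longrightarrow> g = \<one>\<^bsub>euclidean_group\<^esub>)"

definition cocompact :: "'n::finite rigid_motion set \<Rightarrow> bool" where
  "cocompact \<Gamma> \<longleftrightarrow> (\<exists>K. compact K \<and> (\<Union>g\<in>\<Gamma>. act g ` K) = UNIV)"

definition flat_manifold_group :: "'n::finite rigid_motion set \<Rightarrow> bool" where
  "flat_manifold_group \<Gamma> \<longleftrightarrow>
     subgroup \<Gamma> euclidean_group \<and> discrete \<Gamma> \<and> torsion_free \<Gamma> \<and> cocompact \<Gamma>"

text \<open>The quotient carries the orientation induced from the standard one of Euclidean space.\<close>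

definition oriented_flat_manifold_group :: "'n::finite rigid_motion set \<Rightarrow> bool" where
  "oriented_flat_manifold_group \<Gamma> \<longleftrightarrow> flat_manifold_group \<Gamma> \<and> (\<forall>g\<in>\<Gamma>. det (fst g) = 1)"

section \<open>Holonomy\<close>

definition translation :: "real^'n \<Rightarrow> 'n::finite rigid_motion" where
  "translation v = (mat 1, v)"

definition translation_lattice :: "'n::finite rigid_motion set \<Rightarrow> (real^'n) set" where
  "translation_lattice \<Gamma> = {v. translation v \<in> \<Gamma>}"

text \<open>
  The projection p from the group onto its holonomy group is the linear part, whose kernel
  consists of the translations.
\<close>

definition holonomy_group :: "'n::finite rigid_motion set \<Rightarrow> (real^'n^'n) monoid" where
  "holonomy_group \<Gamma> = \<lparr>carrier = fst ` \<Gamma>, monoid.mult = (**), one = mat 1\<rparr>"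

definition elementary_two_group :: "nat \<Rightarrow> (nat \<Rightarrow> int) monoid" where
  "elementary_two_group k = product_group {..<k} (\<lambda>_. integer_mod_group 2)"

definition int_combination :: "('n \<Rightarrow> real^'n) \<Rightarrow> int^'n \<Rightarrow> real^'n::finite" where
  "int_combination b c = (\<Sum>i\<in>UNIV. real_of_int (c $ i) *\<^sub>R b i)"

definition lattice_basis :: "'n::finite rigid_motion set \<Rightarrow> ('n \<Rightarrow> real^'n) \<Rightarrow> bool" where
  "lattice_basis \<Gamma> b \<longleftrightarrow>
     (\<forall>i. b i \<in> translation_lattice \<Gamma>) \<and>
     (\<forall>v\<in>translation_lattice \<Gamma>. \<exists>!c. v = int_combination b c)"

definition holonomy_representation ::
    "'n::finite rigid_motion set \<Rightarrow> ('n \<Rightarrow> real^'n) \<Rightarrow> real^'n^'n \<Rightarrow> int^'n^'n" where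
  "holonomy_representation \<Gamma> b A =
     (THE M. \<forall>g\<in>\<Gamma>. fst g = A \<longrightarrow>
        (\<forall>j. g \<otimes>\<^bsub>euclidean_group\<^esub> translation (b j) \<otimes>\<^bsub>euclidean_group\<^esub> inv\<^bsub>euclidean_group\<^esub> g
             = translation (int_combination b (column j M))))"

definition sign_diagonal :: "int^'n^'n \<Rightarrow> bool" where
  "sign_diagonal M \<longleftrightarrow>
     (\<forall>i j. i \<noteq> j \<longrightarrow> M $ i $ j = 0) \<and> (\<forall>i. M $ i $ i = 1 \<or> M $ i $ i = -1)"

section \<open>Differential forms\<close>

text \<open>
  A form of mixed degree assigns to a point x and a list of p tangent vectors the value of its
  degree p component at x on these vectors. Differential forms on the quotient are the smooth
  forms on Euclidean space that are invariant under pullback by the group. Since the operators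
  below are real with real eigenvalues, real forms give the same spectrum and multiplicities
  as complex ones.
\<close>

type_synonym 'n form = "real^'n \<Rightarrow> (real^'n) list \<Rightarrow> real"

definition alternating_multilinear :: "((real^'n::finite) list \<Rightarrow> real) \<Rightarrow> bool" where
  "alternating_multilinear \<alpha> \<longleftrightarrow>
     (\<forall>us ws. linear (\<lambda>v. \<alpha> (us @ v # ws))) \<and>
     (\<forall>us vs ws v. \<alpha> (us @ v # vs @ v # ws) = 0)"

fun C_k :: "nat \<Rightarrow> (real^'n::finite \<Rightarrow> real) \<Rightarrow> bool" where
  "C_k 0 f \<longleftrightarrow> continuous_on UNIV f"
| "C_k (Suc k) f \<longleftrightarrow>
     (\<forall>x. f differentiable (at x)) \<and> (\<forall>v. C_k k (\<lambda>x. frechet_derivative f (at x) v))"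

definition smooth_form :: "'n::finite form \<Rightarrow> bool" where
  "smooth_form \<omega> \<longleftrightarrow>
     (\<forall>x. alternating_multilinear (\<omega> x)) \<and> (\<forall>vs k. C_k k (\<lambda>x. \<omega> x vs))"

definition pullback :: "'n::finite rigid_motion \<Rightarrow> 'n form \<Rightarrow> 'n form" where
  "pullback g \<omega> = (\<lambda>x vs. \<omega> (act g x) (map ((*v) (fst g)) vs))"

definition degree_part :: "nat \<Rightarrow> 'n::finite form \<Rightarrow> 'n form" where
  "degree_part p \<omega> = (\<lambda>x vs. if length vs = p then \<omega> x vs else 0)"

definition even_form :: "'n::finite form \<Rightarrow> bool" where
  "even_form \<omega> \<longleftrightarrow> (\<forall>x vs. odd (length vs) \<longrightarrow> \<omega> x vs = 0)"

definition even_forms :: "'n::finite rigid_motion set \<Rightarrow> 'n form set" where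
  "even_forms \<Gamma> = {\<omega>. smooth_form \<omega> \<and> even_form \<omega> \<and> (\<forall>g\<in>\<Gamma>. pullback g \<omega> = \<omega>)}"

text \<open>The invariant formula for the exterior derivative, evaluated on constant vector fields.\<close>

definition ext_deriv :: "'n::finite form \<Rightarrow> 'n form" where
  "ext_deriv \<omega> = (\<lambda>x vs. \<Sum>i<length vs.
     (-1) ^ i * frechet_derivative (\<lambda>y. \<omega> y (take i vs @ drop (Suc i) vs)) (at x) (vs ! i))"

text \<open>
  The volume form of the orientation in which the standard basis, in increasing order of its
  indices, is positive: row i of the matrix is the vector whose position in the list is the
  rank of i.
\<close>

definition vol :: "(real^'n::{finite,linorder}) list \<Rightarrow> real" where
  "vol vs = (if length vs = CARD('n) then det (\<chi> i. vs ! card {j. j < i}) else 0)"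

text \<open>
  For a p-form a, the star of a sends v to the sum, over the increasing p-tuples I of indices,
  of a(e_I) vol(e_I, v); this is the star characterised by a \<and> *b = (a, b) vol. Summing over
  all p-tuples counts each such I exactly p! times.
\<close>

definition hodge_star :: "'n::{finite,linorder} form \<Rightarrow> 'n form" where
  "hodge_star \<omega> = (\<lambda>x vs.
     if length vs \<le> CARD('n) then
       (let p = CARD('n) - length vs in
         (\<Sum>is\<in>{is::'n list. length is = p}.
            \<omega> x (map (\<lambda>i. axis i 1) is) * vol (map (\<lambda>i. axis i 1) is @ vs)) / fact p)
     else 0)"

section \<open>The signature operator and its eta invariant\<close>

text \<open>
  In dimension 4m - 1, the operator B acts on q-forms by (-1)^(m+p+1) (eps * d - d *), where
  q = 2p and eps = 1, or q = 2p - 1 and eps = -1; in both cases p = (q + 1) div 2.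
\<close>

definition signature_operator :: "'n::{finite,linorder} form \<Rightarrow> 'n form" where
  "signature_operator \<omega> = (\<lambda>x vs. \<Sum>q\<le>CARD('n).
     (let m = (CARD('n) + 1) div 4; p = (q + 1) div 2;
          \<epsilon> = (if even q then 1 else -1); \<phi> = degree_part q \<omega>
      in (-1) ^ (m + p + 1) *
         (\<epsilon> * hodge_star (ext_deriv \<phi>) x vs - ext_deriv (hodge_star \<phi>) x vs)))"

definition form_scale :: "real \<Rightarrow> 'n::finite form \<Rightarrow> 'n form" where
  "form_scale c \<omega> = (\<lambda>x vs. c * \<omega> x vs)"

global_interpretation form_space: vector_space form_scale
  defines form_dim = form_space.dim
  by standard (auto simp: form_scale_def fun_eq_iff algebra_simps)

definition eigenspace :: "'n::{finite,linorder} rigid_motion set \<Rightarrow> real \<Rightarrow> 'n form set" where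
  "eigenspace \<Gamma> \<mu> = {\<omega> \<in> even_forms \<Gamma>. signature_operator \<omega> = form_scale \<mu> \<omega>}"

definition nonzero_eigenvalues :: "'n::{finite,linorder} rigid_motion set \<Rightarrow> real set" where
  "nonzero_eigenvalues \<Gamma> = {\<mu>. \<mu> \<noteq> 0 \<and> eigenspace \<Gamma> \<mu> \<noteq> {0}}"

definition eta_series :: "'n::{finite,linorder} rigid_motion set \<Rightarrow> complex \<Rightarrow> complex" where
  "eta_series \<Gamma> s = (\<Sum>\<^sub>\<infinity>\<mu>\<in>nonzero_eigenvalues \<Gamma>.
     of_real (sgn \<mu>) * of_nat (form_dim (eigenspace \<Gamma> \<mu>)) * of_real \<bar>\<mu>\<bar> powr (- s))"

text \<open>The value at 0 of the meromorphic continuation of the eta series.\<close>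

definition eta_invariant :: "'n::{finite,linorder} rigid_motion set \<Rightarrow> complex" where
  "eta_invariant \<Gamma> =
     (THE y. \<exists>F. F meromorphic_on UNIV \<and>
               (\<exists>c. \<forall>s. Re s > c \<longrightarrow> F s = eta_series \<Gamma> s) \<and>
               F analytic_on {0} \<and> F 0 = y)"

end

theory Submission
  imports Defs
begin

text \<open>
  The spectrum of the signature operator B on even forms is symmetric, so the eta series vanishes
  term by term against the term of the opposite eigenvalue. On coefficients, B is a Dirac operator:
  it is the sum of s(e) d/de over an orthonormal basis, where the symbols s(e) satisfy the Clifford
  relations, so that B squared is a multiple of the Laplacian. The holonomy consists of commuting
  orthogonal involutions and hence has two orthonormal common eigenvectors u, w up to sign. Let R
  be the rotation of the coefficients (not of the points) by the half turn in the plane of u and w.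
  It preserves invariance of forms and commutes with B squared, so the commutator of R and B maps
  the eigenspace of an eigenvalue to that of its negative. Invariant forms are bounded, and by
  Liouville's theorem the forms killed by the commutator are constant along the plane; on those the
  reflection in u, applied to the coefficients, reverses the sign of the eigenvalue instead.
  Together the two maps embed each eigenspace into the opposite one.
\<close>

section \<open>Alternating functions on lists of vectors\<close>

text \<open>The minus sign comes from orientation. A reflection of the coefficients has determinant
  -1, which the star turns into a sign; it would reverse B altogether but for the term s(u) d/du,
  whose symbol is reversed twice. That term obstructs a one-step symmetry, since invariant forms may
  vary along u. The commutator with the half turn takes care of the forms that do vary: up to the
  rotation it is twice the sum of the terms of B in the directions u and w. Two directions are taken
  so that the equation for its kernel is a Cauchy-Riemann system. The two maps glue to one embedding
  because their images meet only in 0: the reflection is applied to forms constant along the plane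
  and keeps them so, and a form whose commutator is constant along the plane is itself constant
  along it, hence killed. The congruence of the dimension modulo 4 enters through the degree signs
  of B: between two consecutive symbols they turn wedge plus contraction into contraction minus
  wedge, the Clifford action.\<close>

abbreviation unit_vec :: "'n \<Rightarrow> real^'n::finite" where "unit_vec i \<equiv> axis i 1"

definition contract :: "real^'n \<Rightarrow> ((real^'n::finite) list \<Rightarrow> real) \<Rightarrow> (real^'n) list \<Rightarrow> real" where
  "contract v \<alpha> = (\<lambda>vs. \<alpha> (v # vs))"

text \<open>Exterior product with the covector dual to v, expanded along the first argument. The
  recursion is the antiderivation rule for contraction, so \<open>contract_wedge\<close> holds by
  unfolding.\<close>

fun wedge :: "real^'n \<Rightarrow> ((real^'n::finite) list \<Rightarrow> real) \<Rightarrow> (real^'n) list \<Rightarrow> real" where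
  "wedge v \<alpha> [] = 0"
| "wedge v \<alpha> (w # ws) = (v \<bullet> w) * \<alpha> ws - wedge v (contract w \<alpha>) ws"

definition pointwise_pullback ::
    "real^'n^'n \<Rightarrow> ((real^'n::finite) list \<Rightarrow> real) \<Rightarrow> (real^'n) list \<Rightarrow> real" where
  "pointwise_pullback A \<alpha> = (\<lambda>vs. \<alpha> (map ((*v) A) vs))"

lemma alternating_linear:
  "alternating_multilinear \<alpha> \<Longrightarrow> linear (\<lambda>v. \<alpha> (us @ v # ws))"
  by (simp add: alternating_multilinear_def)

lemma alternating_linear_hd: "alternating_multilinear \<alpha> \<Longrightarrow> linear (\<lambda>v. \<alpha> (v # ws))"
  using alternating_linear[of \<alpha> "[]"] by simp

lemma alternating_repeat:
  "alternating_multilinear \<alpha> \<Longrightarrow> \<alpha> (us @ v # vs @ v # ws) = 0"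
  by (simp add: alternating_multilinear_def)

lemma alternating_append_right:
  assumes "alternating_multilinear \<alpha>"
  shows "alternating_multilinear (\<lambda>us. \<alpha> (us @ xs))"
  using assms by (simp add: alternating_multilinear_def)

lemma alternating_append_left:
  assumes "alternating_multilinear \<alpha>"
  shows "alternating_multilinear (\<lambda>us. \<alpha> (xs @ us))"
  unfolding alternating_multilinear_def
proof (intro conjI allI)
  show "linear (\<lambda>v. \<alpha> (xs @ us @ v # ws))" for us ws
    using alternating_linear[OF assms, of "xs @ us"] by simp
  show "\<alpha> (xs @ us @ v # vs @ v # ws) = 0" for us v vs ws
    using alternating_repeat[OF assms, of "xs @ us"] by simp
qed

lemma alternating_contract:
  "alternating_multilinear \<alpha> \<Longrightarrow> alternating_multilinear (contract v \<alpha>)"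
  using alternating_append_left[of \<alpha> "[v]"] by (simp add: contract_def)

lemma alternating_swap:
  assumes "alternating_multilinear \<alpha>"
  shows "\<alpha> (us @ v # w # ws) = - \<alpha> (us @ w # v # ws)"
proof -
  have r: "\<alpha> (us @ x # x # ws) = 0" for x
    using alternating_repeat[OF assms, of us x "[]"] by simp
  have l1: "\<alpha> (us @ (x + y) # z # ws) = \<alpha> (us @ x # z # ws) + \<alpha> (us @ y # z # ws)" for x y z
    using linear_add[OF alternating_linear[OF assms]] by blast
  have l2: "\<alpha> (us @ z # (x + y) # ws) = \<alpha> (us @ z # x # ws) + \<alpha> (us @ z # y # ws)" for x y z
    using linear_add[OF alternating_linear[OF assms, of "us @ [z]"]] by simp
  have "\<alpha> (us @ v # w # ws) + \<alpha> (us @ w # v # ws) = 0"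
    using r[of "v + w"] unfolding l1 l2 by (simp add: r)
  then show ?thesis by simp
qed

lemma contract_contract_swap:
  "alternating_multilinear \<alpha> \<Longrightarrow> contract v (contract w \<alpha>) us = - contract w (contract v \<alpha>) us"
  using alternating_swap[of \<alpha> "[]" w v us] by (simp add: contract_def)

lemma alternating_move:
  assumes "alternating_multilinear \<alpha>"
  shows "\<alpha> (v # us @ ws) = (-1) ^ length us * \<alpha> (us @ v # ws)"
  using assms
proof (induction us arbitrary: \<alpha>)
  case (Cons u us)
  have "\<alpha> (v # u # us @ ws) = - contract u \<alpha> (v # us @ ws)"
    using alternating_swap[OF Cons.prems, of "[]" v u] by (simp add: contract_def)
  also have "\<dots> = (-1) ^ length (u # us) * \<alpha> ((u # us) @ v # ws)"
    using Cons.IH[OF alternating_contract[OF Cons.prems, of u]] by (simp add: contract_def)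
  finally show ?case by simp
qed simp

lemma alternating_zero: "alternating_multilinear (\<lambda>_. 0)"
  by (simp add: alternating_multilinear_def linear_zero)

lemma alternating_add:
  assumes "alternating_multilinear \<alpha>" "alternating_multilinear \<beta>"
  shows "alternating_multilinear (\<lambda>vs. \<alpha> vs + \<beta> vs)"
  using assms by (simp add: alternating_multilinear_def linear_compose_add)

lemma alternating_scale:
  assumes "alternating_multilinear \<alpha>"
  shows "alternating_multilinear (\<lambda>vs. c * \<alpha> vs)"
  unfolding alternating_multilinear_def
proof (intro conjI allI)
  show "linear (\<lambda>v. c * \<alpha> (us @ v # ws))" for us ws
    using linear_compose_scale_right[OF alternating_linear[OF assms, of us ws], of c] by simp
qed (simp add: alternating_repeat[OF assms])

lemma alternating_sum:
  assumes "\<And>i. i \<in> I \<Longrightarrow> alternating_multilinear (\<alpha> i)"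
  shows "alternating_multilinear (\<lambda>vs. \<Sum>i\<in>I. \<alpha> i vs)"
  using assms
  by (induction I rule: infinite_finite_induct)
     (auto simp: alternating_zero intro: alternating_add)

text \<open>Multilinearity and the repetition rule never compare lists of different lengths, so a
  function of mixed degree may be rescaled degree by degree. This covers degree projections and
  degree signs.\<close>

lemma alternating_length_cong:
  assumes "alternating_multilinear \<alpha>"
  shows "alternating_multilinear (\<lambda>vs. c (length vs) * \<alpha> vs)"
  unfolding alternating_multilinear_def
proof (intro conjI allI)
  fix us ws :: "(real^'a) list"
  show "linear (\<lambda>v. c (length (us @ v # ws)) * \<alpha> (us @ v # ws))"
    using linear_compose_scale_right[OF alternating_linear[OF assms, of us ws],
      of "c (length us + Suc (length ws))"]
    by simp
qed (simp add: alternating_repeat[OF assms])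

lemma alternating_pointwise_pullback:
  assumes "alternating_multilinear \<alpha>"
  shows "alternating_multilinear (pointwise_pullback A \<alpha>)"
  unfolding alternating_multilinear_def pointwise_pullback_def
proof (intro conjI allI)
  fix us ws :: "(real^'a) list"
  have "linear ((\<lambda>v. \<alpha> (map ((*v) A) us @ v # map ((*v) A) ws)) \<circ> (*v) A)"
    by (intro linear_compose alternating_linear assms matrix_vector_mul_linear)
  then show "linear (\<lambda>v. \<alpha> (map ((*v) A) (us @ v # ws)))"
    by (simp add: o_def)
qed (simp add: alternating_repeat[OF assms])

section \<open>Exterior product and contraction as linear operators\<close>

lemma wedge_zero [simp]: "wedge v (\<lambda>_. 0) ws = 0"
  by (induction ws) (simp_all add: contract_def)

lemma contract_zero [simp]: "contract v (\<lambda>_. 0) = (\<lambda>_. 0)"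
  by (simp add: contract_def)

lemma contract_add: "contract w (\<lambda>us. \<alpha> us + \<beta> us) = (\<lambda>us. contract w \<alpha> us + contract w \<beta> us)"
  by (simp add: contract_def)

lemma contract_scale: "contract w (\<lambda>us. c * \<alpha> us) = (\<lambda>us. c * contract w \<alpha> us)"
  by (simp add: contract_def)

lemma wedge_add: "wedge v (\<lambda>us. \<alpha> us + \<beta> us) ws = wedge v \<alpha> ws + wedge v \<beta> ws"
  by (induction ws arbitrary: \<alpha> \<beta>) (simp_all add: algebra_simps contract_add)

lemma wedge_scale: "wedge v (\<lambda>us. c * \<alpha> us) ws = c * wedge v \<alpha> ws"
  by (induction ws arbitrary: \<alpha>) (simp_all add: algebra_simps contract_scale)

lemma wedge_sum: "wedge v (\<lambda>us. \<Sum>i\<in>I. \<alpha> i us) ws = (\<Sum>i\<in>I. wedge v (\<alpha> i) ws)"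
  by (induction I rule: infinite_finite_induct) (simp_all add: wedge_add)

lemma wedge_cong:
  assumes "\<And>us. Suc (length us) = length ws \<Longrightarrow> \<alpha> us = \<beta> us"
  shows "wedge v \<alpha> ws = wedge v \<beta> ws"
  using assms
proof (induction ws arbitrary: \<alpha> \<beta>)
  case (Cons w ws)
  have "wedge v (contract w \<alpha>) ws = wedge v (contract w \<beta>) ws"
    by (rule Cons.IH) (simp add: contract_def Cons.prems)
  then show ?case by (simp add: Cons.prems)
qed simp

lemma wedge_linear_left: "linear (\<lambda>v. wedge v \<alpha> ws)"
proof (rule linearI)
  show "wedge (u + v) \<alpha> ws = wedge u \<alpha> ws + wedge v \<alpha> ws" for u v
    by (induction ws arbitrary: \<alpha>) (simp_all add: algebra_simps inner_add_left)
  show "wedge (c *\<^sub>R v) \<alpha> ws = c *\<^sub>R wedge v \<alpha> ws" for c v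
    by (induction ws arbitrary: \<alpha>) (simp_all add: algebra_simps)
qed

text \<open>Every term of the expansion that leaves the second v inside
  \<open>contract v \<alpha>\<close> vanishes, so only the term pairing u with that v survives. This
  is the case of \<open>alternating_wedge\<close> in which the repeated vector stands first.\<close>

lemma wedge_contract_repeat:
  assumes "alternating_multilinear \<alpha>"
  shows "wedge u (contract v \<alpha>) (vs @ v # ws) = (u \<bullet> v) * \<alpha> (vs @ v # ws)"
  using assms
proof (induction vs arbitrary: \<alpha>)
  case Nil
  have "contract v (contract v \<alpha>) = (\<lambda>_. 0)"
    using alternating_repeat[OF Nil, of "[]" v "[]"] by (simp add: contract_def)
  then show ?case by (simp add: contract_def[of v \<alpha>])
next
  case (Cons w vs)
  have "contract w (contract v \<alpha>) = (\<lambda>us. (-1) * contract v (contract w \<alpha>) us)"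
    using contract_contract_swap[OF Cons.prems, of w v] by (simp add: fun_eq_iff)
  then have "wedge u (contract v \<alpha>) ((w # vs) @ v # ws)
    = (u \<bullet> w) * \<alpha> (v # vs @ v # ws) + wedge u (contract v (contract w \<alpha>)) (vs @ v # ws)"
    using wedge_scale[of u "-1" "contract v (contract w \<alpha>)"] by (simp add: contract_def[of v \<alpha>])
  also have "\<dots> = (u \<bullet> v) * contract w \<alpha> (vs @ v # ws)"
    using alternating_repeat[OF Cons.prems, of "[]" v vs ws]
      Cons.IH[OF alternating_contract[OF Cons.prems, of w]] by simp
  finally show ?case by (simp add: contract_def)
qed

lemma contract_linear_left:
  assumes "alternating_multilinear \<alpha>"
  shows "contract (u + v) \<alpha> = (\<lambda>us. contract u \<alpha> us + contract v \<alpha> us)"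
    and "contract (c *\<^sub>R v) \<alpha> = (\<lambda>us. c * contract v \<alpha> us)"
  using linear_add[OF alternating_linear_hd[OF assms]] linear_scale[OF alternating_linear_hd[OF assms]]
  by (simp_all add: contract_def)

lemma alternating_wedge:
  assumes "alternating_multilinear \<alpha>"
  shows "alternating_multilinear (wedge u \<alpha>)"
  unfolding alternating_multilinear_def
proof (intro conjI allI)
  fix us ws :: "(real^'a) list"
  show "linear (\<lambda>v. wedge u \<alpha> (us @ v # ws))"
    using assms
  proof (induction us arbitrary: \<alpha>)
    case Nil
    show ?case
      by (rule linearI)
         (simp_all add: contract_linear_left[OF Nil] wedge_add wedge_scale inner_add_right algebra_simps)
  next
    case (Cons w us)
    show ?case
      using linear_compose_sub[OF linear_compose_scale_right[OF alternating_linear[OF Cons.prems, of us ws],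
          of "u \<bullet> w"] Cons.IH[OF alternating_contract[OF Cons.prems, of w]]]
      by simp
  qed
next
  fix us vs ws :: "(real^'a) list" and v
  show "wedge u \<alpha> (us @ v # vs @ v # ws) = 0"
    using assms
  proof (induction us arbitrary: \<alpha>)
    case Nil
    then show ?case by (simp add: wedge_contract_repeat)
  next
    case (Cons w us)
    then show ?case by (simp add: alternating_repeat alternating_contract)
  qed
qed

text \<open>The covector is paired with an argument of the first block, or with one of the second
  after passing the whole first block.\<close>

lemma wedge_append:
  "wedge v \<alpha> (us @ ws) =
     wedge v (\<lambda>xs. \<alpha> (xs @ ws)) us + (-1) ^ length us * wedge v (\<lambda>xs. \<alpha> (us @ xs)) ws"
  by (induction us arbitrary: \<alpha>) (simp_all add: contract_def algebra_simps)

lemma contract_wedge: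
  "contract w (wedge v \<alpha>) us = (v \<bullet> w) * \<alpha> us - wedge v (contract w \<alpha>) us"
  by (simp add: contract_def)

lemma wedge_eq_sum:
  "wedge v \<alpha> vs = (\<Sum>i<length vs. (-1) ^ i * ((v \<bullet> vs ! i) * \<alpha> (take i vs @ drop (Suc i) vs)))"
proof (induction vs arbitrary: \<alpha>)
  case (Cons w vs)
  show ?case
    by (simp add: Cons.IH sum.lessThan_Suc_shift contract_def sum_negf[symmetric] del: sum.lessThan_Suc)
qed simp

lemma wedge_pointwise_pullback:
  "pointwise_pullback A (wedge v \<alpha>) = wedge (transpose A *v v) (pointwise_pullback A \<alpha>)"
proof
  show "pointwise_pullback A (wedge v \<alpha>) ws = wedge (transpose A *v v) (pointwise_pullback A \<alpha>) ws" for ws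
  proof (induction ws arbitrary: \<alpha>)
    case (Cons w ws)
    have "contract w (pointwise_pullback A \<alpha>) = pointwise_pullback A (contract (A *v w) \<alpha>)"
      by (simp add: contract_def pointwise_pullback_def)
    moreover have "v \<bullet> (A *v w) = (transpose A *v v) \<bullet> w"
      by (metis dot_lmul_matrix transpose_matrix_vector)
    ultimately show ?case
      using Cons.IH[of "contract (A *v w) \<alpha>"] by (simp add: pointwise_pullback_def)
  qed (simp add: pointwise_pullback_def)
qed

lemma sum_basis_expansion:
  fixes f :: "real^'n::finite \<Rightarrow> 'b::real_vector"
  assumes "linear f"
  shows "(\<Sum>i\<in>UNIV. (v $ i) *\<^sub>R f (unit_vec i)) = f v"
proof -
  have "f v = f (\<Sum>i\<in>UNIV. (v $ i) *s unit_vec i)"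
    by (simp only: basis_expansion)
  also have "\<dots> = (\<Sum>i\<in>UNIV. (v $ i) *\<^sub>R f (unit_vec i))"
    by (simp add: linear_sum[OF assms] linear_scale[OF assms] scalar_mult_eq_scaleR)
  finally show ?thesis by simp
qed

text \<open>The degree operator: summing over the basis rebuilds the i-th argument in front, and
  moving it back to its place cancels the sign, so each position contributes \<alpha> once. It
  writes a form of positive degree through wedge products, which drives the induction in
  \<open>star_star\<close>.\<close>

lemma sum_wedge_contract:
  assumes "alternating_multilinear \<alpha>"
  shows "(\<Sum>j\<in>UNIV. wedge (unit_vec j) (contract (unit_vec j) \<alpha>) vs) = real (length vs) * \<alpha> vs"
proof -
  have *: "(\<Sum>j\<in>UNIV. wedge (unit_vec j) (\<beta> j) vs) = (\<Sum>i<length vs. (-1) ^ i * (\<Sum>j\<in>UNIV. (vs ! i $ j) * \<beta> j (take i vs @ drop (Suc i) vs)))" 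
    for \<beta> :: "'a \<Rightarrow> (real^'a) list \<Rightarrow> real"
    unfolding wedge_eq_sum
    by (subst sum.swap) (simp add: sum_distrib_left inner_axis')
  have "(-1) ^ i * (\<Sum>j\<in>UNIV. (vs ! i $ j) * contract (unit_vec j) \<alpha> (take i vs @ drop (Suc i) vs)) = \<alpha> vs"
    if "i < length vs" for i
  proof -
    have "(\<Sum>j\<in>UNIV. (vs ! i $ j) * contract (unit_vec j) \<alpha> (take i vs @ drop (Suc i) vs))
       = \<alpha> (vs ! i # take i vs @ drop (Suc i) vs)"
      using sum_basis_expansion[OF alternating_linear_hd[OF assms, of "take i vs @ drop (Suc i) vs"], of "vs ! i"]
      by (simp add: contract_def)
    also have "\<dots> = (-1) ^ i * \<alpha> vs"
      using alternating_move[OF assms, of "vs ! i" "take i vs"] that by (simp add: id_take_nth_drop[symmetric])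
    finally show ?thesis by (simp add: mult.assoc[symmetric] power_add[symmetric])
  qed
  then show ?thesis by (simp add: *)
qed

lemma alternating_vanishes_on_span:
  assumes "alternating_multilinear \<alpha>" and "v \<in> span (set us \<union> set ws)"
  shows "\<alpha> (us @ v # ws) = 0"
proof -
  note lin = alternating_linear[OF assms(1), of us ws]
  show ?thesis
    using assms(2)
  proof (induction v rule: span_induct)
    case base
    show ?case
      using linear_0[OF lin] linear_add[OF lin] linear_scale[OF lin] by (simp add: subspace_def)
  next
    case (step v)
    then consider xs ys where "us = xs @ v # ys" | xs ys where "ws = xs @ v # ys"
      by (metis UnE split_list)
    then show ?case
    proof cases
      case 1
      then show ?thesis using alternating_repeat[OF assms(1), of xs v ys ws] by simp
    next
      case 2
      then show ?thesis using alternating_repeat[OF assms(1), of us v xs ys] by simp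
    qed
  qed
qed

lemma alternating_eq_zero:
  fixes vs :: "(real^'n::finite) list"
  assumes "alternating_multilinear \<alpha>" and "length vs > CARD('n)"
  shows "\<alpha> vs = 0"
\<comment> \<open>A list with repetitions can have an independent set of entries, so the dimension
  count applies to distinct lists and the repetition rule to the others.\<close>
proof (cases "distinct vs")
  case True
  then have "card (set vs) > DIM(real^'n)"
    using assms(2) by (simp add: distinct_card)
  then have "dependent (set vs)"
    using independent_bound by fastforce
  then obtain v where v: "v \<in> set vs" "v \<in> span (set vs - {v})"
    by (auto simp: dependent_def)
  then obtain us ws where vs: "vs = us @ v # ws" by (meson split_list)
  with True have "set vs - {v} = set us \<union> set ws" by auto
  then show ?thesis
    using alternating_vanishes_on_span[OF assms(1)] v vs by simp
next
  case False
  then obtain xs ys zs y where "vs = xs @ [y] @ ys @ [y] @ zs"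
    using not_distinct_decomp by blast
  then show ?thesis by (simp add: alternating_repeat[OF assms(1)])
qed

section \<open>The Hodge star on alternating functions\<close>

definition index_rank :: "'n::{finite,linorder} \<Rightarrow> nat" where
  "index_rank i = card {j. j < i}"

lemma rank_strict_mono: "i < j \<Longrightarrow> index_rank i < index_rank j"
  for i j :: "'n::{finite,linorder}"
  unfolding index_rank_def by (rule psubset_card_mono) auto

lemma rank_bij: "bij_betw (index_rank :: 'n::{finite,linorder} \<Rightarrow> nat) UNIV {..<CARD('n)}"
proof -
  have inj: "inj (index_rank :: 'n \<Rightarrow> nat)"
    by (rule injI) (metis less_irrefl linorder_less_linear rank_strict_mono)
  have sub: "range (index_rank :: 'n \<Rightarrow> nat) \<subseteq> {..<CARD('n)}"
  proof -
    have "index_rank i < CARD('n)" for i :: 'n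
      unfolding index_rank_def by (rule psubset_card_mono) auto
    then show ?thesis by auto
  qed
  have "range (index_rank :: 'n \<Rightarrow> nat) = {..<CARD('n)}"
    by (rule card_subset_eq[OF _ sub]) (simp_all add: card_image inj)
  with inj show ?thesis by (simp add: bij_betw_def)
qed

lemma rank_eq_iff: "index_rank i = index_rank j \<longleftrightarrow> i = j" for i j :: "'n::{finite,linorder}"
  using rank_bij[where 'n='n] by (auto simp: bij_betw_def inj_eq)

lemma obtain_rank:
  assumes "k < CARD('n)"
  obtains i :: "'n::{finite,linorder}" where "index_rank i = k"
  using assms rank_bij[where 'n='n] unfolding bij_betw_def by (metis imageE lessThan_iff)

lemma vol_eq: "vol vs = (if length vs = CARD('n) then det (\<chi> i. vs ! index_rank i) else 0)"
  for vs :: "(real^'n::{finite,linorder}) list"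
  by (simp add: vol_def index_rank_def)

lemma alternating_vol: "alternating_multilinear (vol :: (real^'n::{finite,linorder}) list \<Rightarrow> real)"
  unfolding alternating_multilinear_def
proof (intro conjI allI)
  fix us ws :: "(real^'n::_) list"
  show "linear (\<lambda>v. vol (us @ v # ws))"
  proof (cases "Suc (length us + length ws) = CARD('n)")
    case True
    then obtain k :: 'n where k: "index_rank k = length us"
      by (metis less_Suc_eq_le le_add1 obtain_rank)
    \<comment> \<open>The 0 is a filler: it freezes all rows but row k independently of v, so that
      the row rules for determinants apply.\<close>
    have "vol (us @ v # ws) = det (\<chi> i. if i = k then v else (us @ 0 # ws) ! index_rank i)" for v
    proof -
      have "(us @ v # ws) ! index_rank i = (if i = k then v else (us @ 0 # ws) ! index_rank i)" for i
        using k by (auto simp: nth_append nth_Cons rank_eq_iff[symmetric] split: nat.split)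
      then show ?thesis using True by (simp add: vol_eq)
    qed
    then show ?thesis
      using det_row_add[of k "\<lambda>_. _" "\<lambda>_. _"] det_row_mul[of k _ "\<lambda>_. _"]
      by (intro linearI) (simp_all flip: scalar_mult_eq_scaleR)
  next
    case False
    then show ?thesis by (simp add: vol_eq linear_zero)
  qed
next
  fix us vs ws :: "(real^'n::_) list" and v
  let ?xs = "us @ v # vs @ v # ws"
  show "vol ?xs = 0"
  proof (cases "length ?xs = CARD('n)")
    case True
    then have "length us < CARD('n)" "Suc (length us + length vs) < CARD('n)" by auto
    then obtain i j :: 'n where ij: "index_rank i = length us" "index_rank j = Suc (length us + length vs)"
      by (metis obtain_rank)
    then have "i \<noteq> j" by auto
    moreover have "?xs ! index_rank i = ?xs ! index_rank j"
      by (simp add: ij nth_append)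
    then have "row i (\<chi> i. ?xs ! index_rank i) = row j (\<chi> i. ?xs ! index_rank i)"
      by (simp add: row_def vec_eq_iff)
    ultimately show ?thesis
      using det_identical_rows True by (auto simp: vol_eq)
  qed (simp add: vol_eq)
qed

lemma vol_pullback:
  "pointwise_pullback A vol = (\<lambda>vs :: (real^'n::{finite,linorder}) list. det A * vol vs)"
proof
  fix vs :: "(real^'n::_) list"
  show "pointwise_pullback A vol vs = det A * vol vs"
  proof (cases "length vs = CARD('n)")
    case True
    have "index_rank i < length vs" for i :: 'n
      using rank_bij[where 'n='n] True by (auto simp: bij_betw_def)
    then have "(\<chi> i::'n. map ((*v) A) vs ! index_rank i) = (\<chi> i. A *v (vs ! index_rank i))"
      by simp
    also have "\<dots> = (\<chi> i. vs ! index_rank i) ** transpose A"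
      by (simp add: vec_eq_iff matrix_matrix_mult_def matrix_vector_mult_def transpose_def mult.commute)
    finally have "(\<chi> i::'n. map ((*v) A) vs ! index_rank i) = (\<chi> i. vs ! index_rank i) ** transpose A" .
    then show ?thesis
      using True by (simp add: pointwise_pullback_def vol_eq det_mul)
  qed (simp add: pointwise_pullback_def vol_eq)
qed

text \<open>On alternating functions this is p! times the usual inner product of p-forms. Summing
  over all tuples instead of increasing ones makes recursion on p a plain splitting of the first
  index.\<close>

definition pairing ::
    "nat \<Rightarrow> ((real^'n::finite) list \<Rightarrow> real) \<Rightarrow> ((real^'n) list \<Rightarrow> real) \<Rightarrow> real" where
  "pairing p \<beta> \<gamma> = (\<Sum>is\<in>{is::'n list. length is = p}. \<beta> (map unit_vec is) * \<gamma> (map unit_vec is))"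

lemma sum_lists_Suc:
  "(\<Sum>is\<in>{is::'n::finite list. length is = Suc p}. f is)
     = (\<Sum>i\<in>UNIV. \<Sum>is\<in>{is. length is = p}. f (i # is))"
proof -
  have "{is::'n list. length is = Suc p} = (\<lambda>(i, is). i # is) ` (UNIV \<times> {is. length is = p})"
    by (auto simp: length_Suc_conv image_iff)
  then have "(\<Sum>is\<in>{is::'n list. length is = Suc p}. f is)
      = (\<Sum>(i, is)\<in>UNIV \<times> {is. length is = p}. f (i # is))"
    by (simp add: sum.reindex inj_on_def case_prod_beta)
  then show ?thesis by (simp add: sum.cartesian_product)
qed

lemma pairing_0 [simp]: "pairing 0 \<beta> \<gamma> = \<beta> [] * \<gamma> []"
  by (simp add: pairing_def)

lemma pairing_Suc:
  "pairing (Suc p) \<beta> \<gamma> = (\<Sum>i\<in>UNIV. pairing p (contract (unit_vec i) \<beta>) (contract (unit_vec i) \<gamma>))"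
  by (simp add: pairing_def sum_lists_Suc contract_def)

lemma pairing_commute: "pairing p \<beta> \<gamma> = pairing p \<gamma> \<beta>"
  by (simp add: pairing_def mult.commute)

lemma pairing_cong:
  assumes "\<And>us. length us = p \<Longrightarrow> \<beta> us = \<beta>' us" "\<And>us. length us = p \<Longrightarrow> \<gamma> us = \<gamma>' us"
  shows "pairing p \<beta> \<gamma> = pairing p \<beta>' \<gamma>'"
  unfolding pairing_def by (rule sum.cong) (simp_all add: assms)

lemma pairing_add_left: "pairing p (\<lambda>us. \<beta> us + \<beta>' us) \<gamma> = pairing p \<beta> \<gamma> + pairing p \<beta>' \<gamma>"
  by (simp add: pairing_def algebra_simps sum.distrib)

lemma pairing_scale_left: "pairing p (\<lambda>us. c * \<beta> us) \<gamma> = c * pairing p \<beta> \<gamma>"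
  by (simp add: pairing_def algebra_simps sum_distrib_left)

lemma pairing_sum_left: "pairing p (\<lambda>us. \<Sum>i\<in>I. \<beta> i us) \<gamma> = (\<Sum>i\<in>I. pairing p (\<beta> i) \<gamma>)"
  by (simp add: pairing_def sum_distrib_right sum.swap[of _ I])

lemma pairing_diff_left: "pairing p (\<lambda>us. \<beta> us - \<beta>' us) \<gamma> = pairing p \<beta> \<gamma> - pairing p \<beta>' \<gamma>"
  by (simp add: pairing_def algebra_simps sum_subtractf)

lemma pairing_scale_right: "pairing p \<beta> (\<lambda>us. c * \<gamma> us) = c * pairing p \<beta> \<gamma>"
  by (simp add: pairing_def algebra_simps sum_distrib_left)

lemma pairing_sum_right: "pairing p \<beta> (\<lambda>us. \<Sum>i\<in>I. \<gamma> i us) = (\<Sum>i\<in>I. pairing p \<beta> (\<gamma> i))"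
  by (simp add: pairing_commute[of _ \<beta>] pairing_sum_left)

lemma sum_contract_expansion:
  assumes "alternating_multilinear \<gamma>"
  shows "(\<Sum>i\<in>UNIV. v $ i * contract (unit_vec i) \<gamma> us) = contract v \<gamma> us"
  using sum_basis_expansion[OF alternating_linear_hd[OF assms], of v us] by (simp add: contract_def)

text \<open>Wedge and contraction are adjoint; the factor p + 1 is the quotient of the factorials
  hidden in the two unnormalised pairings. In the induction the covector meets the first index once,
  and the remaining p contributions come from swapping two contractions.\<close>

lemma pairing_wedge:
  assumes "alternating_multilinear \<beta>" "alternating_multilinear \<gamma>"
  shows "pairing (Suc p) (wedge v \<beta>) \<gamma> = real (Suc p) * pairing p \<beta> (contract v \<gamma>)"
  using assms
proof (induction p arbitrary: \<beta> \<gamma>)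
  case 0
  then show ?case
    using sum_contract_expansion[OF 0(2), of v "[]"]
    by (simp add: pairing_Suc contract_def inner_axis sum_distrib_left algebra_simps flip: sum_distrib_left)
next
  case (Suc p)
  let ?e = "unit_vec :: 'a \<Rightarrow> _"
  have "pairing (Suc (Suc p)) (wedge v \<beta>) \<gamma>
     = (\<Sum>i\<in>UNIV. v $ i * pairing (Suc p) \<beta> (contract (?e i) \<gamma>))
       - (\<Sum>i\<in>UNIV. pairing (Suc p) (wedge v (contract (?e i) \<beta>)) (contract (?e i) \<gamma>))"
    by (subst pairing_Suc)
       (simp only: contract_wedge[abs_def] pairing_diff_left pairing_scale_left sum_subtractf inner_axis inner_real_def mult_1_right)
  also have "(\<Sum>i\<in>UNIV. v $ i * pairing (Suc p) \<beta> (contract (?e i) \<gamma>)) = pairing (Suc p) \<beta> (contract v \<gamma>)"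
    by (simp only: pairing_scale_right[symmetric] pairing_sum_right[symmetric]
          sum_contract_expansion[OF Suc.prems(2)])
  also have "(\<Sum>i\<in>UNIV. pairing (Suc p) (wedge v (contract (?e i) \<beta>)) (contract (?e i) \<gamma>))
     = real (Suc p) * (\<Sum>i\<in>UNIV. pairing p (contract (?e i) \<beta>) (contract v (contract (?e i) \<gamma>)))"
    by (simp add: Suc.IH alternating_contract Suc.prems sum_distrib_left)
  also have "(\<Sum>i\<in>UNIV. pairing p (contract (?e i) \<beta>) (contract v (contract (?e i) \<gamma>)))
     = (\<Sum>i\<in>UNIV. - pairing p (contract (?e i) \<beta>) (contract (?e i) (contract v \<gamma>)))"
  proof (rule sum.cong[OF refl])
    fix i
    have "contract v (contract (?e i) \<gamma>) = (\<lambda>us. (-1) * contract (?e i) (contract v \<gamma>) us)"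
      using contract_contract_swap[OF Suc.prems(2), of v "?e i"] by (simp add: fun_eq_iff)
    then show "pairing p (contract (?e i) \<beta>) (contract v (contract (?e i) \<gamma>))
        = - pairing p (contract (?e i) \<beta>) (contract (?e i) (contract v \<gamma>))"
      using pairing_scale_right[of p "contract (?e i) \<beta>" "-1" "contract (?e i) (contract v \<gamma>)"] by simp
  qed
  also have "\<dots> = - pairing (Suc p) \<beta> (contract v \<gamma>)"
    by (simp add: pairing_Suc sum_negf)
  finally show ?case by (simp add: algebra_simps)
qed

text \<open>Expanding the image of each basis vector in the basis and resumming on the other side
  moves A across one slot at a time.\<close>

lemma pairing_pullback:
  assumes "alternating_multilinear \<beta>" "alternating_multilinear \<gamma>"
  shows "pairing p (pointwise_pullback A \<beta>) \<gamma> = pairing p \<beta> (pointwise_pullback (transpose A) \<gamma>)"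
  using assms
proof (induction p arbitrary: \<beta> \<gamma>)
  case (Suc p)
  let ?e = "unit_vec :: 'a \<Rightarrow> _" and ?B = "transpose A"
  have col: "(A *v ?e i) $ k = A $ k $ i" "(?B *v ?e i) $ k = A $ i $ k" for i k
    by (simp_all add: matrix_vector_mult_basis column_def transpose_def)
  have cp: "contract v (pointwise_pullback C \<alpha>) = pointwise_pullback C (contract (C *v v) \<alpha>)"
    for v C and \<alpha> :: "(real^'a) list \<Rightarrow> real"
    by (simp add: contract_def pointwise_pullback_def)
  have "pairing (Suc p) (pointwise_pullback A \<beta>) \<gamma>
     = (\<Sum>i\<in>UNIV. pairing p (contract (A *v ?e i) \<beta>) (pointwise_pullback ?B (contract (?e i) \<gamma>)))"
    by (simp add: pairing_Suc cp Suc.IH alternating_contract Suc.prems del: transpose_matrix_vector)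
  also have "\<dots> = (\<Sum>i\<in>UNIV. pairing p (\<lambda>us. \<Sum>k\<in>UNIV. A $ k $ i * contract (?e k) \<beta> us)
       (pointwise_pullback ?B (contract (?e i) \<gamma>)))"
    using sum_contract_expansion[OF Suc.prems(1), of "A *v ?e _"] by (simp add: col)
  also have "\<dots> = (\<Sum>k\<in>UNIV. \<Sum>i\<in>UNIV. A $ k $ i * pairing p (contract (?e k) \<beta>)
       (pointwise_pullback ?B (contract (?e i) \<gamma>)))"
    by (subst sum.swap) (simp only: pairing_sum_left pairing_scale_left)
  also have "\<dots> = (\<Sum>k\<in>UNIV. pairing p (contract (?e k) \<beta>)
       (\<lambda>us. \<Sum>i\<in>UNIV. A $ k $ i * pointwise_pullback ?B (contract (?e i) \<gamma>) us))"
    by (simp only: pairing_sum_right pairing_scale_right)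
  also have "\<dots> = (\<Sum>k\<in>UNIV. pairing p (contract (?e k) \<beta>)
       (pointwise_pullback ?B (contract (?B *v ?e k) \<gamma>)))"
    using sum_contract_expansion[OF Suc.prems(2), of "?B *v ?e _"]
    by (simp add: col pointwise_pullback_def del: transpose_matrix_vector)
  also have "\<dots> = pairing (Suc p) \<beta> (pointwise_pullback ?B \<gamma>)"
    by (simp add: pairing_Suc cp)
  finally show ?case .
qed (simp add: pointwise_pullback_def)

definition star :: "((real^'n::{finite,linorder}) list \<Rightarrow> real) \<Rightarrow> (real^'n::_) list \<Rightarrow> real" where
  "star \<alpha> vs = (if length vs \<le> CARD('n)
     then pairing (CARD('n) - length vs) \<alpha> (\<lambda>us. vol (us @ vs)) / fact (CARD('n) - length vs) else 0)"

lemma hodge_star_eq: "hodge_star \<omega> x = star (\<omega> x)"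
  by (auto simp: hodge_star_def star_def pairing_def Let_def fun_eq_iff)

lemma star_cong:
  fixes vs :: "(real^'n::{finite,linorder}) list"
  assumes "\<And>us::(real^'n::_) list. length us + length vs = CARD('n) \<Longrightarrow> \<alpha> us = \<beta> us"
  shows "star \<alpha> vs = star \<beta> vs"
  unfolding star_def by (auto intro!: pairing_cong assms arg_cong2[where f="(/)"])

lemma star_add: "star (\<lambda>us. \<alpha> us + \<beta> us) vs = star \<alpha> vs + star \<beta> vs"
  by (simp add: star_def pairing_add_left add_divide_distrib)

lemma star_scale: "star (\<lambda>us. c * \<alpha> us) vs = c * star \<alpha> vs"
  by (simp add: star_def pairing_scale_left)

lemma star_sum: "star (\<lambda>us. \<Sum>i\<in>I. \<alpha> i us) vs = (\<Sum>i\<in>I. star (\<alpha> i) vs)"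
  by (simp add: star_def pairing_sum_left sum_divide_distrib)

lemma alternating_star: "alternating_multilinear (star \<alpha>)"
  for \<alpha> :: "(real^'n::{finite,linorder}) list \<Rightarrow> real"
proof -
  have *: "alternating_multilinear (\<lambda>vs. pairing p \<alpha> (\<lambda>us. vol (us @ vs)))" for p
    unfolding pairing_def
    by (intro alternating_sum alternating_scale alternating_append_left alternating_vol)
  \<comment> \<open>In \<open>star\<close> the degree p depends on the length of the argument list.
    Writing it as a sum over all p with length-dependent coefficients reduces the claim to
    \<open>alternating_length_cong\<close>.\<close>
  let ?c = "\<lambda>p l. if l \<le> CARD('n) \<and> p = CARD('n) - l then 1 / fact p else 0 :: real"
  have "star \<alpha> = (\<lambda>vs. \<Sum>p\<le>CARD('n). ?c p (length vs) * pairing p \<alpha> (\<lambda>us. vol (us @ vs)))"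
    by (auto simp: star_def fun_eq_iff if_distrib[of "\<lambda>x. x * _"] cong: if_cong)
  then show ?thesis
    by (simp only:) (intro alternating_sum alternating_length_cong *)
qed

text \<open>Adjointness turns the wedge into a contraction of the volume form with v, and v is then
  moved past the summed vectors to stand before \<open>vs\<close>.\<close>

lemma star_wedge:
  fixes vs :: "(real^'n::{finite,linorder}) list"
  assumes "alternating_multilinear \<beta>"
  shows "star (wedge v \<beta>) vs = (-1) ^ (CARD('n) - Suc (length vs)) * star \<beta> (v # vs)"
proof (cases "length vs < CARD('n)")
  case True
  then obtain p where p: "CARD('n) - length vs = Suc p" "CARD('n) - Suc (length vs) = p"
    by (metis Suc_diff_Suc)
  have "contract v (\<lambda>us. vol (us @ vs)) us = (-1) ^ p * vol (us @ v # vs)" if "length us = p" for us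
    using alternating_move[OF alternating_vol, of v us vs] that by (simp add: contract_def)
  then have "pairing (Suc p) (wedge v \<beta>) (\<lambda>us. vol (us @ vs))
      = real (Suc p) * ((-1) ^ p * pairing p \<beta> (\<lambda>us. vol (us @ v # vs)))"
    by (simp only: pairing_wedge[OF assms alternating_append_right[OF alternating_vol]]
        pairing_scale_right[symmetric] cong: pairing_cong)
  then have "pairing (Suc p) (wedge v \<beta>) (\<lambda>us. vol (us @ vs)) / fact (Suc p)
      = (-1) ^ p * pairing p \<beta> (\<lambda>us. vol (us @ v # vs)) / fact p"
    by (simp only: fact_Suc of_nat_mult mult_divide_mult_cancel_left_if) simp
  then show ?thesis
    using True by (simp add: star_def p del: fact_Suc)
next
  case False
  then show ?thesis by (auto simp: star_def)
qed

text \<open>The wedge of v with the volume form takes n + 1 arguments and vanishes; splitting it by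
  \<open>wedge_append\<close> trades a wedge on the summed slots for one on the free slots.
  Adjointness produces the former from the contraction.\<close>

lemma star_contract:
  fixes ws :: "(real^'n::{finite,linorder}) list"
  assumes "alternating_multilinear \<gamma>"
  shows "star (contract v \<gamma>) ws = (-1) ^ (CARD('n) - length ws) * wedge v (star \<gamma>) ws"
proof (cases "length ws \<le> CARD('n)")
  case True
  define q where "q = CARD('n) - length ws"
  let ?vol = "\<lambda>us. vol (us @ ws)"
  have w0: "wedge v ?vol us = (-1) ^ q * wedge v (\<lambda>xs. vol (us @ xs)) ws" if "length us = Suc q" for us
  proof -
    have "wedge v vol (us @ ws) = 0"
      by (rule alternating_eq_zero[OF alternating_wedge[OF alternating_vol]]) (use True that q_def in simp)
    then show ?thesis using wedge_append[of v vol us ws] that by simp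
  qed
  have "pairing q (contract v \<gamma>) ?vol = pairing (Suc q) \<gamma> (wedge v ?vol) / real (Suc q)"
    using pairing_wedge[OF alternating_append_right[OF alternating_vol] assms, of q v ws]
    by (simp add: pairing_commute)
  also have "pairing (Suc q) \<gamma> (wedge v ?vol) = pairing (Suc q) \<gamma> (\<lambda>us. (-1) ^ q * wedge v (\<lambda>xs. vol (us @ xs)) ws)"
    by (rule pairing_cong) (simp_all add: w0)
  also have "\<dots> = (-1) ^ q * wedge v (\<lambda>xs. pairing (Suc q) \<gamma> (\<lambda>us. vol (us @ xs))) ws"
    by (simp only: pairing_scale_right) (simp add: pairing_def wedge_sum wedge_scale)
  also have "wedge v (\<lambda>xs. pairing (Suc q) \<gamma> (\<lambda>us. vol (us @ xs))) ws
      = wedge v (\<lambda>xs. fact (Suc q) * star \<gamma> xs) ws"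
  proof (rule wedge_cong)
    fix xs :: "(real^'n::_) list"
    assume "Suc (length xs) = length ws"
    then have "CARD('n) - length xs = Suc q" "length xs \<le> CARD('n)"
      using True by (simp_all add: q_def)
    then show "pairing (Suc q) \<gamma> (\<lambda>us. vol (us @ xs)) = fact (Suc q) * star \<gamma> xs"
      by (simp add: star_def del: fact_Suc)
  qed
  finally show ?thesis
    using True by (simp add: star_def[of "contract v \<gamma>"] q_def[symmetric] wedge_scale)
next
  case False
  then show ?thesis
    using alternating_eq_zero[OF alternating_wedge[OF alternating_star], of ws v \<gamma>] by (simp add: star_def)
qed

text \<open>Adjointness puts the transpose of A on the summed arguments of \<open>vol\<close>. Since
  the transpose undoes A, the result is the pullback of \<open>vol\<close> by the transpose,
  evaluated where the free arguments are already moved by A; this yields the determinant.\<close>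

lemma star_pullback:
  assumes "alternating_multilinear \<alpha>" "orthogonal_matrix A"
  shows "star (pointwise_pullback A \<alpha>) vs = det A * pointwise_pullback A (star \<alpha>) vs"
proof (cases "length vs \<le> CARD('a)")
  case True
  have A: "transpose A *v (A *v v) = v" for v
    using assms(2) by (simp add: matrix_vector_mul_assoc orthogonal_matrix_def)
  have "pairing p (pointwise_pullback A \<alpha>) (\<lambda>us. vol (us @ vs))
      = pairing p \<alpha> (\<lambda>us. det A * vol (us @ map ((*v) A) vs))" for p
  proof -
    have "vol (map ((*v) (transpose A)) us @ vs) = det A * vol (us @ map ((*v) A) vs)" for us
      using vol_pullback[of "transpose A", unfolded pointwise_pullback_def fun_eq_iff, rule_format, of "us @ map ((*v) A) vs"]
      by (simp add: o_def A del: transpose_matrix_vector)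
    then show ?thesis
      using pairing_pullback[OF assms(1) alternating_append_right[OF alternating_vol, of vs], of p A]
      by (simp add: pointwise_pullback_def del: transpose_matrix_vector)
  qed
  then show ?thesis
    using True by (simp add: star_def pairing_scale_right pointwise_pullback_def)
qed (simp add: star_def pointwise_pullback_def)

text \<open>The squared norm of the volume form, the scalar by which the star composed with itself
  acts in odd dimension. It is carried along as a positive constant.\<close>

definition star_norm :: "'n::{finite,linorder} itself \<Rightarrow> real" where
  "star_norm _ = pairing CARD('n) vol (vol :: (real^'n::_) list \<Rightarrow> real) / fact CARD('n)"

lemma star_norm_pos: "star_norm TYPE('n::{finite,linorder}) > 0"
proof -
  \<comment> \<open>The indices in increasing order: on the corresponding basis vectors
    \<open>vol\<close> is the determinant of the identity, so this tuple gives a positive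
    term.\<close>
  define js :: "'n list" where "js = map (inv_into UNIV index_rank) [0..<CARD('n)]"
  have lt: "index_rank i < CARD('n)" for i :: 'n
    using rank_bij[where 'n='n] by (auto simp: bij_betw_def)
  have "js ! index_rank i = i" for i :: 'n
    using rank_bij[where 'n='n] lt[of i] by (simp add: js_def bij_betw_def)
  moreover have "index_rank i < length js" for i :: 'n
    using lt[of i] by (simp add: js_def)
  ultimately have "(\<chi> i. map unit_vec js ! index_rank i) = (mat 1 :: real^'n::_^'n::_)"
    by (simp add: vec_eq_iff mat_def axis_def)
  then have "vol (map unit_vec js) = 1"
    by (simp add: vol_eq js_def)
  moreover have "length js = CARD('n)" by (simp add: js_def)
  ultimately have "0 < pairing CARD('n) vol (vol :: (real^'n::_) list \<Rightarrow> real)"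
    unfolding pairing_def
    by (intro sum_pos2[where i=js]) (simp_all add: finite_list_length)
  then show ?thesis by (simp add: star_norm_def)
qed

text \<open>Induction on the degree. The double star commutes with wedge products, since the signs
  of \<open>star_wedge\<close> and \<open>star_contract\<close> multiply to (-1) to the power n - 1,
  which is 1 for odd n; \<open>sum_wedge_contract\<close> then reduces degree l + 1 to degree l. In
  degree 0 the constant is the squared norm of \<open>vol\<close>.\<close>

lemma star_star:
  fixes vs :: "(real^'n::{finite,linorder}) list"
  assumes "odd CARD('n)" and "alternating_multilinear \<alpha>"
  shows "star (star \<alpha>) vs = star_norm TYPE('n) * \<alpha> vs"
  using assms(2)
proof (induction "length vs" arbitrary: vs \<alpha>)
  case 0
  have "star \<alpha> us = \<alpha> [] * vol us" if "length us = CARD('n)" for us :: "(real^'n::_) list"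
    using that by (simp add: star_def)
  then have "star (star \<alpha>) [] = pairing CARD('n) (\<lambda>us::(real^'n::_) list. \<alpha> [] * vol us) vol / fact CARD('n)"
    by (simp add: star_def[of "star \<alpha>"] pairing_cong[of "CARD('n)" "star \<alpha>" "\<lambda>us::(real^'n::_) list. \<alpha> [] * vol us" vol vol])
  then show ?case using 0 by (simp add: pairing_scale_left star_norm_def)
next
  case (Suc l)
  show ?case
  proof (cases "length vs \<le> CARD('n)")
    case True
    let ?e = "unit_vec :: 'n \<Rightarrow> _" and ?n = "CARD('n)"
    have step: "star (star (wedge v \<beta>)) vs = wedge v (star (star \<beta>)) vs"
      if "alternating_multilinear \<beta>" for v \<beta>
    proof -
      have "star (wedge v \<beta>) us = (-1) ^ (l) * contract v (star \<beta>) us" if "length us + length vs = ?n" for us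
        using that arg_cong[OF Suc.hyps(2), of "\<lambda>k. k - 1"] by (simp add: star_wedge[OF \<open>alternating_multilinear \<beta>\<close>] contract_def flip: that)
      then have "star (star (wedge v \<beta>)) vs = star (\<lambda>us. (-1) ^ l * contract v (star \<beta>) us) vs"
        by (rule star_cong)
      also have "\<dots> = (-1) ^ (l + (?n - length vs)) * wedge v (star (star \<beta>)) vs"
        by (simp add: star_scale star_contract[OF alternating_star] power_add)
      also have "\<dots> = wedge v (star (star \<beta>)) vs"
      proof -
        have "even (l + (?n - length vs))"
          using True Suc.hyps(2) assms(1) by presburger
        then show ?thesis by simp
      qed
      finally show ?thesis .
    qed
    have "real (length vs) * star (star \<alpha>) vs
        = star (star (\<lambda>us. \<Sum>j\<in>UNIV. wedge (?e j) (contract (?e j) \<alpha>) us)) vs"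
    proof -
      have "star (\<lambda>us. \<Sum>j\<in>UNIV. wedge (?e j) (contract (?e j) \<alpha>) us) us = real (length vs) * star \<alpha> us"
        if "length us + length vs = ?n" for us
      proof -
        have "star (\<lambda>us. \<Sum>j\<in>UNIV. wedge (?e j) (contract (?e j) \<alpha>) us) us
            = star (\<lambda>us. real (length vs) * \<alpha> us) us"
          by (rule star_cong) (use that in \<open>simp add: sum_wedge_contract[OF Suc.prems]\<close>)
        then show ?thesis by (simp add: star_scale)
      qed
      then have "star (star (\<lambda>us. \<Sum>j\<in>UNIV. wedge (?e j) (contract (?e j) \<alpha>) us)) vs
          = star (\<lambda>us. real (length vs) * star \<alpha> us) vs"
        by (rule star_cong)
      then show ?thesis by (simp add: star_scale)
    qed
    also have "\<dots> = (\<Sum>j\<in>UNIV. star (star (wedge (?e j) (contract (?e j) \<alpha>))) vs)"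
      by (simp add: star_sum[abs_def])
    also have "\<dots> = (\<Sum>j\<in>UNIV. wedge (?e j) (star (star (contract (?e j) \<alpha>))) vs)"
      by (simp add: step alternating_contract Suc.prems)
    also have "\<dots> = (\<Sum>j\<in>UNIV. wedge (?e j) (\<lambda>us. star_norm TYPE('n) * contract (?e j) \<alpha> us) vs)"
      by (intro sum.cong refl wedge_cong Suc.hyps(1) alternating_contract Suc.prems)
         (use Suc.hyps(2) in simp)
    also have "\<dots> = real (length vs) * (star_norm TYPE('n) * \<alpha> vs)"
      by (simp add: wedge_scale sum_distrib_left[symmetric] sum_wedge_contract[OF Suc.prems])
    finally show ?thesis using Suc.hyps(2) by (cases vs) simp_all
  next
    case False
    then show ?thesis
      using alternating_eq_zero[OF Suc.prems, of vs] by (simp add: star_def)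
  qed
qed

section \<open>The symbol of the signature operator\<close>

text \<open>The sign of B as a function of the degree of its argument, applied before the
  star.\<close>

definition sign_twist ::
    "((real^'n::finite) list \<Rightarrow> real) \<Rightarrow> (real^'n) list \<Rightarrow> real" where
  "sign_twist \<alpha> = (\<lambda>vs. (-1) ^ ((CARD('n) + 1) div 4 + (length vs + 1) div 2 + 1) * \<alpha> vs)"

text \<open>The coefficient of the derivative along v in B. On even forms \<open>\<epsilon>\<close>
  is 1, so the remaining sign is \<open>sign_twist\<close>.\<close>

definition symbol ::
    "real^'n::{finite,linorder} \<Rightarrow> ((real^'n::_) list \<Rightarrow> real) \<Rightarrow> (real^'n::_) list \<Rightarrow> real" where
  "symbol v \<alpha> = (\<lambda>vs. star (wedge v (sign_twist \<alpha>)) vs - wedge v (star (sign_twist \<alpha>)) vs)"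

definition even_alternating :: "((real^'n::finite) list \<Rightarrow> real) \<Rightarrow> bool" where
  "even_alternating \<alpha> \<longleftrightarrow> alternating_multilinear \<alpha> \<and> (\<forall>vs. odd (length vs) \<longrightarrow> \<alpha> vs = 0)"

text \<open>Clifford multiplication on the exterior algebra, normalised so that v squares to minus
  its squared length.\<close>

definition clifford ::
    "real^'n \<Rightarrow> ((real^'n::finite) list \<Rightarrow> real) \<Rightarrow> (real^'n) list \<Rightarrow> real" where
  "clifford v \<alpha> = (\<lambda>vs. contract v \<alpha> vs - wedge v \<alpha> vs)"

lemma alternating_sign_twist:
  "alternating_multilinear \<alpha> \<Longrightarrow> alternating_multilinear (sign_twist \<alpha>)"
  unfolding sign_twist_def by (rule alternating_length_cong)

lemma alternating_diff:
  assumes "alternating_multilinear \<alpha>" "alternating_multilinear \<beta>"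
  shows "alternating_multilinear (\<lambda>vs. \<alpha> vs - \<beta> vs)"
  using alternating_add[OF assms(1) alternating_scale[OF assms(2), of "-1"]] by simp

lemma alternating_symbol:
  "alternating_multilinear \<alpha> \<Longrightarrow> alternating_multilinear (symbol v \<alpha>)"
  unfolding symbol_def
  by (intro alternating_diff alternating_star alternating_wedge)

lemma alternating_clifford:
  "alternating_multilinear \<alpha> \<Longrightarrow> alternating_multilinear (clifford v \<alpha>)"
  unfolding clifford_def
  by (intro alternating_diff alternating_contract alternating_wedge)

lemma wedge_eq_zero:
  assumes "\<And>us. Suc (length us) = length ws \<Longrightarrow> \<alpha> us = 0"
  shows "wedge v \<alpha> ws = 0"
  using wedge_cong[of ws \<alpha> "\<lambda>_. 0"] assms by simp

lemma star_eq_zero: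
  fixes vs :: "(real^'n::{finite,linorder}) list"
  assumes "\<And>us::(real^'n::_) list. length us + length vs = CARD('n) \<Longrightarrow> \<alpha> us = 0"
  shows "star \<alpha> vs = 0"
proof -
  have "star \<alpha> vs = star (\<lambda>us. 0 * \<alpha> us) vs"
    by (rule star_cong) (simp add: assms)
  then show ?thesis using star_scale[of 0 \<alpha> vs] by simp
qed

lemma sign_twist_eq_0_iff [simp]: "sign_twist \<alpha> vs = 0 \<longleftrightarrow> \<alpha> vs = 0"
  by (simp add: sign_twist_def)

lemma star_even_form:
  fixes \<alpha> :: "(real^'n::{finite,linorder}) list \<Rightarrow> real"
  assumes "odd CARD('n)" "\<forall>us. odd (length us) \<longrightarrow> \<alpha> us = 0" "even (length vs)"
  shows "star \<alpha> vs = 0"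
  using assms by (force intro!: star_eq_zero dest: arg_cong[where f=even])

lemma star_odd_form:
  fixes \<alpha> :: "(real^'n::{finite,linorder}) list \<Rightarrow> real"
  assumes "odd CARD('n)" "\<forall>us. even (length us) \<longrightarrow> \<alpha> us = 0" "odd (length vs)"
  shows "star \<alpha> vs = 0"
  using assms by (force intro!: star_eq_zero dest: arg_cong[where f=even])

text \<open>Here the star is factored out on the left, in \<open>symbol_eq_clifford\<close> on the
  right, so that in a product of two symbols the stars meet. Where the output degree is even, the
  complementary degree is odd and \<open>star_contract\<close> gives a minus sign; in odd output
  degree both terms vanish because the star exchanges parities.\<close>

lemma symbol_eq_star:
  fixes vs :: "(real^'n::{finite,linorder}) list"
  assumes "odd CARD('n)" "even_alternating \<alpha>"
  shows "symbol v \<alpha> vs = star (\<lambda>us. wedge v (sign_twist \<alpha>) us + contract v (sign_twist \<alpha>) us) vs"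
proof -
  let ?\<gamma> = "sign_twist \<alpha>"
  have alt: "alternating_multilinear ?\<gamma>" and \<gamma>0: "\<forall>us. odd (length us) \<longrightarrow> ?\<gamma> us = 0"
    using assms(2) by (auto simp: even_alternating_def alternating_sign_twist)
  have "wedge v (star ?\<gamma>) vs = - star (contract v ?\<gamma>) vs"
  proof (cases "length vs \<le> CARD('n) \<and> even (length vs)")
    case True
    then show ?thesis using star_contract[OF alt, of v vs] assms(1) by simp
  next
    case False
    show ?thesis
    proof (cases "length vs \<le> CARD('n)")
      case True
      then have odd: "odd (length vs)" using False by simp
      have "wedge v (star ?\<gamma>) vs = 0"
      proof (rule wedge_eq_zero)
        fix us :: "(real^'n::_) list"
        assume "Suc (length us) = length vs"
        then have "even (length us)" using odd by (metis even_Suc)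
        then show "star ?\<gamma> us = 0" by (rule star_even_form[OF assms(1) \<gamma>0])
      qed
      then show ?thesis by (simp add: star_contract[OF alt])
    next
      case False
      then show ?thesis using star_contract[OF alt, of v vs] by (simp add: star_def)
    qed
  qed
  then show ?thesis by (simp add: symbol_def star_add)
qed

lemma symbol_eq_clifford:
  fixes vs :: "(real^'n::{finite,linorder}) list"
  assumes "odd CARD('n)" "even_alternating \<alpha>"
  shows "symbol v \<alpha> vs = clifford v (star (sign_twist \<alpha>)) vs"
proof -
  let ?\<gamma> = "sign_twist \<alpha>"
  have alt: "alternating_multilinear ?\<gamma>" and \<gamma>0: "\<forall>us. odd (length us) \<longrightarrow> ?\<gamma> us = 0"
    using assms(2) by (auto simp: even_alternating_def alternating_sign_twist)
  have "star (wedge v ?\<gamma>) vs = contract v (star ?\<gamma>) vs"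
  proof (cases "length vs < CARD('n) \<and> even (length vs)")
    case True
    then show ?thesis using assms(1) by (simp add: star_wedge[OF alt] contract_def)
  next
    case False
    then have "star ?\<gamma> (v # vs) = 0"
      using star_even_form[OF assms(1) \<gamma>0, of "v # vs"] by (auto simp: star_def)
    then show ?thesis by (simp add: star_wedge[OF alt] contract_def)
  qed
  then show ?thesis by (simp add: symbol_def clifford_def)
qed

lemma even_alternating_symbol:
  fixes \<alpha> :: "(real^'n::{finite,linorder}) list \<Rightarrow> real"
  assumes "odd CARD('n)" "even_alternating \<alpha>"
  shows "even_alternating (symbol v \<alpha>)"
proof -
  have "symbol v \<alpha> vs = 0" if "odd (length vs)" for vs
    unfolding symbol_eq_star[OF assms]
  proof (rule star_odd_form[OF assms(1) _ that], intro allI impI)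
    fix us :: "(real^'n::_) list"
    assume even: "even (length us)"
    have "wedge v (sign_twist \<alpha>) us = 0"
      by (rule wedge_eq_zero) (use assms(2) even in \<open>auto simp: even_alternating_def dest: arg_cong[where f=even]\<close>)
    moreover have "contract v (sign_twist \<alpha>) us = 0"
      using assms(2) even by (simp add: even_alternating_def contract_def)
    ultimately show "wedge v (sign_twist \<alpha>) us + contract v (sign_twist \<alpha>) us = 0" by simp
  qed
  then show ?thesis
    using assms(2) alternating_symbol by (auto simp: even_alternating_def)
qed

lemma wedge_diff: "wedge v (\<lambda>us. \<alpha> us - \<beta> us) ws = wedge v \<alpha> ws - wedge v \<beta> ws"
  using wedge_add[of v \<alpha> "\<lambda>us. (-1) * \<beta> us" ws] wedge_scale[of v "-1" \<beta> ws] by simp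

lemma wedge_anticommute:
  "alternating_multilinear \<alpha> \<Longrightarrow> wedge v (wedge w \<alpha>) us + wedge w (wedge v \<alpha>) us = 0"
proof (induction us arbitrary: \<alpha>)
  case (Cons u us)
  have cw: "contract u (wedge x \<alpha>) = (\<lambda>xs. (x \<bullet> u) * \<alpha> xs - wedge x (contract u \<alpha>) xs)" for x
    by (simp add: fun_eq_iff contract_wedge)
  have e: "wedge x (wedge y \<alpha>) (u # us) = (x \<bullet> u) * wedge y \<alpha> us - (y \<bullet> u) * wedge x \<alpha> us
      + wedge x (wedge y (contract u \<alpha>)) us" for x y
    by (simp add: cw wedge_diff wedge_scale)
  show ?case
    using Cons.IH[OF alternating_contract[OF Cons.prems, of u]] unfolding e by simp
qed simp

lemma clifford_anticommute:
  assumes "alternating_multilinear \<alpha>"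
  shows "clifford v (clifford w \<alpha>) us + clifford w (clifford v \<alpha>) us = - 2 * (v \<bullet> w) * \<alpha> us"
proof -
  have "clifford x (clifford y \<alpha>) us = contract x (contract y \<alpha>) us - (y \<bullet> x) * \<alpha> us
      + wedge y (contract x \<alpha>) us - wedge x (contract y \<alpha>) us + wedge x (wedge y \<alpha>) us" for x y
  proof -
    show ?thesis
      by (simp add: clifford_def contract_def wedge_diff)
  qed
  then show ?thesis
    using wedge_anticommute[OF assms, of v w us] contract_contract_swap[OF assms, of v w us]
    by (simp add: inner_commute)
qed

text \<open>The degree signs before and after the first star combine so that the twisted symbol is
  the star of the Clifford action; the second star then cancels the first up to the scalar of
  \<open>star_star\<close>.\<close>

lemma symbol_symbol:
  fixes \<alpha> :: "(real^'n::{finite,linorder}) list \<Rightarrow> real"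
  assumes "CARD('n) mod 4 = 3" "even_alternating \<alpha>"
  shows "symbol v (symbol w \<alpha>) vs = star_norm TYPE('n) * clifford v (clifford w \<alpha>) vs"
proof -
  have odd: "odd CARD('n)" using assms(1) by presburger
  have alt: "alternating_multilinear \<alpha>" and \<alpha>0: "\<And>us. odd (length us) \<Longrightarrow> \<alpha> us = 0"
    using assms(2) by (auto simp: even_alternating_def)
  let ?s = "\<lambda>k. (-1) ^ ((CARD('n) + 1) div 4 + (k + 1) div 2 + 1) :: real"
  have "sign_twist (symbol w \<alpha>) vs = star (clifford w \<alpha>) vs" for vs
  proof (cases "even (length vs)")
    case True
    have "?s (length vs) * (wedge w (sign_twist \<alpha>) us + contract w (sign_twist \<alpha>) us) = clifford w \<alpha> us"
      if len: "length us + length vs = CARD('n)" for us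
    proof -
      obtain a where a: "length vs = 2 * a" using True by blast
      have "odd (length us)" using odd len a by presburger
      then obtain c where c: "length us = 2 * c + 1" by (elim oddE)
      \<comment> \<open>The dimension is 2a + 2c + 1; being 3 modulo 4 it makes a + c odd. Hence the
        two signs multiply to -1 for the wedge, which reads degree 2c, and to 1 for the contraction,
        which reads degree 2c + 2.\<close>
      have ac: "odd (a + c)" using assms(1) len a c by presburger
      have "wedge w (sign_twist \<alpha>) us = wedge w (\<lambda>xs. ?s (2 * c) * \<alpha> xs) us"
        by (rule wedge_cong) (simp add: sign_twist_def c)
      moreover have "contract w (sign_twist \<alpha>) us = ?s (2 * c + 2) * contract w \<alpha> us"
        by (simp add: sign_twist_def c contract_def)
      moreover have "?s (length vs) * ?s (2 * c) = - 1" "?s (length vs) * ?s (2 * c + 2) = 1"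
        using ac by (simp_all add: a power_add[symmetric])
      ultimately show ?thesis
        by (simp only: wedge_scale distrib_left mult.assoc[symmetric] clifford_def
            mult_minus1 mult_1 uminus_add_conv_diff)
    qed
    then have "star (\<lambda>us. ?s (length vs) * (wedge w (sign_twist \<alpha>) us + contract w (sign_twist \<alpha>) us)) vs
        = star (clifford w \<alpha>) vs"
      by (rule star_cong)
    then show ?thesis
      by (simp only: star_scale sign_twist_def[of "symbol w \<alpha>"] symbol_eq_star[OF odd assms(2)])
  next
    case False
    have "star (clifford w \<alpha>) vs = 0"
    proof (rule star_odd_form[OF odd _ False], intro allI impI)
      fix us :: "(real^'n::_) list"
      assume even: "even (length us)"
      have "wedge w \<alpha> us = 0"
        by (rule wedge_eq_zero) (use even in \<open>auto intro!: \<alpha>0 dest: arg_cong[where f=even]\<close>)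
      moreover have "contract w \<alpha> us = 0"
        using even by (simp add: contract_def \<alpha>0)
      ultimately show "clifford w \<alpha> us = 0" by (simp add: clifford_def)
    qed
    then show ?thesis
      using even_alternating_symbol[OF odd assms(2), of w] False
      by (simp add: even_alternating_def)
  qed
  then have "sign_twist (symbol w \<alpha>) = star (clifford w \<alpha>)" ..
  then have "symbol v (symbol w \<alpha>) vs = clifford v (star (star (clifford w \<alpha>))) vs"
    using symbol_eq_clifford[OF odd even_alternating_symbol[OF odd assms(2)], of v w vs] by simp
  also have "star (star (clifford w \<alpha>)) = (\<lambda>us. star_norm TYPE('n) * clifford w \<alpha> us)"
    using star_star[OF odd alternating_clifford[OF alt]] by auto
  finally show ?thesis
    by (simp add: clifford_def[of v] wedge_scale contract_def algebra_simps)
qed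

lemma symbol_anticommute:
  fixes \<alpha> :: "(real^'n::{finite,linorder}) list \<Rightarrow> real"
  assumes "CARD('n) mod 4 = 3" "even_alternating \<alpha>"
  shows "symbol v (symbol w \<alpha>) vs + symbol w (symbol v \<alpha>) vs
      = - 2 * star_norm TYPE('n) * (v \<bullet> w) * \<alpha> vs"
proof -
  have "symbol v (symbol w \<alpha>) vs + symbol w (symbol v \<alpha>) vs
      = star_norm TYPE('n) * (clifford v (clifford w \<alpha>) vs + clifford w (clifford v \<alpha>) vs)"
    by (simp add: symbol_symbol[OF assms] distrib_left)
  also have "\<dots> = star_norm TYPE('n) * (- 2 * (v \<bullet> w) * \<alpha> vs)"
    using assms(2) by (simp only: clifford_anticommute even_alternating_def)
  finally show ?thesis by simp
qed

text \<open>The wedge carries v to its image under A, while the single star in each term contributes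
  the determinant.\<close>

lemma symbol_pullback:
  assumes "alternating_multilinear \<alpha>" "orthogonal_matrix A"
  shows "symbol v (pointwise_pullback A \<alpha>) vs = det A * pointwise_pullback A (symbol (A *v v) \<alpha>) vs"
proof -
  have A: "transpose A *v (A *v v) = v"
    using assms(2) by (simp add: matrix_vector_mul_assoc orthogonal_matrix_def del: transpose_matrix_vector)
  have tw: "sign_twist (pointwise_pullback A \<alpha>) = pointwise_pullback A (sign_twist \<alpha>)"
    by (simp add: sign_twist_def pointwise_pullback_def fun_eq_iff)
  note alt = alternating_sign_twist[OF assms(1)]
  have w: "wedge v (pointwise_pullback A \<beta>) = pointwise_pullback A (wedge (A *v v) \<beta>)" for \<beta>
    by (simp add: wedge_pointwise_pullback A del: transpose_matrix_vector)
  have "star (wedge v (pointwise_pullback A (sign_twist \<alpha>))) vs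
      = det A * pointwise_pullback A (star (wedge (A *v v) (sign_twist \<alpha>))) vs"
    unfolding w by (rule star_pullback[OF alternating_wedge[OF alt] assms(2)])
  moreover have "wedge v (star (pointwise_pullback A (sign_twist \<alpha>))) vs
      = det A * pointwise_pullback A (wedge (A *v v) (star (sign_twist \<alpha>))) vs"
    unfolding w[symmetric] wedge_scale[symmetric]
    by (rule wedge_cong) (rule star_pullback[OF alt assms(2)])
  ultimately show ?thesis
    unfolding symbol_def tw by (simp add: pointwise_pullback_def right_diff_distrib)
qed

lemma symbol_linear_left: "linear (\<lambda>v. symbol v \<alpha> vs)"
proof -
  have "linear (\<lambda>v. star (wedge v (sign_twist \<alpha>)) vs)"
  proof (rule linearI)
    have "wedge (u + v) \<beta> = (\<lambda>us. wedge u \<beta> us + wedge v \<beta> us)"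
      "wedge (c *\<^sub>R v) \<beta> = (\<lambda>us. c * wedge v \<beta> us)" for u v c and \<beta> :: "(real^'a::_) list \<Rightarrow> real"
      using linear_add[OF wedge_linear_left] linear_scale[OF wedge_linear_left] by fastforce+
    then show "star (wedge (u + v) (sign_twist \<alpha>)) vs
        = star (wedge u (sign_twist \<alpha>)) vs + star (wedge v (sign_twist \<alpha>)) vs"
      "star (wedge (c *\<^sub>R v) (sign_twist \<alpha>)) vs = c *\<^sub>R star (wedge v (sign_twist \<alpha>)) vs" for u v c
      by (simp_all add: star_add star_scale)
  qed
  then show ?thesis
    unfolding symbol_def by (intro linear_compose_sub wedge_linear_left)
qed

text \<open>
  A functional on the fibre that is a finite linear combination of evaluations commutes with
  differentiation of the coefficients, and preserves their smoothness and boundedness.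
\<close>

inductive coeff_functional :: "(((real^'n::finite) list \<Rightarrow> real) \<Rightarrow> real) \<Rightarrow> bool" where
  coeff_eval: "coeff_functional (\<lambda>\<alpha>. \<alpha> vs)"
| coeff_zero: "coeff_functional (\<lambda>\<alpha>. 0)"
| coeff_add: "coeff_functional F \<Longrightarrow> coeff_functional G \<Longrightarrow> coeff_functional (\<lambda>\<alpha>. F \<alpha> + G \<alpha>)"
| coeff_scale: "coeff_functional F \<Longrightarrow> coeff_functional (\<lambda>\<alpha>. c * F \<alpha>)"

definition pointwise_operator ::
    "(((real^'n::finite) list \<Rightarrow> real) \<Rightarrow> (real^'n) list \<Rightarrow> real) \<Rightarrow> bool" where
  "pointwise_operator P \<longleftrightarrow> (\<forall>vs. coeff_functional (\<lambda>\<alpha>. P \<alpha> vs))"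

lemma coeff_functional_compose:
  assumes "coeff_functional F" "pointwise_operator P"
  shows "coeff_functional (\<lambda>\<alpha>. F (P \<alpha>))"
  using assms(1)
  by induction (use assms(2) in \<open>auto simp: pointwise_operator_def intro: coeff_functional.intros\<close>)

lemma pointwise_operator_compose:
  "pointwise_operator P \<Longrightarrow> pointwise_operator Q \<Longrightarrow> pointwise_operator (\<lambda>\<alpha>. P (Q \<alpha>))"
  using coeff_functional_compose unfolding pointwise_operator_def by fastforce

lemma coeff_diff:
  assumes "coeff_functional F" "coeff_functional G"
  shows "coeff_functional (\<lambda>\<alpha>. F \<alpha> - G \<alpha>)"
  using coeff_add[OF assms(1) coeff_scale[OF assms(2), of "-1"]] by simp

lemma coeff_sum:
  "(\<And>i. i \<in> I \<Longrightarrow> coeff_functional (F i)) \<Longrightarrow> coeff_functional (\<lambda>\<alpha>. \<Sum>i\<in>I. F i \<alpha>)"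
  by (induction I rule: infinite_finite_induct) (auto intro: coeff_functional.intros)

lemma pointwise_operator_contract: "pointwise_operator (contract v)"
  by (simp add: pointwise_operator_def contract_def coeff_eval)

lemma pointwise_operator_pullback: "pointwise_operator (pointwise_pullback A)"
  by (simp add: pointwise_operator_def pointwise_pullback_def coeff_eval)

lemma pointwise_operator_sign_twist: "pointwise_operator sign_twist"
  unfolding pointwise_operator_def sign_twist_def by (intro allI coeff_scale coeff_eval)

lemma pointwise_operator_wedge: "pointwise_operator (wedge v)"
proof -
  have "coeff_functional (\<lambda>\<alpha>. wedge v \<alpha> ws)" for ws
  proof (induction ws)
    case (Cons w ws)
    show ?case
      using coeff_diff[OF coeff_scale[OF coeff_eval, of "v \<bullet> w" ws]
          coeff_functional_compose[OF Cons pointwise_operator_contract, of w]] by simp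
  qed (simp add: coeff_zero)
  then show ?thesis by (simp add: pointwise_operator_def)
qed

lemma pointwise_operator_star: "pointwise_operator star"
proof -
  have "coeff_functional (\<lambda>\<alpha>. \<alpha> us * c)" for c and us :: "(real^'a::_) list"
    using coeff_scale[OF coeff_eval, of c us] by (simp add: mult.commute)
  then have "coeff_functional (\<lambda>\<alpha>. pairing p \<alpha> \<gamma>)" for p and \<gamma> :: "(real^'a::_) list \<Rightarrow> real"
    unfolding pairing_def by (intro coeff_sum)
  then have "coeff_functional (\<lambda>\<alpha>. pairing p \<alpha> \<gamma> / d)" for p d and \<gamma> :: "(real^'a::_) list \<Rightarrow> real"
    using coeff_scale[of "\<lambda>\<alpha>. pairing p \<alpha> \<gamma>" "1 / d"] by simp
  then have "coeff_functional (\<lambda>\<alpha>. star \<alpha> vs)" for vs :: "(real^'a::_) list"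
    by (cases "length vs \<le> CARD('a)") (simp_all add: star_def coeff_zero)
  then show ?thesis by (simp add: pointwise_operator_def)
qed

lemma pointwise_operator_symbol: "pointwise_operator (symbol v)"
proof -
  have "pointwise_operator (\<lambda>\<alpha>. star (wedge v (sign_twist \<alpha>)))"
    by (rule pointwise_operator_compose[OF pointwise_operator_star
          pointwise_operator_compose[OF pointwise_operator_wedge pointwise_operator_sign_twist]])
  moreover have "pointwise_operator (\<lambda>\<alpha>. wedge v (star (sign_twist \<alpha>)))"
    by (rule pointwise_operator_compose[OF pointwise_operator_wedge
          pointwise_operator_compose[OF pointwise_operator_star pointwise_operator_sign_twist]])
  ultimately show ?thesis
    by (simp add: pointwise_operator_def symbol_def coeff_diff)
qed

lemma coeff_functional_linear:
  assumes "coeff_functional F"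
  shows "F (\<lambda>vs. a * \<alpha> vs + b * \<beta> vs) = a * F \<alpha> + b * F \<beta>"
  using assms by induction (simp_all add: algebra_simps)

section \<open>Differentiation of forms\<close>

definition smooth :: "(real^'n::finite \<Rightarrow> real) \<Rightarrow> bool" where
  "smooth f \<longleftrightarrow> (\<forall>k. C_k k f)"

lemma smooth_differentiable: "smooth f \<Longrightarrow> f differentiable (at x)"
  unfolding smooth_def by (metis C_k.simps(2))

lemma smooth_has_derivative:
  "smooth f \<Longrightarrow> (f has_derivative frechet_derivative f (at x)) (at x)"
  using smooth_differentiable frechet_derivative_works by blast

lemma smooth_directional: "smooth f \<Longrightarrow> smooth (\<lambda>x. frechet_derivative f (at x) v)"
  unfolding smooth_def by (metis C_k.simps(2))

lemma smooth_continuous: "smooth f \<Longrightarrow> continuous_on UNIV f"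
  unfolding smooth_def by (metis C_k.simps(1))

lemma C_k_zero: "C_k k (\<lambda>x. 0)"
  by (induction k) (simp_all add: frechet_derivative_const)

lemma C_k_add: "C_k k f \<Longrightarrow> C_k k g \<Longrightarrow> C_k k (\<lambda>x. f x + g x)"
proof (induction k arbitrary: f g)
  case (Suc k)
  have "frechet_derivative (\<lambda>x. f x + g x) (at x)
      = (\<lambda>v. frechet_derivative f (at x) v + frechet_derivative g (at x) v)" for x
    using Suc.prems
    by (intro frechet_derivative_at[symmetric] has_derivative_add) (simp_all flip: frechet_derivative_works)
  with Suc show ?case by (simp add: differentiable_add)
qed (simp add: continuous_on_add)

lemma C_k_scale: "C_k k f \<Longrightarrow> C_k k (\<lambda>x. c * f x)"
proof (induction k arbitrary: f)
  case (Suc k)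
  have "frechet_derivative (\<lambda>x. c * f x) (at x) = (\<lambda>v. c * frechet_derivative f (at x) v)" for x
    using Suc.prems
    by (intro frechet_derivative_at[symmetric] has_derivative_mult_right) (simp flip: frechet_derivative_works)
  with Suc show ?case by simp
qed (simp add: continuous_on_mult_left)

lemma frechet_derivative_affine:
  fixes f :: "real^'n::finite \<Rightarrow> real"
  assumes "f differentiable (at (A *v x + a))"
  shows "((\<lambda>y. f (A *v y + a)) has_derivative (\<lambda>v. frechet_derivative f (at (A *v x + a)) (A *v v))) (at x)"
proof -
  have "((\<lambda>y. A *v y + a) has_derivative (*v) A) (at x)"
    using has_derivative_add[OF bounded_linear_imp_has_derivative[OF matrix_vector_mul_bounded_linear]
        has_derivative_const, of A a "at x"] by simp
  then show ?thesis
    using has_derivative_compose[of "\<lambda>y. A *v y + a" "(*v) A" x UNIV f] assms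
    by (simp add: frechet_derivative_works)
qed

lemma smooth_line:
  assumes "smooth f"
  shows "((\<lambda>s. f (y + s *\<^sub>R u)) has_real_derivative frechet_derivative f (at (y + s *\<^sub>R u)) u) (at s)"
proof -
  have g: "((\<lambda>s. y + s *\<^sub>R u) has_derivative (\<lambda>h. h *\<^sub>R u)) (at s)"
    by (auto intro!: derivative_eq_intros)
  have "((\<lambda>s. f (y + s *\<^sub>R u)) has_derivative (\<lambda>h. frechet_derivative f (at (y + s *\<^sub>R u)) (h *\<^sub>R u))) (at s)"
    using has_derivative_compose[OF g smooth_has_derivative[OF assms]] .
  moreover have "frechet_derivative f (at (y + s *\<^sub>R u)) (h *\<^sub>R u) = frechet_derivative f (at (y + s *\<^sub>R u)) u * h" for h
    using linear_scale[OF linear_frechet_derivative[OF smooth_differentiable[OF assms]]] by simp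
  ultimately show ?thesis by (simp add: has_field_derivative_def)
qed

text \<open>Mean value theorem in direction u for the increment over h v, then in direction v. The
  left-hand side is symmetric in u and v, so it can be evaluated in either order.\<close>

lemma second_difference:
  fixes f :: "real^'n::finite \<Rightarrow> real"
  assumes "smooth f" "h > 0"
  obtains s t where "0 < s" "s < h" "0 < t" "t < h"
    "f (x + h *\<^sub>R v + h *\<^sub>R u) - f (x + h *\<^sub>R u) - f (x + h *\<^sub>R v) + f x
       = h\<^sup>2 * frechet_derivative (\<lambda>y. frechet_derivative f (at y) u) (at (x + s *\<^sub>R u + t *\<^sub>R v)) v"
proof -
  define g where "g = (\<lambda>y. frechet_derivative f (at y) u)"
  have g: "smooth g" unfolding g_def by (rule smooth_directional[OF assms(1)])
  let ?\<phi> = "\<lambda>s. f (x + h *\<^sub>R v + s *\<^sub>R u) - f (x + s *\<^sub>R u)"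
  have "(?\<phi> has_real_derivative g (x + h *\<^sub>R v + s *\<^sub>R u) - g (x + s *\<^sub>R u)) (at s)" for s
    unfolding g_def by (intro DERIV_diff smooth_line assms)
  then obtain s where s: "0 < s" "s < h"
    "?\<phi> h - ?\<phi> 0 = (h - 0) * (g (x + h *\<^sub>R v + s *\<^sub>R u) - g (x + s *\<^sub>R u))"
    using MVT2[OF assms(2), of ?\<phi> "\<lambda>s. g (x + h *\<^sub>R v + s *\<^sub>R u) - g (x + s *\<^sub>R u)"] by blast
  obtain t where t: "0 < t" "t < h"
    "g (x + s *\<^sub>R u + h *\<^sub>R v) - g (x + s *\<^sub>R u + 0 *\<^sub>R v)
       = (h - 0) * frechet_derivative g (at (x + s *\<^sub>R u + t *\<^sub>R v)) v"
    using MVT2[OF assms(2), of "\<lambda>t. g (x + s *\<^sub>R u + t *\<^sub>R v)"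
        "\<lambda>t. frechet_derivative g (at (x + s *\<^sub>R u + t *\<^sub>R v)) v"] smooth_line[OF g] by blast
  have e: "x + h *\<^sub>R v + s *\<^sub>R u = x + s *\<^sub>R u + h *\<^sub>R v" by simp
  have "f (x + h *\<^sub>R v + h *\<^sub>R u) - f (x + h *\<^sub>R u) - f (x + h *\<^sub>R v) + f x
      = h * (h * frechet_derivative g (at (x + s *\<^sub>R u + t *\<^sub>R v)) v)"
    using s(3) t(3) unfolding e by simp
  then show ?thesis
    using that[OF s(1,2) t(1,2)] unfolding g_def[symmetric] by (simp add: power2_eq_square)
qed

text \<open>The same second difference divided by the square of h converges to both mixed
  derivatives, by continuity of each.\<close>

lemma mixed_partials_commute:
  fixes f :: "real^'n::finite \<Rightarrow> real"
  assumes "smooth f"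
  shows "frechet_derivative (\<lambda>y. frechet_derivative f (at y) u) (at x) v
       = frechet_derivative (\<lambda>y. frechet_derivative f (at y) v) (at x) u"
proof -
  define F where "F = (\<lambda>u v y. frechet_derivative (\<lambda>y. frechet_derivative f (at y) u) (at y) v)"
  have F: "continuous_on UNIV (F u v)" for u v
    unfolding F_def by (intro smooth_continuous smooth_directional assms)
  define h :: "nat \<Rightarrow> real" where "h = (\<lambda>n. 1 / real (Suc n))"
  have h0: "h n > 0" for n by (simp add: h_def)
  have hlim: "h \<longlonglongrightarrow> 0" unfolding h_def by (rule lim_inverse_n'[THEN LIMSEQ_Suc])
  define \<Delta> where "\<Delta> = (\<lambda>h. f (x + h *\<^sub>R v + h *\<^sub>R u) - f (x + h *\<^sub>R u) - f (x + h *\<^sub>R v) + f x)"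
  have lim: "(\<lambda>n. \<Delta> (h n) / (h n)\<^sup>2) \<longlonglongrightarrow> F u' v' x"
    if ex: "\<And>n. \<exists>s t. 0 < s \<and> s < h n \<and> 0 < t \<and> t < h n \<and> \<Delta> (h n) = (h n)\<^sup>2 * F u' v' (x + s *\<^sub>R u' + t *\<^sub>R v')" for u' v'
  proof -
    obtain s t where st: "\<And>n. 0 < s n" "\<And>n. s n < h n" "\<And>n. 0 < t n" "\<And>n. t n < h n"
      "\<And>n. \<Delta> (h n) = (h n)\<^sup>2 * F u' v' (x + s n *\<^sub>R u' + t n *\<^sub>R v')"
      using ex by metis
    have "s \<longlonglongrightarrow> 0" "t \<longlonglongrightarrow> 0"
      by (rule tendsto_sandwich[OF _ _ tendsto_const hlim]; use st in \<open>auto intro!: always_eventually less_imp_le\<close>)+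
    then have "(\<lambda>n. x + s n *\<^sub>R u' + t n *\<^sub>R v') \<longlonglongrightarrow> x + 0 *\<^sub>R u' + 0 *\<^sub>R v'"
      by (intro tendsto_intros)
    then have "(\<lambda>n. F u' v' (x + s n *\<^sub>R u' + t n *\<^sub>R v')) \<longlonglongrightarrow> F u' v' x"
      using continuous_on_tendsto_compose[OF F[of u' v']] by simp
    moreover have "\<Delta> (h n) / (h n)\<^sup>2 = F u' v' (x + s n *\<^sub>R u' + t n *\<^sub>R v')" for n
      using st(5)[of n] h0[of n] by simp
    ultimately show ?thesis by simp
  qed
  have "(\<lambda>n. \<Delta> (h n) / (h n)\<^sup>2) \<longlonglongrightarrow> F u v x"
    by (rule lim) (metis second_difference[OF assms h0] \<Delta>_def F_def)
  moreover have "(\<lambda>n. \<Delta> (h n) / (h n)\<^sup>2) \<longlonglongrightarrow> F v u x"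
  proof (rule lim)
    fix n
    have "\<Delta> (h n) = f (x + h n *\<^sub>R u + h n *\<^sub>R v) - f (x + h n *\<^sub>R v) - f (x + h n *\<^sub>R u) + f x"
      by (simp add: \<Delta>_def algebra_simps)
    then show "\<exists>s t. 0 < s \<and> s < h n \<and> 0 < t \<and> t < h n \<and> \<Delta> (h n) = (h n)\<^sup>2 * F v u (x + s *\<^sub>R v + t *\<^sub>R u)"
      by (metis second_difference[OF assms h0] F_def)
  qed
  ultimately show ?thesis
    using LIMSEQ_unique unfolding F_def by blast
qed

text \<open>The covariant derivative of the flat connection: the argument vectors are parallel
  fields.\<close>

definition form_deriv :: "real^'n \<Rightarrow> 'n::finite form \<Rightarrow> 'n form" where
  "form_deriv v \<omega> = (\<lambda>x vs. frechet_derivative (\<lambda>y. \<omega> y vs) (at x) v)"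

lemma smooth_form_iff:
  "smooth_form \<omega> \<longleftrightarrow> (\<forall>x. alternating_multilinear (\<omega> x)) \<and> (\<forall>vs. smooth (\<lambda>x. \<omega> x vs))"
  by (simp add: smooth_form_def smooth_def)

lemma smooth_formD:
  assumes "smooth_form \<omega>"
  shows "alternating_multilinear (\<omega> x)" "smooth (\<lambda>x. \<omega> x vs)"
  using assms by (simp_all add: smooth_form_iff)

lemma coeff_functional_smooth:
  assumes "coeff_functional F" "smooth_form \<omega>"
  shows "smooth (\<lambda>x. F (\<omega> x))"
  using assms(1)
  by induction (use smooth_formD[OF assms(2)] in \<open>auto simp: smooth_def C_k_zero intro: C_k_add C_k_scale\<close>)

lemma coeff_functional_deriv:
  assumes "coeff_functional F" "smooth_form \<omega>"
  shows "frechet_derivative (\<lambda>x. F (\<omega> x)) (at x) v = F (form_deriv v \<omega> x)"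
  using assms(1)
proof induction
  case (coeff_add F G)
  have "((\<lambda>x. F (\<omega> x) + G (\<omega> x)) has_derivative
      (\<lambda>v. frechet_derivative (\<lambda>x. F (\<omega> x)) (at x) v + frechet_derivative (\<lambda>x. G (\<omega> x)) (at x) v)) (at x)"
    by (intro has_derivative_add smooth_has_derivative coeff_functional_smooth assms(2) coeff_add.hyps)
  then show ?case using coeff_add.IH by (simp add: frechet_derivative_at[symmetric])
next
  case (coeff_scale F c)
  have "((\<lambda>x. c * F (\<omega> x)) has_derivative
      (\<lambda>v. c * frechet_derivative (\<lambda>x. F (\<omega> x)) (at x) v)) (at x)"
    by (intro has_derivative_mult_right smooth_has_derivative coeff_functional_smooth assms(2) coeff_scale.hyps)
  then show ?case using coeff_scale.IH by (simp add: frechet_derivative_at[symmetric])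
qed (simp_all add: form_deriv_def frechet_derivative_const)

lemma smooth_form_pointwise:
  assumes "pointwise_operator P" "smooth_form \<omega>" "\<And>\<alpha>. alternating_multilinear \<alpha> \<Longrightarrow> alternating_multilinear (P \<alpha>)"
  shows "smooth_form (\<lambda>x. P (\<omega> x))"
  using assms coeff_functional_smooth[OF _ assms(2), of "\<lambda>\<alpha>. P \<alpha> vs" for vs]
  by (simp add: smooth_form_iff pointwise_operator_def)

lemma form_deriv_pointwise:
  assumes "pointwise_operator P" "smooth_form \<omega>"
  shows "form_deriv v (\<lambda>x. P (\<omega> x)) = (\<lambda>x. P (form_deriv v \<omega> x))"
  using coeff_functional_deriv[OF _ assms(2), of "\<lambda>\<alpha>. P \<alpha> vs" for vs] assms(1)
  by (simp add: form_deriv_def[of v "\<lambda>x. P (\<omega> x)"] pointwise_operator_def fun_eq_iff)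

lemma form_deriv_linear:
  assumes "smooth_form \<omega>"
  shows "linear (\<lambda>v. form_deriv v \<omega> x vs)"
  unfolding form_deriv_def
  by (rule linear_frechet_derivative[OF smooth_differentiable[OF smooth_formD(2)[OF assms]]])

lemma smooth_form_add:
  "smooth_form \<omega> \<Longrightarrow> smooth_form \<eta> \<Longrightarrow> smooth_form (\<lambda>x vs. \<omega> x vs + \<eta> x vs)"
  by (auto simp: smooth_form_def alternating_add C_k_add)

lemma smooth_form_scale: "smooth_form \<omega> \<Longrightarrow> smooth_form (\<lambda>x vs. c * \<omega> x vs)"
  by (auto simp: smooth_form_def alternating_scale C_k_scale)

lemma smooth_form_sum:
  "(\<And>i. i \<in> I \<Longrightarrow> smooth_form (\<omega> i)) \<Longrightarrow> smooth_form (\<lambda>x vs. \<Sum>i\<in>I. \<omega> i x vs)"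
  by (induction I rule: infinite_finite_induct)
     (auto simp: smooth_form_add, auto simp: smooth_form_def alternating_zero C_k_zero)

lemma form_deriv_add:
  assumes "smooth_form \<omega>" "smooth_form \<eta>"
  shows "form_deriv v (\<lambda>x vs. \<omega> x vs + \<eta> x vs) = (\<lambda>x vs. form_deriv v \<omega> x vs + form_deriv v \<eta> x vs)"
proof (intro ext)
  fix x vs
  have "((\<lambda>x. \<omega> x vs + \<eta> x vs) has_derivative
      (\<lambda>v. frechet_derivative (\<lambda>x. \<omega> x vs) (at x) v + frechet_derivative (\<lambda>x. \<eta> x vs) (at x) v)) (at x)"
    by (intro has_derivative_add smooth_has_derivative smooth_formD(2) assms)
  then show "form_deriv v (\<lambda>x vs. \<omega> x vs + \<eta> x vs) x vs = form_deriv v \<omega> x vs + form_deriv v \<eta> x vs"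
    by (simp add: form_deriv_def frechet_derivative_at[symmetric])
qed

lemma form_deriv_zero: "form_deriv v (\<lambda>x vs. 0) = (\<lambda>x vs. 0)"
  by (simp add: form_deriv_def frechet_derivative_const)

lemma form_deriv_scale:
  assumes "smooth_form \<omega>"
  shows "form_deriv v (\<lambda>x vs. c * \<omega> x vs) = (\<lambda>x vs. c * form_deriv v \<omega> x vs)"
proof (intro ext)
  fix x vs
  have "((\<lambda>x. c * \<omega> x vs) has_derivative (\<lambda>v. c * frechet_derivative (\<lambda>x. \<omega> x vs) (at x) v)) (at x)"
    by (intro has_derivative_mult_right smooth_has_derivative smooth_formD(2) assms)
  then show "form_deriv v (\<lambda>x vs. c * \<omega> x vs) x vs = c * form_deriv v \<omega> x vs"
    by (simp add: form_deriv_def frechet_derivative_at[symmetric])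
qed

lemma form_deriv_sum:
  assumes "\<And>i. i \<in> I \<Longrightarrow> smooth_form (\<omega> i)"
  shows "form_deriv v (\<lambda>x vs. \<Sum>i\<in>I. \<omega> i x vs) = (\<lambda>x vs. \<Sum>i\<in>I. form_deriv v (\<omega> i) x vs)"
  using assms
  by (induction I rule: infinite_finite_induct)
     (auto simp: form_deriv_zero form_deriv_add smooth_form_sum)

lemma smooth_form_deriv:
  assumes "smooth_form \<omega>"
  shows "smooth_form (form_deriv v \<omega>)"
proof -
  have "alternating_multilinear (form_deriv v \<omega> x)" for x
    unfolding alternating_multilinear_def
  proof (intro conjI allI)
    fix us ws :: "(real^'a) list"
    have diff: "(\<lambda>y. \<omega> y vs) differentiable (at x)" for vs
      by (intro smooth_differentiable smooth_formD assms)
    show "linear (\<lambda>w. form_deriv v \<omega> x (us @ w # ws))"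
    proof (rule linearI)
      fix a b :: "real^'a" and c :: real
      note lin = alternating_linear[OF smooth_formD(1)[OF assms], of _ us ws]
      have "((\<lambda>y. \<omega> y (us @ (a + b) # ws)) has_derivative
        (\<lambda>v. form_deriv v \<omega> x (us @ a # ws) + form_deriv v \<omega> x (us @ b # ws))) (at x)"
        unfolding linear_add[OF lin] form_deriv_def
        by (intro has_derivative_add) (simp_all add: diff flip: frechet_derivative_works)
      then show "form_deriv v \<omega> x (us @ (a + b) # ws) = form_deriv v \<omega> x (us @ a # ws) + form_deriv v \<omega> x (us @ b # ws)"
        using fun_cong[OF frechet_derivative_at, of _ _ x v] by (fastforce simp: form_deriv_def)
      have "((\<lambda>y. \<omega> y (us @ (c *\<^sub>R a) # ws)) has_derivative (\<lambda>v. c *\<^sub>R form_deriv v \<omega> x (us @ a # ws))) (at x)"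
        unfolding linear_scale[OF lin] form_deriv_def
        by (intro has_derivative_scaleR_right) (simp_all add: diff flip: frechet_derivative_works)
      then show "form_deriv v \<omega> x (us @ (c *\<^sub>R a) # ws) = c *\<^sub>R form_deriv v \<omega> x (us @ a # ws)"
        using fun_cong[OF frechet_derivative_at, of _ _ x v] by (fastforce simp: form_deriv_def)
    qed
  next
    fix us vs ws :: "(real^'a) list" and w
    show "form_deriv v \<omega> x (us @ w # vs @ w # ws) = 0"
      by (simp add: form_deriv_def alternating_repeat[OF smooth_formD(1)[OF assms]] frechet_derivative_const)
  qed
  moreover have "smooth (\<lambda>x. form_deriv v \<omega> x vs)" for vs
    unfolding form_deriv_def by (intro smooth_directional smooth_formD assms)
  ultimately show ?thesis by (simp add: smooth_form_iff)
qed

lemma even_form_deriv: "even_form \<omega> \<Longrightarrow> even_form (form_deriv v \<omega>)"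
  by (simp add: even_form_def form_deriv_def frechet_derivative_const)

lemma form_deriv_commute:
  "smooth_form \<omega> \<Longrightarrow> form_deriv u (form_deriv v \<omega>) = form_deriv v (form_deriv u \<omega>)"
  by (simp add: form_deriv_def fun_eq_iff mixed_partials_commute[OF smooth_formD(2)])

lemma sum_form_deriv_expansion:
  assumes "smooth_form \<omega>"
  shows "(\<Sum>j\<in>UNIV. v $ j * form_deriv (unit_vec j) \<omega> x vs) = form_deriv v \<omega> x vs"
  using sum_basis_expansion[OF form_deriv_linear[OF assms], of v x vs] by simp

lemma ext_deriv_eq:
  assumes "smooth_form \<omega>"
  shows "ext_deriv \<omega> x vs = (\<Sum>j\<in>UNIV. wedge (unit_vec j) (form_deriv (unit_vec j) \<omega> x) vs)"
proof -
  have "(\<Sum>j\<in>UNIV. wedge (unit_vec j) (form_deriv (unit_vec j) \<omega> x) vs)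
     = (\<Sum>i<length vs. (-1) ^ i * (\<Sum>j\<in>UNIV. vs ! i $ j * form_deriv (unit_vec j) \<omega> x (take i vs @ drop (Suc i) vs)))"
    unfolding wedge_eq_sum by (subst sum.swap) (simp add: sum_distrib_left inner_axis')
  then show ?thesis
    by (simp add: sum_form_deriv_expansion[OF assms]) (simp add: ext_deriv_def form_deriv_def)
qed

lemma even_alternating_form:
  "smooth_form \<omega> \<Longrightarrow> even_form \<omega> \<Longrightarrow> even_alternating (\<omega> x)"
  by (simp add: even_alternating_def smooth_formD even_form_def)

text \<open>B has constant coefficients: d is the sum of wedges with basis covectors after partial
  derivatives, and the star commutes with the latter.\<close>

lemma signature_operator_eq:
  fixes \<omega> :: "'n::{finite,linorder} form"
  assumes "smooth_form \<omega>" "even_form \<omega>"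
  shows "signature_operator \<omega> = (\<lambda>x vs. \<Sum>j\<in>UNIV. symbol (unit_vec j) (form_deriv (unit_vec j) \<omega> x) vs)"
proof (intro ext)
  fix x and vs :: "(real^'n::_) list"
  let ?n = "CARD('n)" and ?e = "unit_vec :: 'n \<Rightarrow> _"
  define part where "part = (\<lambda>q (\<alpha> :: (real^'n::_) list \<Rightarrow> real) us. if length us = q then \<alpha> us else 0)"
  define c :: "nat \<Rightarrow> real" where "c = (\<lambda>q. (-1) ^ ((?n + 1) div 4 + (q + 1) div 2 + 1))"
  let ?D = "\<lambda>j. form_deriv (?e j) \<omega> x"
  have "coeff_functional (\<lambda>\<alpha>. part q \<alpha> us)" for q us
    by (cases "length us = q") (simp_all add: part_def coeff_eval coeff_zero)
  then have part_op: "pointwise_operator (part q)" for q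
    by (simp add: pointwise_operator_def)
  have part_alt: "alternating_multilinear (part q \<alpha>)" if "alternating_multilinear \<alpha>" for q \<alpha>
    using alternating_length_cong[OF that, of "\<lambda>l. if l = q then 1 else 0"]
    by (simp add: part_def if_distrib[of "\<lambda>x. x * _"] cong: if_cong)
  have \<phi>: "degree_part q \<omega> = (\<lambda>x. part q (\<omega> x))" for q
    by (simp add: degree_part_def part_def)
  have sm: "smooth_form (degree_part q \<omega>)" for q
    unfolding \<phi> by (rule smooth_form_pointwise[OF part_op assms(1) part_alt])
  have d\<phi>: "form_deriv v (degree_part q \<omega>) = (\<lambda>x. part q (form_deriv v \<omega> x))" for v q
    unfolding \<phi> by (rule form_deriv_pointwise[OF part_op assms(1)])
  have hs: "hodge_star (degree_part q \<omega>) = (\<lambda>x. star (degree_part q \<omega> x))" for q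
    by (simp add: hodge_star_eq fun_eq_iff)
  have sm': "smooth_form (\<lambda>x. star (degree_part q \<omega> x))" for q
    by (rule smooth_form_pointwise[OF pointwise_operator_star sm]) (rule alternating_star)
  let ?P = "\<lambda>q j. star (wedge (?e j) (part q (?D j))) vs - wedge (?e j) (star (part q (?D j))) vs"
  have t1: "hodge_star (ext_deriv (degree_part q \<omega>)) x vs = (\<Sum>j\<in>UNIV. star (wedge (?e j) (part q (?D j))) vs)" for q
    by (simp add: hodge_star_eq ext_deriv_eq[OF sm, abs_def] d\<phi> star_sum)
  have t2: "ext_deriv (hodge_star (degree_part q \<omega>)) x vs = (\<Sum>j\<in>UNIV. wedge (?e j) (star (part q (?D j))) vs)" for q
    by (simp add: hs ext_deriv_eq[OF sm'] form_deriv_pointwise[OF pointwise_operator_star sm] d\<phi>)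
  have "signature_operator \<omega> x vs = (\<Sum>q\<le>?n. c q * (\<Sum>j\<in>UNIV. ?P q j))"
    unfolding signature_operator_def
  proof (rule sum.cong[OF refl], goal_cases)
    case (1 q)
    show ?case
    proof (cases "even q")
      case True
      then show ?thesis by (simp add: Let_def t1 t2 sum_subtractf c_def)
    next
      \<comment> \<open>In odd degrees, where \<open>\<epsilon>\<close> is -1, the component of an
        even form is zero.\<close>
      case False
      have "part q (?D j) = (\<lambda>_. 0)" for j
        using even_form_deriv[OF assms(2)] False by (auto simp: part_def even_form_def)
      moreover have "star (\<lambda>_ :: (real^'n::_) list. 0) = (\<lambda>_. 0)" "wedge (?e j) (\<lambda>_. 0) = (\<lambda>_. 0)" for j
        by (auto intro: star_eq_zero)
      ultimately show ?thesis by (simp add: Let_def t1 t2)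
    qed
  qed
  also have "\<dots> = (\<Sum>j\<in>UNIV. \<Sum>q\<le>?n. c q * ?P q j)"
    by (simp add: sum_distrib_left sum.swap[of _ "{..?n}"])
  also have "\<dots> = (\<Sum>j\<in>UNIV. symbol (?e j) (?D j) vs)"
  proof (rule sum.cong[OF refl])
    fix j
    \<comment> \<open>Summing over degrees up to n reassembles the whole form, since alternating
      functions vanish on longer lists.\<close>
    have "(\<Sum>q\<le>?n. c q * part q (?D j) us) = sign_twist (?D j) us" for us
    proof -
      have "(\<Sum>q\<le>?n. c q * part q (?D j) us) = (if length us \<le> ?n then c (length us) * ?D j us else 0)"
        by (simp add: part_def if_distrib[of "\<lambda>x. _ * x"] cong: if_cong)
      then show ?thesis
        using alternating_eq_zero[OF smooth_formD(1)[OF smooth_form_deriv[OF assms(1)]], of us]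
        by (auto simp: sign_twist_def c_def)
    qed
    then have tw: "sign_twist (?D j) = (\<lambda>us. \<Sum>q\<le>?n. c q * part q (?D j) us)" by simp
    have w: "wedge (?e j) (\<lambda>us. \<Sum>q\<le>?n. c q * part q (?D j) us)
        = (\<lambda>us. \<Sum>q\<le>?n. c q * wedge (?e j) (part q (?D j)) us)"
      and s: "star (\<lambda>us. \<Sum>q\<le>?n. c q * part q (?D j) us) = (\<lambda>us. \<Sum>q\<le>?n. c q * star (part q (?D j)) us)"
      by (simp_all add: fun_eq_iff wedge_sum wedge_scale star_sum star_scale)
    show "(\<Sum>q\<le>?n. c q * ?P q j) = symbol (?e j) (?D j) vs"
      unfolding symbol_def tw w s
      by (simp add: wedge_sum wedge_scale star_sum star_scale sum_subtractf right_diff_distrib)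
  qed
  finally show "signature_operator \<omega> x vs = (\<Sum>j\<in>UNIV. symbol (?e j) (?D j) vs)" .
qed

section \<open>Bounded forms on planes\<close>

lemma pointwise_operator_linear_combination:
  assumes "pointwise_operator P"
  shows "P (\<lambda>vs. a * \<alpha> vs + b * \<beta> vs) ws = a * P \<alpha> ws + b * P \<beta> ws"
  using coeff_functional_linear[of "\<lambda>\<alpha>. P \<alpha> ws" a \<alpha> b \<beta>] assms by (simp add: pointwise_operator_def)

lemma pointwise_operator_zero:
  "pointwise_operator P \<Longrightarrow> P (\<lambda>_. 0) ws = 0"
  using pointwise_operator_linear_combination[of P 0 "\<lambda>_. 0" 0 "\<lambda>_. 0" ws] by simp

lemma pointwise_operator_scale:
  "pointwise_operator P \<Longrightarrow> P (\<lambda>vs. a * \<alpha> vs) ws = a * P \<alpha> ws"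
  using pointwise_operator_linear_combination[of P a \<alpha> 0 "\<lambda>_. 0" ws] by simp

lemma pointwise_operator_add:
  "pointwise_operator P \<Longrightarrow> P (\<lambda>vs. \<alpha> vs + \<beta> vs) ws = P \<alpha> ws + P \<beta> ws"
  using pointwise_operator_linear_combination[of P 1 \<alpha> 1 \<beta> ws] by simp

lemma pointwise_operator_sum:
  "pointwise_operator P \<Longrightarrow> P (\<lambda>vs. \<Sum>i\<in>I. \<alpha> i vs) ws = (\<Sum>i\<in>I. P (\<alpha> i) ws)"
proof (induction I rule: infinite_finite_induct)
  case (insert i I)
  then show ?case
    using pointwise_operator_add[of P "\<alpha> i" "\<lambda>vs. \<Sum>i\<in>I. \<alpha> i vs" ws] by simp
qed (simp_all add: pointwise_operator_zero)

text \<open>Bounds values by coefficients and norms of arguments alone, hence uniformly over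
  arguments moved by the holonomy.\<close>

lemma multilinear_bound:
  assumes "alternating_multilinear \<alpha>"
  shows "\<bar>\<alpha> vs\<bar> \<le> prod_list (map norm vs) *
    (\<Sum>is\<in>{is. length is = length vs}. \<bar>\<alpha> (map unit_vec is)\<bar>)"
  using assms
proof (induction vs arbitrary: \<alpha>)
  case (Cons v vs)
  let ?S = "\<lambda>\<beta>. \<Sum>is\<in>{is. length is = length vs}. \<bar>\<beta> (map unit_vec is)\<bar>"
  let ?p = "prod_list (map norm vs)"
  have p: "0 \<le> ?p" by (induction vs) simp_all
  have "\<alpha> (v # vs) = (\<Sum>i\<in>UNIV. v $ i * contract (unit_vec i) \<alpha> vs)"
    by (simp add: sum_contract_expansion[OF Cons.prems]) (simp add: contract_def)
  also have "\<bar>\<dots>\<bar> \<le> (\<Sum>i\<in>UNIV. \<bar>v $ i\<bar> * \<bar>contract (unit_vec i) \<alpha> vs\<bar>)"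
    unfolding abs_mult[symmetric] by (rule sum_abs)
  also have "\<dots> \<le> (\<Sum>i\<in>UNIV. norm v * (?p * ?S (contract (unit_vec i) \<alpha>)))"
    by (intro sum_mono mult_mono Cons.IH alternating_contract Cons.prems component_le_norm_cart) simp_all
  also have "\<dots> = prod_list (map norm (v # vs)) * (\<Sum>i\<in>UNIV. ?S (contract (unit_vec i) \<alpha>))"
    by (simp add: sum_distrib_left mult.assoc)
  also have "(\<Sum>i\<in>UNIV. ?S (contract (unit_vec i) \<alpha>))
      = (\<Sum>is\<in>{is. length is = length (v # vs)}. \<bar>\<alpha> (map unit_vec is)\<bar>)"
    by (simp add: sum_lists_Suc contract_def)
  finally show ?case .
qed simp

definition bounded_form :: "'n::finite form \<Rightarrow> bool" where
  "bounded_form \<omega> \<longleftrightarrow> (\<forall>vs. \<exists>C. \<forall>x. \<bar>\<omega> x vs\<bar> \<le> C)"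

lemma orthogonal_matrix_norm:
  fixes A :: "real^'n^'n"
  assumes "orthogonal_matrix A"
  shows "norm (transpose A *v v) = norm v"
proof -
  have "(transpose A *v v) \<bullet> (transpose A *v v) = v \<bullet> (A *v (transpose A *v v))"
    by (metis dot_lmul_matrix transpose_matrix_vector)
  then show ?thesis
    using assms by (simp add: norm_eq_sqrt_inner matrix_vector_mul_assoc orthogonal_matrix_def del: transpose_matrix_vector)
qed

text \<open>Every point is moved into a compact set by the group, and the linear parts preserve the
  norms of the arguments. Invariance is asked only up to sign, so that derivatives along u and w are
  covered too.\<close>

lemma invariant_form_bounded:
  fixes \<theta> :: "'n::finite form"
  assumes "cocompact \<Gamma>" "\<And>g. g \<in> \<Gamma> \<Longrightarrow> orthogonal_matrix (fst g)" "smooth_form \<theta>"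
    and inv: "\<And>g x vs. g \<in> \<Gamma> \<Longrightarrow> \<bar>\<theta> (act g x) (map ((*v) (fst g)) vs)\<bar> = \<bar>\<theta> x vs\<bar>"
  shows "bounded_form \<theta>"
  unfolding bounded_form_def
proof
  fix vs :: "(real^'n) list"
  obtain K where K: "compact K" "(\<Union>g\<in>\<Gamma>. act g ` K) = UNIV"
    using assms(1) by (auto simp: cocompact_def)
  define f where "f = (\<lambda>x. \<Sum>is\<in>{is. length is = length vs}. \<bar>\<theta> x (map unit_vec is)\<bar>)"
  have "continuous_on UNIV f"
    unfolding f_def by (intro continuous_intros smooth_continuous smooth_formD assms(3))
  then have "bounded (f ` K)"
    using K(1) by (meson compact_continuous_image compact_imp_bounded continuous_on_subset subset_UNIV)
  then obtain M where M: "\<And>x. x \<in> K \<Longrightarrow> \<bar>f x\<bar> \<le> M"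
    by (auto simp: bounded_iff)
  have p: "0 \<le> prod_list (map norm ws)" for ws :: "(real^'n) list" by (induction ws) simp_all
  have "\<bar>\<theta> x vs\<bar> \<le> prod_list (map norm vs) * M" for x
  proof -
    obtain g k where g: "g \<in> \<Gamma>" "k \<in> K" "x = act g k"
    proof -
      have "x \<in> (\<Union>g\<in>\<Gamma>. act g ` K)" using K(2) by simp
      then show ?thesis using that by blast
    qed
    let ?A = "fst g"
    let ?ws = "map ((*v) (transpose ?A)) vs"
    have "map ((*v) ?A) ?ws = vs"
      using assms(2)[OF g(1)]
      by (simp add: o_def matrix_vector_mul_assoc orthogonal_matrix_def del: transpose_matrix_vector)
    then have "\<bar>\<theta> x vs\<bar> = \<bar>\<theta> k ?ws\<bar>"
      using inv[OF g(1), of k ?ws] g(3) by simp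
    also have "\<dots> \<le> prod_list (map norm ?ws) * f k"
      using multilinear_bound[OF smooth_formD(1)[OF assms(3)], of k ?ws] by (simp add: f_def)
    also have "map norm ?ws = map norm vs"
      by (simp add: o_def orthogonal_matrix_norm[OF assms(2)[OF g(1)]] del: transpose_matrix_vector)
    also have "prod_list (map norm vs) * f k \<le> prod_list (map norm vs) * M"
      using M[OF g(2)] p by (intro mult_left_mono) auto
    finally show ?thesis .
  qed
  then show "\<exists>C. \<forall>x. \<bar>\<theta> x vs\<bar> \<le> C" by blast
qed

lemma coeff_functional_bounded:
  assumes "coeff_functional F" "bounded_form \<omega>"
  shows "\<exists>C. \<forall>x. \<bar>F (\<omega> x)\<bar> \<le> C"
  using assms(1)
proof induction
  case (coeff_add F G)
  then obtain C D where "\<And>x. \<bar>F (\<omega> x)\<bar> \<le> C" "\<And>x. \<bar>G (\<omega> x)\<bar> \<le> D" by blast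
  then have "\<bar>F (\<omega> x) + G (\<omega> x)\<bar> \<le> C + D" for x
    using abs_triangle_ineq[of "F (\<omega> x)" "G (\<omega> x)"] by (smt (verit))
  then show ?case by blast
next
  case (coeff_scale F c)
  then obtain C where "\<And>x. \<bar>F (\<omega> x)\<bar> \<le> C" by blast
  then have "\<bar>c * F (\<omega> x)\<bar> \<le> \<bar>c\<bar> * C" for x
    by (simp add: abs_mult mult_left_mono)
  then show ?case by blast
next
  case (coeff_eval vs)
  then show ?case using assms(2) by (simp add: bounded_form_def)
next
  case coeff_zero
  then show ?case by auto
qed

lemma bounded_cauchy_riemann:
  fixes f g :: "real^'n::finite \<Rightarrow> real"
  assumes f: "smooth f" and g: "smooth g"
    and cr1: "\<And>x. frechet_derivative f (at x) u = frechet_derivative g (at x) w"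
    and cr2: "\<And>x. frechet_derivative f (at x) w = - frechet_derivative g (at x) u"
    and bf: "\<And>x. \<bar>f x\<bar> \<le> C" and bg: "\<And>x. \<bar>g x\<bar> \<le> D"
  shows "frechet_derivative f (at x) u = 0" "frechet_derivative f (at x) w = 0"
proof -
  \<comment> \<open>The affine plane through x, parametrised by the complex plane; on it f + i g
    becomes a bounded entire function.\<close>
  define p where "p = (\<lambda>z. x + Re z *\<^sub>R u + Im z *\<^sub>R w)"
  define h where "h = (\<lambda>z. of_real (f (p z)) + \<i> * of_real (g (p z)))"
  define h' where "h' = (\<lambda>z. Complex (frechet_derivative f (at (p z)) u) (frechet_derivative g (at (p z)) u))"
  have p: "(p has_derivative (\<lambda>d. Re d *\<^sub>R u + Im d *\<^sub>R w)) (at z)" for z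
    unfolding p_def by (auto intro!: derivative_eq_intros has_derivative_Re has_derivative_Im)
  have comp: "((\<lambda>z. q (p z)) has_derivative
      (\<lambda>d. Re d * frechet_derivative q (at (p z)) u + Im d * frechet_derivative q (at (p z)) w)) (at z)"
    if "smooth q" for q :: "real^'n \<Rightarrow> real" and z
  proof -
    have lin: "linear (frechet_derivative q (at (p z)))"
      by (rule linear_frechet_derivative[OF smooth_differentiable[OF that]])
    show ?thesis
      using has_derivative_compose[OF p[of z] smooth_has_derivative[OF that]]
      by (simp add: linear_add[OF lin] linear_scale[OF lin])
  qed
  have "(h has_field_derivative h' z) (at z)" for z
  proof -
    have "(h has_derivative (\<lambda>d.
        of_real (Re d * frechet_derivative f (at (p z)) u + Im d * frechet_derivative f (at (p z)) w)
        + \<i> * of_real (Re d * frechet_derivative g (at (p z)) u + Im d * frechet_derivative g (at (p z)) w))) (at z)"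
      unfolding h_def
      by (intro has_derivative_add has_derivative_mult_right has_derivative_of_real comp f g)
    also have "(\<lambda>d. of_real (Re d * frechet_derivative f (at (p z)) u + Im d * frechet_derivative f (at (p z)) w)
        + \<i> * of_real (Re d * frechet_derivative g (at (p z)) u + Im d * frechet_derivative g (at (p z)) w))
      = (*) (h' z)"
      using cr1[of "p z"] cr2[of "p z"] by (auto simp: fun_eq_iff complex_eq_iff h'_def)
    finally show ?thesis by (simp add: has_field_derivative_def)
  qed
  note deriv = this
  then have "h holomorphic_on UNIV"
    by (meson holomorphic_on_open open_UNIV)
  moreover have "norm (h z) \<le> C + D" for z
    unfolding h_def
    by (rule order_trans[OF norm_triangle_ineq]) (simp add: norm_mult add_mono bf bg)
  then have "bounded (range h)" by (auto simp: bounded_iff)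
  ultimately obtain c where "\<And>z. h z = c"
    using Liouville_theorem by (auto simp: constant_on_def)
  then have "h = (\<lambda>_. c)" by auto
  then have "h' 0 = 0"
    using DERIV_unique[OF deriv[of 0]] by auto
  then have "frechet_derivative f (at x) u = 0 \<and> frechet_derivative g (at x) u = 0"
    by (simp add: h'_def p_def complex_eq_iff)
  then show "frechet_derivative f (at x) u = 0" "frechet_derivative f (at x) w = 0"
    using cr2[of x] by simp_all
qed

lemma bounded_affine_on_lines:
  assumes "smooth f" "\<And>x. \<bar>f x\<bar> \<le> C"
    and "\<And>x. frechet_derivative (\<lambda>y. frechet_derivative f (at y) u) (at x) u = 0"
  shows "frechet_derivative f (at x) u = 0"
proof -
  define c where "c = frechet_derivative f (at x) u"
  have "((\<lambda>s. frechet_derivative f (at (x + s *\<^sub>R u)) u) has_real_derivative 0) (at s)" for s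
    using smooth_line[OF smooth_directional[OF assms(1), of u], where y=x and u=u and s=s] assms(3) by simp
  then have "frechet_derivative f (at (x + s *\<^sub>R u)) u = c" for s
    using DERIV_isconst_all[of "\<lambda>s. frechet_derivative f (at (x + s *\<^sub>R u)) u" s 0] by (simp add: c_def)
  then have d: "((\<lambda>s. f (x + s *\<^sub>R u)) has_real_derivative c) (at s)" for s
    using smooth_line[OF assms(1)] by metis
  have "((\<lambda>s. f (x + s *\<^sub>R u) - c * s) has_real_derivative 0) (at s)" for s
    using DERIV_diff[OF d DERIV_cmult_Id[of c]] by simp
  then have "f (x + s *\<^sub>R u) - c * s = f x" for s
    using DERIV_isconst_all[of "\<lambda>s. f (x + s *\<^sub>R u) - c * s" s 0] by simp
  then have bd: "\<bar>c * s\<bar> \<le> 2 * C" for s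
    using assms(2)[of x] assms(2)[of "x + s *\<^sub>R u"] by (smt (verit))
  have "c = 0"
  proof (rule ccontr)
    assume "c \<noteq> 0"
    \<comment> \<open>At this s the product c s equals 2C + 1, beyond the bound 2C.\<close>
    then show False using bd[of "(2 * C + 1) / c"] by simp
  qed
  then show ?thesis by (simp add: c_def)
qed

section \<open>The part of the operator along the plane\<close>

lemma symbol_operator_smooth:
  "smooth_form \<omega> \<Longrightarrow> smooth_form (\<lambda>x. symbol v (form_deriv v' \<omega> x))"
  by (rule smooth_form_pointwise[OF pointwise_operator_symbol smooth_form_deriv alternating_symbol])

lemma form_deriv_symbol:
  "smooth_form \<omega> \<Longrightarrow> form_deriv v (\<lambda>x. symbol u (form_deriv w \<omega> x)) = (\<lambda>x. symbol u (form_deriv w (form_deriv v \<omega>) x))"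
  by (simp add: form_deriv_pointwise[OF pointwise_operator_symbol smooth_form_deriv] form_deriv_commute)

definition plane_part :: "real^'n::{finite,linorder} \<Rightarrow> real^'n::_ \<Rightarrow> 'n form \<Rightarrow> 'n form" where
  "plane_part u w \<omega> = (\<lambda>x vs. symbol u (form_deriv u \<omega> x) vs + symbol w (form_deriv w \<omega> x) vs)"

lemma smooth_form_plane_part: "smooth_form \<omega> \<Longrightarrow> smooth_form (plane_part u w \<omega>)"
  unfolding plane_part_def by (intro smooth_form_add symbol_operator_smooth)

lemma form_deriv_plane_part:
  "smooth_form \<omega> \<Longrightarrow> form_deriv v (plane_part u w \<omega>) = plane_part u w (form_deriv v \<omega>)"
  by (simp add: plane_part_def form_deriv_add symbol_operator_smooth form_deriv_symbol)

text \<open>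
  The equation says that \<theta> satisfies the Cauchy-Riemann equations along the plane spanned by u
  and w, the symbols of u and w playing the role of a complex structure.
\<close>

lemma plane_part_zero_imp_constant:
  fixes \<theta> :: "'n::{finite,linorder} form"
  assumes n: "CARD('n) mod 4 = 3" and uw: "norm u = 1" "norm w = 1" "u \<bullet> w = 0"
    and \<theta>: "smooth_form \<theta>" "even_form \<theta>" "bounded_form \<theta>" "plane_part u w \<theta> = (\<lambda>x vs. 0)"
  shows "form_deriv u \<theta> = (\<lambda>x vs. 0)" "form_deriv w \<theta> = (\<lambda>x vs. 0)"
proof -
  let ?k = "star_norm TYPE('n)"
  \<comment> \<open>The conjugate function. Applying s(u) to s(u) d/du \<theta> = - s(w) d/dw
    \<theta>, and using that the symbols of u and w anticommute and square to -k, makes k \<theta>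
    and \<psi> satisfy the Cauchy-Riemann equations.\<close>
  define \<psi> where "\<psi> = (\<lambda>x. symbol u (symbol w (\<theta> x)))"
  have op: "pointwise_operator (\<lambda>\<alpha>. symbol u (symbol w \<alpha>))"
    by (rule pointwise_operator_compose[OF pointwise_operator_symbol pointwise_operator_symbol])
  have op1: "pointwise_operator (symbol v)" for v :: "real^'n::_" by (rule pointwise_operator_symbol)
  have d\<psi>: "form_deriv v \<psi> x vs = symbol u (symbol w (form_deriv v \<theta> x)) vs" for v x vs
    unfolding \<psi>_def by (simp add: form_deriv_pointwise[OF op \<theta>(1)])
  have \<psi>: "smooth_form \<psi>"
    unfolding \<psi>_def by (rule smooth_form_pointwise[OF op \<theta>(1)]) (intro alternating_symbol)
  have k: "?k > 0" by (rule star_norm_pos)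
  have ea: "even_alternating (form_deriv v \<theta> x)" for v x
    by (intro even_alternating_form smooth_form_deriv even_form_deriv \<theta>)
  have eq: "symbol w (form_deriv w \<theta> x) = (\<lambda>vs. (-1) * symbol u (form_deriv u \<theta> x) vs)"
    "symbol u (form_deriv u \<theta> x) = (\<lambda>vs. (-1) * symbol w (form_deriv w \<theta> x) vs)" for x
    using \<theta>(4) by (auto simp: plane_part_def fun_eq_iff eq_neg_iff_add_eq_0 add.commute)
  have sq: "symbol v (symbol v (form_deriv v' \<theta> x)) vs = - ?k * form_deriv v' \<theta> x vs"
    if "norm v = 1" for v v' x vs
    using symbol_anticommute[OF n ea, of v v v' x vs] that by (simp add: dot_square_norm)
  have cr1: "form_deriv w \<psi> x vs = ?k * form_deriv u \<theta> x vs" for x vs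
    unfolding d\<psi> eq(1) pointwise_operator_scale[OF op1] sq[OF uw(1)] by simp
  have cr2: "form_deriv u \<psi> x vs = - (?k * form_deriv w \<theta> x vs)" for x vs
  proof -
    have "form_deriv u \<psi> x vs = - symbol w (symbol u (form_deriv u \<theta> x)) vs"
      using symbol_anticommute[OF n ea, of u w u x vs] uw(3) by (simp add: d\<psi>)
    then show ?thesis
      unfolding eq(2) pointwise_operator_scale[OF op1] sq[OF uw(2)] by simp
  qed
  have zero: "form_deriv u \<theta> x vs = 0 \<and> form_deriv w \<theta> x vs = 0" for x vs
  proof -
    let ?f = "\<lambda>x. ?k * \<theta> x vs" and ?g = "\<lambda>x. \<psi> x vs"
    have sf: "smooth ?f" and sg: "smooth ?g"
      using smooth_formD(2)[OF smooth_form_scale[OF \<theta>(1)]] smooth_formD(2)[OF \<psi>] by simp_all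
    have df: "frechet_derivative ?f (at y) v = ?k * form_deriv v \<theta> y vs" for v y
      using form_deriv_scale[OF \<theta>(1), of v ?k] by (simp add: form_deriv_def fun_eq_iff)
    have dg: "frechet_derivative ?g (at y) v = form_deriv v \<psi> y vs" for v y
      by (simp add: form_deriv_def)
    obtain C where C: "\<And>x. \<bar>\<theta> x vs\<bar> \<le> C" using \<theta>(3) by (auto simp: bounded_form_def)
    obtain D where D: "\<And>x. \<bar>\<psi> x vs\<bar> \<le> D"
      using coeff_functional_bounded[OF _ \<theta>(3), of "\<lambda>\<alpha>. symbol u (symbol w \<alpha>) vs"] op
      by (auto simp: pointwise_operator_def \<psi>_def)
    have "\<bar>?f x\<bar> \<le> ?k * C" for x using C[of x] k by (simp add: abs_mult)
    then have "frechet_derivative ?f (at x) u = 0" "frechet_derivative ?f (at x) w = 0"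
      using bounded_cauchy_riemann[OF sf sg _ _ _ D, of u w "?k * C" x] unfolding df dg cr1 cr2 by simp_all
    then show ?thesis using k by (simp add: df)
  qed
  then show "form_deriv u \<theta> = (\<lambda>x vs. 0)" "form_deriv w \<theta> = (\<lambda>x vs. 0)" by auto
qed

text \<open>The plane part commutes with derivatives, so it kills the derivatives of \<omega> along
  u and w, which are therefore constant along the plane. Thus \<omega> is affine on lines in these
  directions, and being bounded it is constant on them.\<close>

lemma plane_part_constant_imp_constant:
  fixes \<omega> :: "'n::{finite,linorder} form"
  assumes n: "CARD('n) mod 4 = 3" and uw: "norm u = 1" "norm w = 1" "u \<bullet> w = 0"
    and \<omega>: "smooth_form \<omega>" "even_form \<omega>" "bounded_form \<omega>"
    and bd: "bounded_form (form_deriv u \<omega>)" "bounded_form (form_deriv w \<omega>)"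
    and const: "form_deriv u (plane_part u w \<omega>) = (\<lambda>x vs. 0)" "form_deriv w (plane_part u w \<omega>) = (\<lambda>x vs. 0)"
  shows "form_deriv u \<omega> = (\<lambda>x vs. 0)" "form_deriv w \<omega> = (\<lambda>x vs. 0)"
proof -
  have z: "form_deriv v \<omega> = (\<lambda>x vs. 0)" if "form_deriv v (form_deriv v \<omega>) = (\<lambda>x vs. 0)" for v
  proof (intro ext)
    fix x vs
    obtain C where "\<And>x. \<bar>\<omega> x vs\<bar> \<le> C" using \<omega>(3) by (auto simp: bounded_form_def)
    then show "form_deriv v \<omega> x vs = 0"
      using bounded_affine_on_lines[OF smooth_formD(2)[OF \<omega>(1)], of vs C v x] that
      by (simp add: form_deriv_def fun_eq_iff)
  qed
  show "form_deriv u \<omega> = (\<lambda>x vs. 0)"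
    by (rule z, rule plane_part_zero_imp_constant(1)[OF n uw])
       (simp_all add: smooth_form_deriv even_form_deriv \<omega> bd const flip: form_deriv_plane_part[OF \<omega>(1)])
  show "form_deriv w \<omega> = (\<lambda>x vs. 0)"
    by (rule z, rule plane_part_zero_imp_constant(2)[OF n uw])
       (simp_all add: smooth_form_deriv even_form_deriv \<omega> bd const flip: form_deriv_plane_part[OF \<omega>(1)])
qed

section \<open>Pointwise rotations of forms\<close>

text \<open>The trace of a bilinear form is the same in every orthonormal basis; this makes B
  independent of the basis used to write it.\<close>

lemma sum_bilinear_orthogonal:
  fixes f :: "real^'n::finite \<Rightarrow> real^'n \<Rightarrow> real"
  assumes "orthogonal_matrix A" "\<And>v. linear (\<lambda>u. f u v)" "\<And>u. linear (f u)"
  shows "(\<Sum>j\<in>UNIV. f (A *v unit_vec j) (A *v unit_vec j)) = (\<Sum>j\<in>UNIV. f (unit_vec j) (unit_vec j))"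
proof -
  have col: "(A *v unit_vec j) $ k = A $ k $ j" for j k
    by (simp add: matrix_vector_mult_basis column_def)
  have "f (A *v unit_vec j) (A *v unit_vec j)
      = (\<Sum>k\<in>UNIV. \<Sum>l\<in>UNIV. A $ k $ j * A $ l $ j * f (unit_vec k) (unit_vec l))" for j
  proof -
    have a: "f (A *v unit_vec j) v = (\<Sum>k\<in>UNIV. A $ k $ j * f (unit_vec k) v)" for v
      using sum_basis_expansion[OF assms(2), of "A *v unit_vec j" v] by (simp add: col)
    have b: "f v (A *v unit_vec j) = (\<Sum>l\<in>UNIV. A $ l $ j * f v (unit_vec l))" for v
      using sum_basis_expansion[OF assms(3), of "A *v unit_vec j" v] by (simp add: col)
    show ?thesis by (subst a) (simp add: b sum_distrib_left mult.assoc)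
  qed
  then have "(\<Sum>j\<in>UNIV. f (A *v unit_vec j) (A *v unit_vec j))
      = (\<Sum>j\<in>UNIV. \<Sum>k\<in>UNIV. \<Sum>l\<in>UNIV. A $ k $ j * A $ l $ j * f (unit_vec k) (unit_vec l))"
    by simp
  also have "\<dots> = (\<Sum>k\<in>UNIV. \<Sum>l\<in>UNIV. (\<Sum>j\<in>UNIV. A $ k $ j * A $ l $ j) * f (unit_vec k) (unit_vec l))"
    by (subst sum.swap, rule sum.cong[OF refl], subst sum.swap) (simp add: sum_distrib_right)
  also have "\<dots> = (\<Sum>k\<in>UNIV. \<Sum>l\<in>UNIV. (if k = l then 1 else 0) * f (unit_vec k) (unit_vec l))"
  proof -
    have "(A ** transpose A) $ k $ l = (mat 1 :: real^'n^'n) $ k $ l" for k l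
      using assms(1) by (simp add: orthogonal_matrix_def)
    then have "(\<Sum>j\<in>UNIV. A $ k $ j * A $ l $ j) = (if k = l then 1 else 0)" for k l
      by (simp add: matrix_matrix_mult_def transpose_def mat_def)
    then show ?thesis by simp
  qed
  also have "\<dots> = (\<Sum>j\<in>UNIV. f (unit_vec j) (unit_vec j))"
    by (simp add: if_distrib[of "\<lambda>x. x * _"] cong: if_cong)
  finally show ?thesis .
qed

lemma symbol_form_deriv_linear:
  assumes "smooth_form \<omega>"
  shows "linear (\<lambda>v. symbol u (form_deriv v \<omega> x) vs)"
proof (rule linearI)
  have "form_deriv (a + b) \<omega> x = (\<lambda>vs. form_deriv a \<omega> x vs + form_deriv b \<omega> x vs)"
    "form_deriv (c *\<^sub>R a) \<omega> x = (\<lambda>vs. c * form_deriv a \<omega> x vs)" for a b c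
    using linear_add[OF form_deriv_linear[OF assms]] linear_scale[OF form_deriv_linear[OF assms]] by auto
  then show "symbol u (form_deriv (a + b) \<omega> x) vs = symbol u (form_deriv a \<omega> x) vs + symbol u (form_deriv b \<omega> x) vs"
    "symbol u (form_deriv (c *\<^sub>R a) \<omega> x) vs = c *\<^sub>R symbol u (form_deriv a \<omega> x) vs" for a b c
    by (simp_all add: pointwise_operator_add[OF pointwise_operator_symbol] pointwise_operator_scale[OF pointwise_operator_symbol])
qed

lemma smooth_form_signature_operator:
  assumes "smooth_form \<omega>" "even_form \<omega>"
  shows "smooth_form (signature_operator \<omega>)"
  unfolding signature_operator_eq[OF assms]
  by (intro smooth_form_sum symbol_operator_smooth assms)

lemma even_form_signature_operator:
  fixes \<omega> :: "'n::{finite,linorder} form"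
  assumes "odd CARD('n)" "smooth_form \<omega>" "even_form \<omega>"
  shows "even_form (signature_operator \<omega>)"
proof -
  have "even_alternating (symbol u (form_deriv v \<omega> x))" for u v x
    by (intro even_alternating_symbol assms(1) even_alternating_form smooth_form_deriv even_form_deriv assms)
  then show ?thesis
    by (simp add: even_form_def signature_operator_eq[OF assms(2,3)] even_alternating_def)
qed

lemma even_form_add: "even_form \<omega> \<Longrightarrow> even_form \<eta> \<Longrightarrow> even_form (\<lambda>x vs. \<omega> x vs + \<eta> x vs)"
  by (simp add: even_form_def)

lemma even_form_scale: "even_form \<omega> \<Longrightarrow> even_form (\<lambda>x vs. c * \<omega> x vs)"
  by (simp add: even_form_def)

lemma signature_operator_linear_combination:
  assumes "smooth_form \<omega>" "even_form \<omega>" "smooth_form \<eta>" "even_form \<eta>"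
  shows "signature_operator (\<lambda>x vs. a * \<omega> x vs + b * \<eta> x vs)
      = (\<lambda>x vs. a * signature_operator \<omega> x vs + b * signature_operator \<eta> x vs)"
proof -
  have s: "smooth_form (\<lambda>x vs. a * \<omega> x vs + b * \<eta> x vs)" "even_form (\<lambda>x vs. a * \<omega> x vs + b * \<eta> x vs)"
    by (intro smooth_form_add smooth_form_scale even_form_add even_form_scale assms)+
  have "form_deriv v (\<lambda>x vs. a * \<omega> x vs + b * \<eta> x vs)
      = (\<lambda>x vs. a * form_deriv v \<omega> x vs + b * form_deriv v \<eta> x vs)" for v
    by (simp add: form_deriv_add smooth_form_scale form_deriv_scale assms)
  then show ?thesis
    by (simp add: signature_operator_eq[OF s] signature_operator_eq[OF assms(1,2)]
        signature_operator_eq[OF assms(3,4)] pointwise_operator_linear_combination[OF pointwise_operator_symbol]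
        sum.distrib sum_distrib_left)
qed

text \<open>Since derivatives commute, the double sum can be symmetrised; what remains are
  anticommutators of symbols, which vanish off the diagonal.\<close>

lemma signature_operator_squared:
  fixes \<omega> :: "'n::{finite,linorder} form"
  assumes n: "CARD('n) mod 4 = 3" and \<omega>: "smooth_form \<omega>" "even_form \<omega>"
  shows "signature_operator (signature_operator \<omega>) x vs
    = - star_norm TYPE('n) * (\<Sum>j\<in>UNIV. form_deriv (unit_vec j) (form_deriv (unit_vec j) \<omega>) x vs)"
proof -
  let ?e = "unit_vec :: 'n \<Rightarrow> _" and ?k = "star_norm TYPE('n)"
  have odd: "odd CARD('n)" using n by presburger
  let ?D = "\<lambda>k j. form_deriv (?e k) (form_deriv (?e j) \<omega>) x"
  let ?S = "\<lambda>k j. symbol (?e k) (symbol (?e j) (?D k j)) vs"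
  have d: "form_deriv (?e k) (signature_operator \<omega>) x = (\<lambda>vs. \<Sum>j\<in>UNIV. symbol (?e j) (?D k j) vs)" for k
    unfolding signature_operator_eq[OF \<omega>]
    by (simp add: form_deriv_sum symbol_operator_smooth \<omega> form_deriv_symbol form_deriv_commute)
  have "signature_operator (signature_operator \<omega>) x vs = (\<Sum>k\<in>UNIV. \<Sum>j\<in>UNIV. ?S k j)"
    by (simp add: signature_operator_eq[OF smooth_form_signature_operator even_form_signature_operator] odd \<omega>
        d pointwise_operator_sum[OF pointwise_operator_symbol])
  moreover have "(\<Sum>k\<in>UNIV. \<Sum>j\<in>UNIV. ?S k j) = (\<Sum>k\<in>UNIV. \<Sum>j\<in>UNIV. ?S j k)"
    by (rule sum.swap)
  ultimately have "2 * signature_operator (signature_operator \<omega>) x vs = (\<Sum>k\<in>UNIV. \<Sum>j\<in>UNIV. ?S k j + ?S j k)"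
    by (simp add: sum.distrib)
  also have "\<dots> = (\<Sum>k\<in>UNIV. \<Sum>j\<in>UNIV. if k = j then - 2 * ?k * ?D k k vs else 0)"
  proof (intro sum.cong refl)
    fix k j
    have "even_alternating (?D k j)"
      by (intro even_alternating_form smooth_form_deriv even_form_deriv \<omega>)
    then have "?S k j + symbol (?e j) (symbol (?e k) (?D k j)) vs = - 2 * ?k * (?e k \<bullet> ?e j) * ?D k j vs"
      by (rule symbol_anticommute[OF n])
    then show "?S k j + ?S j k = (if k = j then - 2 * ?k * ?D k k vs else 0)"
      by (simp add: form_deriv_commute[OF \<omega>(1), of "?e j" "?e k"] inner_axis_axis)
  qed
  also have "\<dots> = 2 * (- ?k * (\<Sum>j\<in>UNIV. ?D j j vs))"
    by (simp add: sum_distrib_left sum_negf mult.assoc)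
  finally show ?thesis by simp
qed

definition rotate_fibre :: "real^'n^'n \<Rightarrow> 'n::finite form \<Rightarrow> 'n form" where
  "rotate_fibre A \<omega> = (\<lambda>x. pointwise_pullback A (\<omega> x))"

lemma smooth_form_rotate_fibre: "smooth_form \<omega> \<Longrightarrow> smooth_form (rotate_fibre A \<omega>)"
  unfolding rotate_fibre_def
  by (rule smooth_form_pointwise[OF pointwise_operator_pullback]) (auto intro: alternating_pointwise_pullback)

lemma even_form_rotate_fibre: "even_form \<omega> \<Longrightarrow> even_form (rotate_fibre A \<omega>)"
  by (simp add: even_form_def rotate_fibre_def pointwise_pullback_def)

lemma form_deriv_rotate_fibre:
  "smooth_form \<omega> \<Longrightarrow> form_deriv v (rotate_fibre A \<omega>) = rotate_fibre A (form_deriv v \<omega>)"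
  unfolding rotate_fibre_def by (rule form_deriv_pointwise[OF pointwise_operator_pullback])

text \<open>Since the points stay fixed, A moves the direction of each symbol but not that of the
  derivative next to it. This mismatch is the source of the commutator.\<close>

lemma signature_operator_rotate_fibre:
  assumes "smooth_form \<omega>" "even_form \<omega>" "orthogonal_matrix A"
  shows "signature_operator (rotate_fibre A \<omega>) x vs
    = det A * (\<Sum>j\<in>UNIV. symbol (A *v unit_vec j) (form_deriv (unit_vec j) \<omega> x) (map ((*v) A) vs))"
proof -
  have "symbol (unit_vec j) (form_deriv (unit_vec j) (rotate_fibre A \<omega>) x) vs
      = det A * symbol (A *v unit_vec j) (form_deriv (unit_vec j) \<omega> x) (map ((*v) A) vs)" for j
  proof -
    have "form_deriv (unit_vec j) (rotate_fibre A \<omega>) x = pointwise_pullback A (form_deriv (unit_vec j) \<omega> x)"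
      by (simp add: form_deriv_rotate_fibre assms(1)) (simp add: rotate_fibre_def)
    then show ?thesis
      using symbol_pullback[OF smooth_formD(1)[OF smooth_form_deriv[OF assms(1)]] assms(3),
          of "unit_vec j" "unit_vec j" x vs]
      by (simp add: pointwise_pullback_def[of A "symbol _ _"])
  qed
  then show ?thesis
    by (simp add: signature_operator_eq smooth_form_rotate_fibre even_form_rotate_fibre assms sum_distrib_left)
qed

lemma signature_operator_squared_rotate_fibre:
  fixes \<omega> :: "'n::{finite,linorder} form"
  assumes "CARD('n) mod 4 = 3" "smooth_form \<omega>" "even_form \<omega>"
  shows "signature_operator (signature_operator (rotate_fibre A \<omega>))
    = rotate_fibre A (signature_operator (signature_operator \<omega>))"
  by (intro ext) (simp add: signature_operator_squared smooth_form_rotate_fibre even_form_rotate_fibre assms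
      form_deriv_rotate_fibre smooth_form_deriv rotate_fibre_def[of A "signature_operator _"]
      pointwise_pullback_def, simp add: rotate_fibre_def pointwise_pullback_def)

lemma sum_symbol_direction:
  assumes "smooth_form \<omega>"
  shows "(\<Sum>j\<in>UNIV. u $ j * symbol v (form_deriv (unit_vec j) \<omega> x) vs) = symbol v (form_deriv u \<omega> x) vs"
  using sum_basis_expansion[OF symbol_form_deriv_linear[OF assms], of u v x vs] by simp

section \<open>Reflections and their determinant\<close>

definition reflection :: "real^'n \<Rightarrow> real^'n^'n::finite" where
  "reflection u = matrix (\<lambda>v. v - (2 * (u \<bullet> v)) *\<^sub>R u)"

lemma reflection_apply: "reflection u *v v = v - (2 * (u \<bullet> v)) *\<^sub>R u"
proof -
  have "linear (\<lambda>v. v - (2 * (u \<bullet> v)) *\<^sub>R u)"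
    by (rule linearI) (simp_all add: algebra_simps inner_add_right)
  then show ?thesis by (simp add: reflection_def matrix_works)
qed

lemma reflection_involution:
  assumes "norm u = 1"
  shows "reflection u *v (reflection u *v v) = v"
proof -
  have "u \<bullet> (reflection u *v v) = - (u \<bullet> v)"
    using assms by (simp add: reflection_apply inner_diff_right dot_square_norm)
  then show ?thesis
    by (simp add: reflection_apply[of u "reflection u *v v"]) (simp add: reflection_apply)
qed

lemma orthogonal_reflection:
  assumes "norm u = 1"
  shows "orthogonal_matrix (reflection u)"
proof -
  have "(reflection u *v v) \<bullet> (reflection u *v w) = v \<bullet> w" for v w
    using assms by (simp add: reflection_apply inner_diff_left inner_diff_right dot_square_norm inner_commute algebra_simps)
  then have "orthogonal_transformation ((*v) (reflection u))"
    by (simp add: orthogonal_transformation_def)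
  then show ?thesis
    by (simp add: orthogonal_transformation_matrix)
qed

text \<open>An orthogonal matrix carrying some basis vector to u conjugates the reflection to a
  diagonal matrix with a single entry -1.\<close>

lemma det_reflection:
  fixes u :: "real^'n::finite"
  assumes "norm u = 1"
  shows "det (reflection u) = -1"
proof -
  fix k :: 'n
  obtain Q where Q: "orthogonal_matrix Q" "Q *v unit_vec k = u"
    using orthogonal_matrix_exists_basis[OF assms] by metis
  define D :: "real^'n^'n" where "D = (\<chi> i j. if i = j then (if i = k then -1 else 1) else 0)"
  have "reflection u ** Q = Q ** D"
  proof -
    have "reflection u *v (Q *v v) = Q *v (D *v v)" for v
    proof -
      have "u \<bullet> (Q *v v) = v $ k"
      proof -
        have "u \<bullet> (Q *v v) = (transpose Q *v (Q *v unit_vec k)) \<bullet> v"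
          by (metis Q(2) dot_lmul_matrix transpose_matrix_vector)
        then show ?thesis
          using Q(1) by (simp add: matrix_vector_mul_assoc orthogonal_matrix_def inner_axis' del: transpose_matrix_vector)
      qed
      moreover have "D *v v = v - (2 * v $ k) *\<^sub>R unit_vec k"
        by (simp add: vec_eq_iff D_def matrix_vector_mult_def axis_def if_distrib[of "\<lambda>x. x * _"] cong: if_cong)
      ultimately show ?thesis
        by (simp add: reflection_apply matrix_vector_mult_diff_distrib matrix_vector_mult_scaleR Q(2))
    qed
    then show ?thesis
      by (simp add: matrix_eq flip: matrix_vector_mul_assoc)
  qed
  then have "det (reflection u) * det Q = det Q * det D"
    by (metis det_mul)
  moreover have "det D = -1"
  proof -
    have "det D = (\<Prod>i\<in>UNIV. if i = k then -1 else 1)"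
      by (subst det_diagonal) (simp_all add: D_def)
    then show ?thesis by simp
  qed
  moreover have "det Q \<noteq> 0"
    using det_orthogonal_matrix[OF Q(1)] by auto
  ultimately have "(det (reflection u) + 1) * det Q = 0"
    by (simp add: algebra_simps)
  then show ?thesis using \<open>det Q \<noteq> 0\<close> by simp
qed

section \<open>Spectral symmetry\<close>

context vector_space
begin

text \<open>Use J on the kernel of T and T on a complement of that kernel in V. If J k + T c = 0,
  then \<open>disjoint\<close> gives T c = 0, so c lies in the kernel and in the complement and is
  0; then k = 0 by injectivity of J. T is assumed linear on V alone, as derivatives are linear on
  smooth forms; the glued map is built from a basis to be linear everywhere.\<close>

lemma embedding_from_two_maps:
  assumes V: "subspace V" and W: "subspace W"
    and T_add: "\<And>x y. x \<in> V \<Longrightarrow> y \<in> V \<Longrightarrow> T (x + y) = T x + T y"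
    and T_scale: "\<And>c x. x \<in> V \<Longrightarrow> T (scale c x) = scale c (T x)"
    and T: "\<And>x. x \<in> V \<Longrightarrow> T x \<in> W"
    and J_add: "\<And>x y. J (x + y) = J x + J y"
    and J_scale: "\<And>c x. J (scale c x) = scale c (J x)"
    and J: "\<And>x. x \<in> V \<Longrightarrow> T x = 0 \<Longrightarrow> J x \<in> W"
    and J_inj: "\<And>x. J x = 0 \<Longrightarrow> x = 0"
    and disjoint: "\<And>x y. x \<in> V \<Longrightarrow> y \<in> V \<Longrightarrow> T y = 0 \<Longrightarrow> T x = J y \<Longrightarrow> T x = 0"
  shows "\<exists>\<Phi>. Vector_Spaces.linear scale scale \<Phi> \<and> \<Phi> ` V \<subseteq> W \<and> inj_on \<Phi> V"
proof -
  interpret vp: vector_space_pair scale scale ..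
  define K where "K = {x \<in> V. T x = 0}"
  have J0: "J 0 = 0" using J_scale[of 0 0] by simp
  have T0: "T 0 = 0" using T_scale[of 0 0] subspace_0[OF V] by simp
  have K: "subspace K"
    using V T0 by (auto simp: subspace_def K_def T_add T_scale)
  obtain B0 where B0: "B0 \<subseteq> K" "independent B0" "K \<subseteq> span B0"
    using maximal_independent_subset by blast
  have "B0 \<subseteq> V" using B0(1) by (auto simp: K_def)
  then obtain B where B: "B0 \<subseteq> B" "B \<subseteq> V" "independent B" "V \<subseteq> span B"
    using maximal_independent_subset_extend B0(2) by metis
  define \<Phi> where "\<Phi> = vp.construct B (\<lambda>b. if b \<in> B0 then J b else T b)"
  \<comment> \<open>The projection onto the kernel along the complement; it shows below that the two
    spans meet only in 0.\<close>
  define \<pi> where "\<pi> = vp.construct B (\<lambda>b. if b \<in> B0 then b else 0)"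
  have lin: "Vector_Spaces.linear scale scale \<Phi>" "Vector_Spaces.linear scale scale \<pi>"
    unfolding \<Phi>_def \<pi>_def by (rule vp.linear_construct[OF B(3)])+
  have \<Phi>b: "\<Phi> b = (if b \<in> B0 then J b else T b)" and \<pi>b: "\<pi> b = (if b \<in> B0 then b else 0)" if "b \<in> B" for b
    unfolding \<Phi>_def \<pi>_def using that by (simp_all add: vp.construct_basis[OF B(3)])
  have on0: "k \<in> K \<and> \<Phi> k = J k \<and> \<pi> k = k" if "k \<in> span B0" for k
    using that
  proof (induction k rule: span_induct)
    case base
    show ?case
      using K by (auto simp: subspace_def J0 J_add J_scale vp.linear_0[OF lin(1)] vp.linear_0[OF lin(2)]
          vp.linear_add[OF lin(1)] vp.linear_add[OF lin(2)] vp.linear_scale[OF lin(1)] vp.linear_scale[OF lin(2)])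
  next
    case (step k)
    then show ?case using B(1) B0(1) \<Phi>b \<pi>b by auto
  qed
  have on1: "c \<in> V \<and> \<Phi> c = T c \<and> \<pi> c = 0" if "c \<in> span (B - B0)" for c
    using that
  proof (induction c rule: span_induct)
    case base
    show ?case
      using V by (auto simp: subspace_def T0 T_add T_scale vp.linear_0[OF lin(1)] vp.linear_0[OF lin(2)]
          vp.linear_add[OF lin(1)] vp.linear_add[OF lin(2)] vp.linear_scale[OF lin(1)] vp.linear_scale[OF lin(2)])
  next
    case (step c)
    then show ?case using B(2) \<Phi>b \<pi>b by auto
  qed
  have decomp: "\<exists>k c. k \<in> span B0 \<and> c \<in> span (B - B0) \<and> v = k + c" if "v \<in> V" for v
  proof -
    have "B = B0 \<union> (B - B0)" using B(1) by auto
    then have "v \<in> span (B0 \<union> (B - B0))" using that B(4) by auto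
    then show ?thesis unfolding span_Un by blast
  qed
  have "\<Phi> v \<in> W" if v: "v \<in> V" for v
  proof -
    obtain k c where kc: "k \<in> span B0" "c \<in> span (B - B0)" "v = k + c" using decomp[OF v] by blast
    then have "\<Phi> v = J k + T c"
      by (simp add: vp.linear_add[OF lin(1)] on0 on1)
    moreover have "J k \<in> W" "T c \<in> W"
      using on0[OF kc(1)] on1[OF kc(2)] J T by (auto simp: K_def)
    ultimately show ?thesis using subspace_add[OF W] by simp
  qed
  moreover have "v = 0" if v: "v \<in> V" "\<Phi> v = 0" for v
  proof -
    obtain k c where kc: "k \<in> span B0" "c \<in> span (B - B0)" "v = k + c" using decomp[OF v(1)] by blast
    then have sum: "J k + T c = 0"
      using v(2) by (simp add: vp.linear_add[OF lin(1)] on0 on1)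
    have k: "k \<in> K" and c: "c \<in> V" using on0[OF kc(1)] on1[OF kc(2)] by auto
    have "T c = - J k"
      using sum by (simp add: eq_neg_iff_add_eq_0 add.commute)
    then have "T c = J (scale (-1) k)" unfolding J_scale by simp
    moreover have "scale (-1) k \<in> K" using subspace_scale[OF K k] .
    ultimately have Tc: "T c = 0"
      using disjoint[OF c, of "scale (-1) k"] by (auto simp: K_def)
    then have "c \<in> span B0" using B0(3) c by (auto simp: K_def)
    then have "c = 0" using on0[of c] on1[OF kc(2)] by simp
    moreover have "k = 0" using sum Tc J_inj by simp
    ultimately show ?thesis using kc(3) by simp
  qed
  then have "inj_on \<Phi> V"
    using vp.linear_diff[OF lin(1)] subspace_diff[OF V]
    by (intro inj_onI) (metis right_minus_eq)
  ultimately show ?thesis using lin(1) by blast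
qed

lemma embedding_imp_dim_le:
  assumes "subspace V" "subspace W"
    and \<Phi>: "Vector_Spaces.linear scale scale \<Phi>" "\<Phi> ` V \<subseteq> W" "inj_on \<Phi> V"
    and B: "B \<subseteq> V" "independent B" and C: "W \<subseteq> span C" "finite C"
  shows "finite B \<and> card B \<le> card C"
proof -
  interpret vp: vector_space_pair scale scale ..
  have inj: "inj_on \<Phi> (span B)"
    using \<Phi>(3) span_minimal[OF B(1) assms(1)] by (rule inj_on_subset)
  then have "independent (\<Phi> ` B)"
    using vp.linear_independent_injective_image[OF \<Phi>(1) B(2)] by blast
  then have "finite (\<Phi> ` B) \<and> card (\<Phi> ` B) \<le> card C"
    using independent_span_bound[OF C(2)] \<Phi>(2) B(1) C(1) by (metis image_mono subset_trans)
  moreover have "inj_on \<Phi> B"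
    using inj span_superset by (rule inj_on_subset)
  ultimately show ?thesis by (simp add: card_image finite_image_iff)
qed

text \<open>Infinite-dimensional subspaces have dimension 0 here, so no finiteness is required.\<close>

lemma mutual_embeddings_imp_dim_eq:
  assumes "subspace V" "subspace W"
    and "Vector_Spaces.linear scale scale \<Phi>" "\<Phi> ` V \<subseteq> W" "inj_on \<Phi> V"
    and "Vector_Spaces.linear scale scale \<Psi>" "\<Psi> ` W \<subseteq> V" "inj_on \<Psi> W"
  shows "dim V = dim W"
proof -
  obtain B where B: "B \<subseteq> V" "independent B" "V \<subseteq> span B" "card B = dim V" by (rule basis_exists)
  obtain C where C: "C \<subseteq> W" "independent C" "W \<subseteq> span C" "card C = dim W" by (rule basis_exists)
  note VW = embedding_imp_dim_le[OF assms(1,2,3-5) B(1,2) C(3)]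
  note WV = embedding_imp_dim_le[OF assms(2,1,6-8) C(1,2) B(3)]
  show ?thesis
    using VW WV B(4) C(4) by (metis card.infinite le_antisym)
qed

end

text \<open>Reindexing by negation shows that the series equals its own negative at every s, so any
  continuation vanishes on a half-plane and hence at 0. \<open>triv\<close> is separate from
  \<open>dim\<close> because dimension 0 can also stand for infinite dimension.\<close>

lemma eta_invariant_zero:
  assumes dim: "\<And>\<mu>. form_dim (eigenspace \<Gamma> (- \<mu>)) = form_dim (eigenspace \<Gamma> \<mu>)"
    and triv: "\<And>\<mu>. eigenspace \<Gamma> \<mu> = {0} \<Longrightarrow> eigenspace \<Gamma> (- \<mu>) = {0}"
  shows "eta_invariant \<Gamma> = 0"
proof -
  have "eta_series \<Gamma> s = 0" for s
  proof -
    let ?N = "nonzero_eigenvalues \<Gamma>"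
    let ?f = "\<lambda>\<mu>. of_real (sgn \<mu>) * of_nat (form_dim (eigenspace \<Gamma> \<mu>)) * of_real \<bar>\<mu>\<bar> powr (- s) :: complex"
    have N: "- \<mu> \<in> ?N" if "\<mu> \<in> ?N" for \<mu>
      using that triv[of "- \<mu>"] by (auto simp: nonzero_eigenvalues_def)
    have "bij_betw uminus ?N ?N"
      by (rule bij_betwI[where g=uminus]) (auto intro: N)
    then have "infsum ?f ?N = infsum (\<lambda>\<mu>. ?f (- \<mu>)) ?N"
      by (simp only: infsum_reindex_bij_betw[where f="?f"])
    also have "\<dots> = infsum (\<lambda>\<mu>. - ?f \<mu>) ?N"
      by (simp add: dim sgn_minus)
    also have "\<dots> = - infsum ?f ?N" by (rule infsum_uminus)
    finally show ?thesis by (simp add: eta_series_def)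
  qed
  note series = this
  show ?thesis
    unfolding eta_invariant_def series
  proof (rule the_equality)
    show "\<exists>F. F meromorphic_on UNIV \<and> (\<exists>c. \<forall>s. c < Re s \<longrightarrow> F s = 0) \<and> F analytic_on {0} \<and> F 0 = (0::complex)"
      by (rule exI[of _ "\<lambda>_. 0"]) auto
  next
    fix y :: complex
    assume "\<exists>F. F meromorphic_on UNIV \<and> (\<exists>c. \<forall>s. c < Re s \<longrightarrow> F s = 0) \<and> F analytic_on {0} \<and> F 0 = y"
    then obtain F c where F: "F meromorphic_on UNIV" "\<And>s. c < Re s \<Longrightarrow> F s = 0" "F analytic_on {0}" "F 0 = y"
      by blast
    \<comment> \<open>A meromorphic F may take stray values at isolated points. Removing them makes
      the identity theorem applicable from the point c + 1 of the half-plane, and changes nothing at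
      0, where F is analytic.\<close>
    let ?G = "remove_sings F" and ?z = "of_real (c + 1) :: complex"
    have "eventually (\<lambda>s. s \<in> {s. c < Re s}) (nhds ?z)"
      by (intro eventually_nhds_in_open open_halfspace_Re_gt) simp
    then have ev: "eventually (\<lambda>s. c < Re s) (nhds ?z)" by simp
    have "eventually (\<lambda>s. F s = 0) (nhds s)" if "c < Re s" for s
    proof -
      have "eventually (\<lambda>s. s \<in> {s. c < Re s}) (nhds s)"
        using that by (intro eventually_nhds_in_open open_halfspace_Re_gt) simp
      then show ?thesis by eventually_elim (use F(2) in simp)
    qed
    then have "?G s = 0" if "c < Re s" for s
      using that by (intro remove_sings_eqI tendsto_eventually filter_leD[OF at_within_le_nhds]) blast
    then have "eventually (\<lambda>s. ?G s = 0) (at ?z)"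
      using ev by (auto simp: eventually_at_filter elim: eventually_mono)
    then have "frequently (\<lambda>s. ?G s = 0) (at ?z)"
      by (rule eventually_frequently[rotated]) simp
    moreover have "?G nicely_meromorphic_on UNIV"
      using F(1) by (rule remove_sings_nicely_meromorphic)
    ultimately have "?G 0 = 0"
      by (rule frequently_eq_meromorphic_imp_constant) auto
    moreover have "?G 0 = F 0"
      using F(3) by (rule remove_sings_at_analytic)
    ultimately show "y = 0" using F(4) by simp
  qed
qed

text \<open>Induction on the dimension. If some A is neither the identity nor its negative on V, its
  fixed space is nonzero, proper, and preserved by everything commuting with A.\<close>

lemma commuting_involutions_eigenvector:
  fixes V :: "(real^'n::finite) set"
  assumes "subspace V" "V \<noteq> {0}"
    and "\<And>A v. A \<in> F \<Longrightarrow> v \<in> V \<Longrightarrow> A *v v \<in> V"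
    and sq: "\<And>A. A \<in> F \<Longrightarrow> A ** A = mat 1"
    and comm: "\<And>A B. A \<in> F \<Longrightarrow> B \<in> F \<Longrightarrow> A ** B = B ** A"
  shows "\<exists>v\<in>V. v \<noteq> 0 \<and> (\<forall>A\<in>F. A *v v = v \<or> A *v v = - v)"
  using assms(1-3)
proof (induction "dim V" arbitrary: V rule: less_induct)
  case less
  show ?case
  proof (cases "\<forall>A\<in>F. (\<forall>v\<in>V. A *v v = v) \<or> (\<forall>v\<in>V. A *v v = - v)")
    case True
    moreover obtain v where "v \<in> V" "v \<noteq> 0"
      using less.prems(1,2) subspace_0 by blast
    ultimately show ?thesis by blast
  next
    case False
    then obtain A x y where A: "A \<in> F" and x: "x \<in> V" "A *v x \<noteq> x" and y: "y \<in> V" "A *v y \<noteq> - y"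
      by blast
    define U where "U = {v \<in> V. A *v v = v}"
    have U: "subspace U"
      using less.prems(1) by (auto simp: U_def subspace_def matrix_vector_right_distrib matrix_vector_mult_scaleR)
    have AA: "A *v (A *v v) = v" for v
      using sq[OF A] by (simp add: matrix_vector_mul_assoc)
    \<comment> \<open>Averaging y with its image gives a fixed vector, nonzero by the choice of
      y.\<close>
    have "A *v y + y \<in> U"
      using y(1) less.prems(1) less.prems(3)[OF A]
      by (simp add: U_def subspace_add matrix_vector_right_distrib AA add.commute)
    moreover have "A *v y + y \<noteq> 0" using y(2) by (simp add: eq_neg_iff_add_eq_0)
    ultimately have U0: "U \<noteq> {0}" by auto
    have "U \<subset> V" using x by (auto simp: U_def)
    then have "dim U < dim V"
      by (metis U dim_psubset less.prems(1) span_eq_iff)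
    moreover have "B *v v \<in> U" if "B \<in> F" "v \<in> U" for B v
    proof -
      have "A *v (B *v v) = B *v (A *v v)"
        using comm[OF A that(1)] by (simp add: matrix_vector_mul_assoc)
      then show ?thesis using that less.prems(3) by (simp add: U_def)
    qed
    ultimately have "\<exists>v\<in>U. v \<noteq> 0 \<and> (\<forall>A\<in>F. A *v v = v \<or> A *v v = - v)"
      using less.hyps[of U] U U0 by blast
    then show ?thesis by (auto simp: U_def)
  qed
qed

lemma normalized_eigenvector:
  fixes v :: "real^'n::finite"
  assumes "\<And>A. A \<in> F \<Longrightarrow> A *v v = v \<or> A *v v = - v"
  shows "\<And>A. A \<in> F \<Longrightarrow> A *v (v /\<^sub>R norm v) = v /\<^sub>R norm v \<or> A *v (v /\<^sub>R norm v) = - (v /\<^sub>R norm v)"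
proof -
  fix A
  assume "A \<in> F"
  then show "A *v (v /\<^sub>R norm v) = v /\<^sub>R norm v \<or> A *v (v /\<^sub>R norm v) = - (v /\<^sub>R norm v)"
    using assms[of A] by (auto simp: matrix_vector_mult_scaleR)
qed

lemma commuting_involutions_eigenplane:
  fixes F :: "(real^'n^'n::finite) set"
  assumes "2 \<le> CARD('n)" and orth: "\<And>A. A \<in> F \<Longrightarrow> orthogonal_matrix A"
    and sq: "\<And>A. A \<in> F \<Longrightarrow> A ** A = mat 1"
    and comm: "\<And>A B. A \<in> F \<Longrightarrow> B \<in> F \<Longrightarrow> A ** B = B ** A"
  obtains u w where "norm u = 1" "norm w = 1" "u \<bullet> w = 0"
    "\<forall>A\<in>F. A *v u = u \<or> A *v u = - u"
    "\<forall>A\<in>F. A *v w = w \<or> A *v w = - w"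
proof -
  have "\<exists>v\<in>UNIV. v \<noteq> 0 \<and> (\<forall>A\<in>F. A *v v = v \<or> A *v v = - v)"
  proof (rule commuting_involutions_eigenvector[OF _ _ _ sq comm])
    show "UNIV \<noteq> {0 :: real^'n}"
      by (metis UNIV_I axis_eq_0_iff singletonD zero_neq_one)
  qed auto
  then obtain u where u: "u \<noteq> 0" "\<And>A. A \<in> F \<Longrightarrow> A *v u = u \<or> A *v u = - u" by blast
  \<comment> \<open>Orthogonality makes the complement of u invariant, so the eigenvector lemma can
    be applied again there.\<close>
  have inv: "u \<bullet> (A *v v) = 0" if "A \<in> F" "u \<bullet> v = 0" for A v
  proof -
    have "(A *v u) \<bullet> (A *v v) = u \<bullet> v"
      using orth[OF that(1)] orthogonal_transformation_matrix[of "(*v) A"]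
      by (simp add: orthogonal_transformation_def matrix_vector_mul_linear)
    then show ?thesis using u(2)[OF that(1)] that(2) by auto
  qed
  have "\<exists>v\<in>{v. u \<bullet> v = 0}. v \<noteq> 0 \<and> (\<forall>A\<in>F. A *v v = v \<or> A *v v = - v)"
  proof (rule commuting_involutions_eigenvector[OF _ _ _ sq comm])
    show "subspace {v. u \<bullet> v = 0}" by (rule subspace_hyperplane)
    obtain y where "y \<noteq> 0" "orthogonal u y"
      using orthogonal_to_vector_exists[of u] assms(1) by auto
    then show "{v. u \<bullet> v = 0} \<noteq> {0}" by (auto simp: orthogonal_def)
  qed (use inv in auto)
  then obtain w where w: "u \<bullet> w = 0" "w \<noteq> 0" "\<And>A. A \<in> F \<Longrightarrow> A *v w = w \<or> A *v w = - w" by blast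
  show ?thesis
    by (rule that[of "u /\<^sub>R norm u" "w /\<^sub>R norm w"])
       (use u w normalized_eigenvector[of F u] normalized_eigenvector[of F w] in auto)
qed

lemma elementary_two_group_holonomy:
  assumes sub: "subgroup \<Gamma> euclidean_group" and iso: "holonomy_group \<Gamma> \<cong> elementary_two_group k"
    and g: "g \<in> \<Gamma>" and h: "h \<in> \<Gamma>"
  shows "fst g ** fst g = mat 1" "fst g ** fst h = fst h ** fst g"
proof -
  let ?G = "elementary_two_group k"
  \<comment> \<open>The product of the model reduces modulo 2 on arbitrary functions, so this and
    \<open>comm\<close> hold for all x and y, inside the carrier or not.\<close>
  have sq: "x \<otimes>\<^bsub>?G\<^esub> x = \<one>\<^bsub>?G\<^esub>" for x
    by (simp add: elementary_two_group_def flip: mult_2)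
  have comm: "x \<otimes>\<^bsub>?G\<^esub> y = y \<otimes>\<^bsub>?G\<^esub> x" for x y
    by (simp add: elementary_two_group_def add.commute)
  obtain f where f: "f \<in> hom (holonomy_group \<Gamma>) ?G" "bij_betw f (carrier (holonomy_group \<Gamma>)) (carrier ?G)"
    using iso by (auto simp: is_iso_def iso_def)
  have mult: "fst a ** fst b \<in> fst ` \<Gamma>" if "a \<in> \<Gamma>" "b \<in> \<Gamma>" for a b
    using subgroup.m_closed[OF sub that] by (force simp: euclidean_group_def)
  have one: "mat 1 \<in> fst ` \<Gamma>"
    using subgroup.one_closed[OF sub] by (force simp: euclidean_group_def)
  have C: "carrier (holonomy_group \<Gamma>) = fst ` \<Gamma>" by (simp add: holonomy_group_def)
  have fm: "f (a ** b) = f a \<otimes>\<^bsub>?G\<^esub> f b" if "a \<in> fst ` \<Gamma>" "b \<in> fst ` \<Gamma>" for a b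
    using f(1) that by (auto simp: hom_def holonomy_group_def)
  have inj: "inj_on f (fst ` \<Gamma>)" using f(2) by (simp add: bij_betw_def C)
  \<comment> \<open>The image of the identity is its own square, and every square in the model is
    the unit.\<close>
  have f1: "f (mat 1) = \<one>\<^bsub>?G\<^esub>"
    using fm[OF one one] by (simp add: sq)
  show "fst g ** fst g = mat 1"
    by (rule inj_onD[OF inj]) (use g mult one in \<open>auto simp: fm f1 sq\<close>)
  show "fst g ** fst h = fst h ** fst g"
    by (rule inj_onD[OF inj]) (use g h mult in \<open>auto simp: fm intro: comm\<close>)
qed


section \<open>Spectral symmetry from an orthonormal pair preserved up to sign by the
  holonomy\<close>

locale invariant_plane =
  fixes \<Gamma> :: "'n::{finite,linorder} rigid_motion set" and u w :: "real^'n::_"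
  assumes dim_mod_4: "CARD('n) mod 4 = 3"
    and cocompact: "cocompact \<Gamma>"
    and orthogonal: "\<And>g. g \<in> \<Gamma> \<Longrightarrow> orthogonal_matrix (fst g)"
    and orientation: "\<And>g. g \<in> \<Gamma> \<Longrightarrow> det (fst g) = 1"
    and orthonormal: "norm u = 1" "norm w = 1" "u \<bullet> w = 0"
    and u_invariant: "\<And>g. g \<in> \<Gamma> \<Longrightarrow> fst g *v u = u \<or> fst g *v u = - u"
    and w_invariant: "\<And>g. g \<in> \<Gamma> \<Longrightarrow> fst g *v w = w \<or> fst g *v w = - w"
begin

definition half_turn :: "real^'n::_^'n::_" where
  "half_turn = reflection u ** reflection w"

lemma half_turn_apply: "half_turn *v v = v - (2 * (u \<bullet> v)) *\<^sub>R u - (2 * (w \<bullet> v)) *\<^sub>R w"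
  using orthonormal
  by (simp add: half_turn_def reflection_apply inner_diff_right flip: matrix_vector_mul_assoc)

lemma half_turn_involution: "half_turn *v (half_turn *v v) = v"
proof -
  have "reflection w *v (reflection u *v v) = reflection u *v (reflection w *v v)" for v
    using orthonormal by (simp add: reflection_apply inner_diff_right inner_commute[of w u])
  then show ?thesis
    by (simp add: half_turn_def reflection_involution orthonormal flip: matrix_vector_mul_assoc)
qed

lemma orthogonal_half_turn: "orthogonal_matrix half_turn"
  unfolding half_turn_def by (intro orthogonal_matrix_mul orthogonal_reflection orthonormal)

lemma det_half_turn: "det half_turn = 1"
  by (simp add: half_turn_def det_mul det_reflection orthonormal)

text \<open>Vectors v and -v define the same reflection, so an isometry preserving the line of v
  commutes with it. Hence both the half turn and the reflection in u keep forms invariant under the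
  group.\<close>

lemma reflection_commute:
  assumes "orthogonal_matrix A" "A *v v = v \<or> A *v v = - v"
  shows "A *v (reflection v *v x) = reflection v *v (A *v x)"
proof -
  have "(A *v v) \<bullet> (A *v x) = v \<bullet> x"
    using assms(1) orthogonal_transformation_matrix[of "(*v) A"]
    by (simp add: orthogonal_transformation_def matrix_vector_mul_linear)
  note inner = this
  from assms(2) show ?thesis
  proof
    assume "A *v v = - v"
    moreover from this have "v \<bullet> (A *v x) = - (v \<bullet> x)" using inner by simp
    ultimately show ?thesis
      by (simp add: reflection_apply matrix_vector_mult_diff_distrib matrix_vector_mult_scaleR)
  qed (use inner in \<open>simp add: reflection_apply matrix_vector_mult_diff_distrib matrix_vector_mult_scaleR\<close>)
qed

lemma half_turn_commute:
  "g \<in> \<Gamma> \<Longrightarrow> fst g *v (half_turn *v x) = half_turn *v (fst g *v x)"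
  by (simp add: half_turn_def reflection_commute orthogonal u_invariant w_invariant flip: matrix_vector_mul_assoc)

lemma even_formsD:
  assumes "\<omega> \<in> even_forms \<Gamma>"
  shows "smooth_form \<omega>" "even_form \<omega>"
    and "g \<in> \<Gamma> \<Longrightarrow> \<omega> (act g x) (map ((*v) (fst g)) vs) = \<omega> x vs"
  using assms by (auto simp: even_forms_def pullback_def fun_eq_iff)

lemma even_formsI:
  assumes "smooth_form \<omega>" "even_form \<omega>"
    and "\<And>g x vs. g \<in> \<Gamma> \<Longrightarrow> \<omega> (act g x) (map ((*v) (fst g)) vs) = \<omega> x vs"
  shows "\<omega> \<in> even_forms \<Gamma>"
  using assms by (auto simp: even_forms_def pullback_def fun_eq_iff)

lemma even_forms_linear_combination:
  assumes "\<omega> \<in> even_forms \<Gamma>" "\<eta> \<in> even_forms \<Gamma>"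
  shows "(\<lambda>x vs. a * \<omega> x vs + b * \<eta> x vs) \<in> even_forms \<Gamma>"
  by (intro even_formsI smooth_form_add smooth_form_scale even_form_add even_form_scale even_formsD(1,2)[OF assms(1)] even_formsD(1,2)[OF assms(2)])
     (simp add: even_formsD(3)[OF assms(1)] even_formsD(3)[OF assms(2)])

lemma rotate_fibre_even_forms:
  assumes "\<omega> \<in> even_forms \<Gamma>" and comm: "\<And>g x. g \<in> \<Gamma> \<Longrightarrow> fst g *v (A *v x) = A *v (fst g *v x)"
  shows "rotate_fibre A \<omega> \<in> even_forms \<Gamma>"
proof (rule even_formsI)
  fix g x vs
  assume g: "g \<in> \<Gamma>"
  have "map ((*v) A) (map ((*v) (fst g)) vs) = map ((*v) (fst g)) (map ((*v) A) vs)"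
    by (simp add: comm[OF g])
  then show "rotate_fibre A \<omega> (act g x) (map ((*v) (fst g)) vs) = rotate_fibre A \<omega> x vs"
    using even_formsD(3)[OF assms(1) g, of x "map ((*v) A) vs"]
    by (simp add: rotate_fibre_def pointwise_pullback_def del: map_map)
qed (intro smooth_form_rotate_fibre even_form_rotate_fibre even_formsD[OF assms(1)])+

lemma form_deriv_invariant:
  assumes "\<omega> \<in> even_forms \<Gamma>" "g \<in> \<Gamma>"
  shows "form_deriv (fst g *v v) \<omega> (act g x) (map ((*v) (fst g)) vs) = form_deriv v \<omega> x vs"
proof -
  let ?f = "\<lambda>y. \<omega> y (map ((*v) (fst g)) vs)"
  have "((\<lambda>y. ?f (fst g *v y + snd g)) has_derivative
      (\<lambda>v. frechet_derivative ?f (at (fst g *v x + snd g)) (fst g *v v))) (at x)"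
    by (intro frechet_derivative_affine smooth_differentiable smooth_formD even_formsD[OF assms(1)])
  moreover have "(\<lambda>y. ?f (fst g *v y + snd g)) = (\<lambda>y. \<omega> y vs)"
    using even_formsD(3)[OF assms] by (simp add: act_def)
  ultimately have "frechet_derivative (\<lambda>y. \<omega> y vs) (at x)
      = (\<lambda>v. frechet_derivative ?f (at (fst g *v x + snd g)) (fst g *v v))"
    by (metis frechet_derivative_at)
  then show ?thesis by (simp add: form_deriv_def act_def)
qed

text \<open>Pulling back by an element of the group turns the sum over the standard basis into the
  sum over its rotated image, which is the same; the determinant from the star is 1 by
  orientation.\<close>

lemma signature_operator_even_forms:
  assumes "\<omega> \<in> even_forms \<Gamma>"
  shows "signature_operator \<omega> \<in> even_forms \<Gamma>"
proof (rule even_formsI)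
  note \<omega> = even_formsD(1,2)[OF assms]
  have "odd CARD('n)" using dim_mod_4 by presburger
  then show "smooth_form (signature_operator \<omega>)" "even_form (signature_operator \<omega>)"
    by (intro smooth_form_signature_operator even_form_signature_operator \<omega>)+
  fix g x and vs :: "(real^'n::_) list"
  assume g: "g \<in> \<Gamma>"
  let ?A = "fst g" and ?e = "unit_vec :: 'n \<Rightarrow> _"
  let ?f = "\<lambda>v v'. symbol v (form_deriv v' \<omega> (act g x)) (map ((*v) ?A) vs)"
  have "?f (?A *v ?e j) (?A *v ?e j) = symbol (?e j) (form_deriv (?e j) \<omega> x) vs" for j
  proof -
    have "pointwise_pullback ?A (form_deriv (?A *v ?e j) \<omega> (act g x)) = form_deriv (?e j) \<omega> x"
      by (simp add: fun_eq_iff pointwise_pullback_def form_deriv_invariant[OF assms g])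
    then show ?thesis
      using symbol_pullback[OF smooth_formD(1)[OF smooth_form_deriv[OF \<omega>(1)]] orthogonal[OF g],
          of "?e j" "?A *v ?e j" "act g x" vs]
      by (simp add: orientation[OF g] pointwise_pullback_def[of ?A "symbol _ _"])
  qed
  moreover have "(\<Sum>j\<in>UNIV. ?f (?A *v ?e j) (?A *v ?e j)) = (\<Sum>j\<in>UNIV. ?f (?e j) (?e j))"
    by (rule sum_bilinear_orthogonal[OF orthogonal[OF g] symbol_linear_left symbol_form_deriv_linear[OF \<omega>(1)]])
  ultimately show "signature_operator \<omega> (act g x) (map ((*v) ?A) vs) = signature_operator \<omega> x vs"
    by (simp add: signature_operator_eq[OF \<omega>])
qed

text \<open>The half turn reverses the symbols of u and w and fixes those of vectors orthogonal to
  both, so exactly the plane part changes sign.\<close>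

lemma signature_operator_half_turn:
  assumes "smooth_form \<omega>" "even_form \<omega>"
  shows "signature_operator (rotate_fibre half_turn \<omega>) x vs
    = rotate_fibre half_turn (signature_operator \<omega>) x vs - 2 * rotate_fibre half_turn (plane_part u w \<omega>) x vs"
proof -
  let ?D = "\<lambda>j. form_deriv (unit_vec j) \<omega> x" and ?vs = "map ((*v) half_turn) vs"
  have "symbol (half_turn *v unit_vec j) (?D j) ?vs = symbol (unit_vec j) (?D j) ?vs
      - 2 * (u $ j * symbol u (?D j) ?vs) - 2 * (w $ j * symbol w (?D j) ?vs)" for j
    by (simp add: half_turn_apply linear_diff[OF symbol_linear_left] linear_scale[OF symbol_linear_left] inner_axis)
  then show ?thesis
    unfolding signature_operator_rotate_fibre[OF assms orthogonal_half_turn]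
    by (simp add: det_half_turn sum_subtractf
        sum_distrib_left[symmetric] sum_symbol_direction[OF assms(1)]
        rotate_fibre_def pointwise_pullback_def plane_part_def signature_operator_eq[OF assms])
qed

text \<open>The determinant -1 reverses everything; the extra change of the symbol of u is
  multiplied by a derivative that vanishes.\<close>

lemma signature_operator_reflection:
  assumes "smooth_form \<omega>" "even_form \<omega>" "form_deriv u \<omega> = (\<lambda>x vs. 0)"
  shows "signature_operator (rotate_fibre (reflection u) \<omega>) x vs
    = - rotate_fibre (reflection u) (signature_operator \<omega>) x vs"
proof -
  let ?D = "\<lambda>j. form_deriv (unit_vec j) \<omega> x" and ?vs = "map ((*v) (reflection u)) vs"
  have "symbol (reflection u *v unit_vec j) (?D j) ?vs
      = symbol (unit_vec j) (?D j) ?vs - 2 * (u $ j * symbol u (?D j) ?vs)" for j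
    by (simp add: reflection_apply linear_diff[OF symbol_linear_left] linear_scale[OF symbol_linear_left] inner_axis)
  then show ?thesis
    unfolding signature_operator_rotate_fibre[OF assms(1,2) orthogonal_reflection[OF orthonormal(1)]]
    by (simp add: det_reflection orthonormal
        sum_subtractf sum_distrib_left[symmetric] sum_symbol_direction[OF assms(1)] assms(3)
        pointwise_operator_zero[OF pointwise_operator_symbol]
        rotate_fibre_def pointwise_pullback_def signature_operator_eq[OF assms(1,2)])
qed

text \<open>On smooth even forms this is the commutator R B - B R by
  \<open>signature_operator_half_turn\<close>. Written through the plane part it is visibly zero on
  forms constant along the plane.\<close>

definition flip_sign :: "'n form \<Rightarrow> 'n form" where
  "flip_sign \<omega> = (\<lambda>x vs. 2 * rotate_fibre half_turn (plane_part u w \<omega>) x vs)"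

lemma eigenspaceD:
  assumes "\<omega> \<in> eigenspace \<Gamma> \<mu>"
  shows "\<omega> \<in> even_forms \<Gamma>" "signature_operator \<omega> = (\<lambda>x vs. \<mu> * \<omega> x vs)"
  using assms by (simp_all add: eigenspace_def form_scale_def)

text \<open>
  The commutator of the half turn R with the signature operator B anticommutes with B, because
  B squared is a multiple of the Laplacian on coefficients and therefore commutes with R.
\<close>

lemma flip_sign_eigenspace:
  assumes "\<omega> \<in> eigenspace \<Gamma> \<mu>"
  shows "flip_sign \<omega> \<in> eigenspace \<Gamma> (- \<mu>)"
proof -
  let ?R = "rotate_fibre half_turn" and ?B = "signature_operator :: 'n form \<Rightarrow> 'n form"
  note \<omega> = eigenspaceD[OF assms]
  note sm = even_formsD(1,2)
  have R: "?R \<omega> \<in> even_forms \<Gamma>"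
    by (rule rotate_fibre_even_forms[OF \<omega>(1) half_turn_commute])
  have eq: "flip_sign \<omega> = (\<lambda>x vs. \<mu> * ?R \<omega> x vs + (-1) * ?B (?R \<omega>) x vs)"
    by (intro ext) (simp add: flip_sign_def signature_operator_half_turn[OF sm[OF \<omega>(1)]] \<omega>(2),
        simp add: rotate_fibre_def pointwise_pullback_def)
  have BB: "?B (?B (?R \<omega>)) = (\<lambda>x vs. \<mu> * (\<mu> * ?R \<omega> x vs))"
  proof -
    have "?B (?B \<omega>) = (\<lambda>x vs. \<mu> * (\<mu> * \<omega> x vs))"
      using signature_operator_linear_combination[OF sm[OF \<omega>(1)] sm[OF \<omega>(1)], of \<mu> 0] by (simp add: \<omega>(2))
    then show ?thesis
      by (simp add: signature_operator_squared_rotate_fibre[OF dim_mod_4 sm[OF \<omega>(1)]])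
         (simp add: rotate_fibre_def pointwise_pullback_def)
  qed
  note BR = signature_operator_even_forms[OF R]
  \<comment> \<open>Applying B to \<mu> R \<omega> - B R \<omega> gives \<mu> B R \<omega> minus the
    square of \<mu> times R \<omega>, which is -\<mu> times the original.\<close>
  have "?B (flip_sign \<omega>) = (\<lambda>x vs. \<mu> * ?B (?R \<omega>) x vs + (-1) * (\<mu> * (\<mu> * ?R \<omega> x vs)))"
    unfolding eq signature_operator_linear_combination[OF sm[OF R] sm[OF BR]] BB ..
  also have "\<dots> = form_scale (- \<mu>) (flip_sign \<omega>)"
    unfolding eq by (simp add: form_scale_def fun_eq_iff algebra_simps)
  finally show ?thesis
    using even_forms_linear_combination[OF R BR, of \<mu> "-1"] by (simp add: eigenspace_def eq)
qed

lemma even_forms_bounded: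
  assumes "\<omega> \<in> even_forms \<Gamma>"
  shows "bounded_form \<omega>"
  using even_formsD[OF assms] by (intro invariant_form_bounded[OF cocompact orthogonal]) auto

text \<open>The derivative along v is itself invariant only up to sign, because the holonomy may
  reverse v.\<close>

lemma form_deriv_bounded:
  assumes "\<omega> \<in> even_forms \<Gamma>" and v: "\<And>g. g \<in> \<Gamma> \<Longrightarrow> fst g *v v = v \<or> fst g *v v = - v"
  shows "bounded_form (form_deriv v \<omega>)"
proof (rule invariant_form_bounded[OF cocompact orthogonal smooth_form_deriv[OF even_formsD(1)[OF assms(1)]]])
  fix g x vs
  assume g: "g \<in> \<Gamma>"
  show "\<bar>form_deriv v \<omega> (act g x) (map ((*v) (fst g)) vs)\<bar> = \<bar>form_deriv v \<omega> x vs\<bar>"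
    using v[OF g] form_deriv_invariant[OF assms(1) g, of v x vs]
      linear_neg[OF form_deriv_linear[OF even_formsD(1)[OF assms(1)], of "act g x" "map ((*v) (fst g)) vs"], of v]
    by auto
qed

lemma flip_sign_constant_imp_constant:
  assumes "\<omega> \<in> even_forms \<Gamma>"
    and "form_deriv u (flip_sign \<omega>) = (\<lambda>x vs. 0)" "form_deriv w (flip_sign \<omega>) = (\<lambda>x vs. 0)"
  shows "form_deriv u \<omega> = (\<lambda>x vs. 0)" "form_deriv w \<omega> = (\<lambda>x vs. 0)"
proof -
  note \<omega> = even_formsD(1,2)[OF assms(1)]
  note pl = smooth_form_plane_part[OF \<omega>(1), of u w]
  have z: "form_deriv v (plane_part u w \<omega>) = (\<lambda>x vs. 0)" if "form_deriv v (flip_sign \<omega>) = (\<lambda>x vs. 0)" for v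
  proof (intro ext)
    fix x vs
    \<comment> \<open>Evaluating on arguments already turned once undoes the half turn, leaving the
      plane part itself.\<close>
    have "2 * form_deriv v (plane_part u w \<omega>) x (map ((*v) half_turn) (map ((*v) half_turn) vs)) = 0"
      using fun_cong[OF fun_cong[OF that], of x "map ((*v) half_turn) vs"]
        form_deriv_scale[OF smooth_form_rotate_fibre[OF pl, of half_turn], of v 2]
      by (simp add: flip_sign_def form_deriv_rotate_fibre[OF pl] del: map_map)
         (simp add: rotate_fibre_def pointwise_pullback_def del: map_map)
    then show "form_deriv v (plane_part u w \<omega>) x vs = 0"
      by (simp add: o_def half_turn_involution)
  qed
  show "form_deriv u \<omega> = (\<lambda>x vs. 0)" "form_deriv w \<omega> = (\<lambda>x vs. 0)"
    using plane_part_constant_imp_constant[OF dim_mod_4 orthonormal \<omega> even_forms_bounded[OF assms(1)]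
        form_deriv_bounded[OF assms(1) u_invariant] form_deriv_bounded[OF assms(1) w_invariant] z[OF assms(2)] z[OF assms(3)]]
    by simp_all
qed

lemma reflection_eigenspace:
  assumes "\<omega> \<in> eigenspace \<Gamma> \<mu>" "flip_sign \<omega> = (\<lambda>x vs. 0)"
  shows "rotate_fibre (reflection u) \<omega> \<in> eigenspace \<Gamma> (- \<mu>)"
proof -
  note \<omega> = eigenspaceD[OF assms(1)]
  have "form_deriv u \<omega> = (\<lambda>x vs. 0)"
    by (rule flip_sign_constant_imp_constant(1)[OF \<omega>(1)]) (simp_all add: assms(2) form_deriv_zero)
  then have "signature_operator (rotate_fibre (reflection u) \<omega>) = form_scale (- \<mu>) (rotate_fibre (reflection u) \<omega>)"
    by (intro ext) (simp add: signature_operator_reflection even_formsD(1,2)[OF \<omega>(1)] \<omega>(2),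
        simp add: rotate_fibre_def pointwise_pullback_def form_scale_def)
  moreover have "rotate_fibre (reflection u) \<omega> \<in> even_forms \<Gamma>"
    by (rule rotate_fibre_even_forms[OF \<omega>(1) reflection_commute[OF orthogonal u_invariant]])
  ultimately show ?thesis by (simp add: eigenspace_def)
qed

lemma subspace_eigenspace: "form_space.subspace (eigenspace \<Gamma> \<mu>)"
proof -
  have lc: "(\<lambda>x vs. a * \<omega> x vs + b * \<eta> x vs) \<in> eigenspace \<Gamma> \<mu>"
    if "\<omega> \<in> eigenspace \<Gamma> \<mu>" "\<eta> \<in> eigenspace \<Gamma> \<mu>" for \<omega> \<eta> a b
  proof -
    note \<omega> = eigenspaceD[OF that(1)] and \<eta> = eigenspaceD[OF that(2)]
    show ?thesis
      using even_forms_linear_combination[OF \<omega>(1) \<eta>(1), of a b]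
        signature_operator_linear_combination[OF even_formsD(1,2)[OF \<omega>(1)] even_formsD(1,2)[OF \<eta>(1)], of a b]
      by (simp add: eigenspace_def form_scale_def \<omega>(2) \<eta>(2) algebra_simps)
  qed
  have "(\<lambda>x vs. 0) \<in> even_forms \<Gamma>"
    by (rule even_formsI) (auto simp: smooth_form_def even_form_def alternating_zero C_k_zero)
  moreover have "signature_operator (\<lambda>x vs. 0) = (\<lambda>x vs. 0 :: real)"
    by (subst signature_operator_eq)
       (auto simp: smooth_form_def even_form_def alternating_zero C_k_zero form_deriv_zero
         pointwise_operator_zero[OF pointwise_operator_symbol])
  ultimately have "0 \<in> eigenspace \<Gamma> \<mu>"
    by (simp add: eigenspace_def form_scale_def zero_fun_def)
  then show ?thesis
    using lc[of _ _ 1 1] lc[of _ _ _ 0]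
    by (auto simp: form_space.subspace_def plus_fun_def form_scale_def)
qed

lemma eigenspace_embedding:
  "\<exists>\<Phi>. Vector_Spaces.linear form_scale form_scale \<Phi> \<and> \<Phi> ` eigenspace \<Gamma> \<mu> \<subseteq> eigenspace \<Gamma> (- \<mu>)
     \<and> inj_on \<Phi> (eigenspace \<Gamma> \<mu>)"
proof (rule form_space.embedding_from_two_maps[where T=flip_sign and J="rotate_fibre (reflection u)"])
  let ?J = "rotate_fibre (reflection u)"
  have JJ: "?J (?J \<omega>) = \<omega>" for \<omega>
    by (simp add: rotate_fibre_def pointwise_pullback_def o_def reflection_involution orthonormal)
  have lin: "flip_sign (\<lambda>x vs. a * \<omega> x vs + b * \<eta> x vs)
      = (\<lambda>x vs. a * flip_sign \<omega> x vs + b * flip_sign \<eta> x vs)"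
    if "\<omega> \<in> eigenspace \<Gamma> \<mu>" "\<eta> \<in> eigenspace \<Gamma> \<mu>" for \<omega> \<eta> a b
  proof -
    have sm: "smooth_form \<omega>" "smooth_form \<eta>"
      using that eigenspaceD(1) even_formsD(1) by blast+
    have "form_deriv v (\<lambda>x vs. a * \<omega> x vs + b * \<eta> x vs)
        = (\<lambda>x vs. a * form_deriv v \<omega> x vs + b * form_deriv v \<eta> x vs)" for v
      by (simp add: form_deriv_add smooth_form_scale form_deriv_scale sm)
    then show ?thesis
      by (simp add: flip_sign_def rotate_fibre_def pointwise_pullback_def plane_part_def
          pointwise_operator_linear_combination[OF pointwise_operator_symbol] algebra_simps)
  qed
  show "flip_sign (\<omega> + \<eta>) = flip_sign \<omega> + flip_sign \<eta>"
    if "\<omega> \<in> eigenspace \<Gamma> \<mu>" "\<eta> \<in> eigenspace \<Gamma> \<mu>" for \<omega> \<eta>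
    using lin[OF that, of 1 1] by (simp add: plus_fun_def)
  show "flip_sign (form_scale c \<omega>) = form_scale c (flip_sign \<omega>)" if "\<omega> \<in> eigenspace \<Gamma> \<mu>" for c \<omega>
    using lin[OF that that, of c 0] by (simp add: form_scale_def)
  show "?J (\<omega> + \<eta>) = ?J \<omega> + ?J \<eta>" "?J (form_scale c \<omega>) = form_scale c (?J \<omega>)" for \<omega> \<eta> c
    by (simp_all add: rotate_fibre_def pointwise_pullback_def plus_fun_def form_scale_def)
  show "?J \<omega> \<in> eigenspace \<Gamma> (- \<mu>)" if "\<omega> \<in> eigenspace \<Gamma> \<mu>" "flip_sign \<omega> = 0" for \<omega>
    using reflection_eigenspace[OF that(1)] that(2) by (simp add: zero_fun_def)
  show "\<omega> = 0" if "?J \<omega> = 0" for \<omega>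
  proof -
    have "\<omega> = ?J 0" using JJ[of \<omega>] that by simp
    also have "\<dots> = 0" by (simp add: rotate_fibre_def pointwise_pullback_def zero_fun_def)
    finally show ?thesis .
  qed
  \<comment> \<open>Being in the kernel, \<eta> is constant along the plane, and so is its
    reflection, since derivatives commute with maps of the coefficients. The common value
    \<open>flip_sign \<omega>\<close> is thus constant along the plane, which forces \<omega> to be
    so and \<open>flip_sign \<omega>\<close> to vanish.\<close>
  show "flip_sign \<omega> = 0"
    if "\<omega> \<in> eigenspace \<Gamma> \<mu>" "\<eta> \<in> eigenspace \<Gamma> \<mu>" "flip_sign \<eta> = 0" "flip_sign \<omega> = ?J \<eta>" for \<omega> \<eta>
  proof -
    note \<omega> = eigenspaceD(1)[OF that(1)] and \<eta> = eigenspaceD(1)[OF that(2)]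
    have "flip_sign \<eta> = (\<lambda>x vs. 0)" using that(3) by (simp add: zero_fun_def)
    then have "form_deriv u \<eta> = (\<lambda>x vs. 0)" "form_deriv w \<eta> = (\<lambda>x vs. 0)"
      using flip_sign_constant_imp_constant[OF \<eta>] by (simp_all add: form_deriv_zero)
    then have "form_deriv u (flip_sign \<omega>) = (\<lambda>x vs. 0)" "form_deriv w (flip_sign \<omega>) = (\<lambda>x vs. 0)"
      unfolding that(4) form_deriv_rotate_fibre[OF even_formsD(1)[OF \<eta>]]
      by (simp_all add: rotate_fibre_def pointwise_pullback_def)
    then have "form_deriv u \<omega> = (\<lambda>x vs. 0)" "form_deriv w \<omega> = (\<lambda>x vs. 0)"
      using flip_sign_constant_imp_constant[OF \<omega>] by simp_all
    then show ?thesis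
      by (simp add: flip_sign_def plane_part_def rotate_fibre_def pointwise_pullback_def zero_fun_def
          pointwise_operator_zero[OF pointwise_operator_symbol])
  qed
qed (use subspace_eigenspace flip_sign_eigenspace in auto)

lemma eta_invariant_eq_zero: "eta_invariant \<Gamma> = 0"
proof (rule eta_invariant_zero)
  fix \<mu> :: real
  obtain \<Phi> where \<Phi>: "Vector_Spaces.linear form_scale form_scale \<Phi>" "\<Phi> ` eigenspace \<Gamma> \<mu> \<subseteq> eigenspace \<Gamma> (- \<mu>)"
    "inj_on \<Phi> (eigenspace \<Gamma> \<mu>)"
    using eigenspace_embedding by blast
  obtain \<Psi> where \<Psi>: "Vector_Spaces.linear form_scale form_scale \<Psi>" "\<Psi> ` eigenspace \<Gamma> (- \<mu>) \<subseteq> eigenspace \<Gamma> \<mu>"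
    "inj_on \<Psi> (eigenspace \<Gamma> (- \<mu>))"
    using eigenspace_embedding[of "- \<mu>"] by auto
  show "form_dim (eigenspace \<Gamma> (- \<mu>)) = form_dim (eigenspace \<Gamma> \<mu>)"
    by (rule form_space.mutual_embeddings_imp_dim_eq[OF subspace_eigenspace subspace_eigenspace \<Psi> \<Phi>])
  assume trivial: "eigenspace \<Gamma> \<mu> = {0}"
  have zero: "0 \<in> eigenspace \<Gamma> (- \<mu>)"
    by (rule form_space.subspace_0[OF subspace_eigenspace])
  \<comment> \<open>An injective linear map into the zero space has zero source; equality of
    dimensions would not give this.\<close>
  have "\<Psi> \<omega> = 0" if "\<omega> \<in> eigenspace \<Gamma> (- \<mu>)" for \<omega>
    using subsetD[OF \<Psi>(2) imageI[OF that]] unfolding trivial by simp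
  then have "\<omega> = 0" if "\<omega> \<in> eigenspace \<Gamma> (- \<mu>)" for \<omega>
    using inj_onD[OF \<Psi>(3) _ that zero] that zero by simp
  then show "eigenspace \<Gamma> (- \<mu>) = {0}"
    using zero by (intro equalityI subsetI) simp_all
qed

end

text \<open>Common to both holonomy types: an elementary 2-group of rank k acts by commuting
  orthogonal involutions, which supply the pair u, w.\<close>

lemma eta_invariant_elementary_two_group:
  fixes \<Gamma> :: "'n::{finite,linorder} rigid_motion set"
  assumes n: "CARD('n) mod 4 = 3" and \<Gamma>: "oriented_flat_manifold_group \<Gamma>"
    and iso: "holonomy_group \<Gamma> \<cong> elementary_two_group k"
  shows "eta_invariant \<Gamma> = 0"
proof -
  have sub: "subgroup \<Gamma> euclidean_group" and cc: "cocompact \<Gamma>" and det: "\<And>g. g \<in> \<Gamma> \<Longrightarrow> det (fst g) = 1"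
    using \<Gamma> by (auto simp: oriented_flat_manifold_group_def flat_manifold_group_def)
  have orth: "orthogonal_matrix (fst g)" if "g \<in> \<Gamma>" for g
    using subgroup.mem_carrier[OF sub that] by (simp add: euclidean_group_def)
  have "2 \<le> CARD('n)" using n by presburger
  have o: "orthogonal_matrix A" "A ** A = mat 1" if "A \<in> fst ` \<Gamma>" for A
    using that orth elementary_two_group_holonomy(1)[OF sub iso] by auto
  have comm: "A ** B = B ** A" if "A \<in> fst ` \<Gamma>" "B \<in> fst ` \<Gamma>" for A B
    using that elementary_two_group_holonomy(2)[OF sub iso] by auto
  obtain u w :: "real^'n::_" where "norm u = 1" "norm w = 1" "u \<bullet> w = 0"
    "\<forall>A\<in>fst ` \<Gamma>. A *v u = u \<or> A *v u = - u"
    "\<forall>A\<in>fst ` \<Gamma>. A *v w = w \<or> A *v w = - w"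
    by (rule commuting_involutions_eigenplane[OF \<open>2 \<le> CARD('n)\<close> o comm])
  then interpret invariant_plane \<Gamma> u w
    by unfold_locales (use n cc orth det in auto)
  show ?thesis by (rule eta_invariant_eq_zero)
qed

theorem mainTheorem2:
  fixes \<Gamma> :: "'n::{finite,linorder} rigid_motion set"
  assumes "CARD('n) mod 4 = 3"
    and "oriented_flat_manifold_group \<Gamma>"
  shows "(holonomy_group \<Gamma> \<cong> elementary_two_group (CARD('n) - 1) \<longrightarrow> eta_invariant \<Gamma> = 0) \<and>
    (\<forall>k. 1 \<le> k \<and> k \<le> CARD('n) - 2 \<and> holonomy_group \<Gamma> \<cong> elementary_two_group k \<and>
         (\<exists>b. lattice_basis \<Gamma> b \<and>
              (\<forall>A\<in>carrier (holonomy_group \<Gamma>). sign_diagonal (holonomy_representation \<Gamma> b A)))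
       \<longrightarrow> eta_invariant \<Gamma> = 0)"
  using eta_invariant_elementary_two_group[OF assms] by blast

end
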